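(* Let $d\ge 2$, let $Q_1,Q_2$ be quadratic forms on $\mathbb{R}^d$, let $\Sigma(Q_1,Q_2)$ be the associated quadratic surface of codimension $2$ in $\mathbb{R}^{d+2}$, let $\mathcal{T}=\mathcal{T}_{Q_1,Q_2}$ be the associated restricted $2$-plane transform, and let $C>0$ be fixed. (1) Suppose that $\Sigma(Q_1,Q_2)$ is well-curved. Then for every $1\le p,q\le\infty$ such that $$2+\frac{d}{q}>\frac{d+2}{p}\quad\text{ and }\quad \frac{2}{q}\ge\frac1p,$$ there is a constant $K$ (depending on $p,q,Q_1,Q_2$ and $C$) such that $$\|\mathcal{T}f\|_{L^q(\mathbb{R}^d\times[-1,1]^d)}\le K\,\|f\|_{L^p(\mathbb{R}^{d+2})}$$ for every function $f$ supported in $B(0,C)\times[-1,1]^2$. (2) If instead $\Sigma(Q_1,Q_2)$ is not well-curved (hence flat), then every $L^p\to L^q$ estimate with $(p,q)$ sufficiently close to $\big(\tfrac{d+4}{4},\tfrac{d+4}{2}\big)$ is false; that is, there is a neighbourhood $U$ of $\big(\tfrac{d+4}{4},\tfrac{d+4}{2}\big)$ such that for every $(p,q)\in U$ with $1\le p,q\le\infty$ there is no finite constant $K$ for which $\|\mathcal{T}f\|_{L^q(\mathbb{R}^d\times[-1,1]^d)}\le K\|f\|_{L^p(\mathbb{R}^{d+2})}$ holds for all $f$ supported in $B(0,C)\times[-1,1]^2$.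
   Context: $B(0,C)$ is the ball of radius $C$ centred at $0$ in $\mathbb{R}^d$. Convention: $1/\infty=0$. The operator. For functions $f:\mathbb{R}^{d+2}\to\mathbb{C}$, $$\mathcal{T}f(x,\xi):=\iint_{|s|,|t|\le1}f\big(x-s\nabla Q_1(\xi)-t\nabla Q_2(\xi),s,t\big)\,ds\,dt,\qquad x\in\mathbb{R}^d,\ \xi\in[-1,1]^d.$$ The surface and well-curvedness. Let $\phi(\xi)=(\xi,Q_1(\xi),Q_2(\xi))$, $\xi\in[-1,1]^d$, and $\Sigma(Q_1,Q_2)=\phi([-1,1]^d)\subset\mathbb{R}^{d+2}$. The density with respect to $d\xi$ of Gressman's affine invariant surface measure $\nu$ on $\Sigma(Q_1,Q_2)$ is $$\frac{d\nu}{d\xi}=\Big[\inf_{M\in SL(\mathbb{R}^d)}\Big(\sum_{i_1,\dots,i_d,\,j_1,j_2,\,k_1,k_2=1}^d\big|\det\big(X_{i_1}\phi,\dots,X_{i_d}\phi,\;X_{j_1}X_{j_2}\phi,\;X_{k_1}X_{k_2}\phi\big)\big|^2\Big)^{1/2}\Big]^{d/(d+4)},$$ where $X_i=\sum_{k=1}^dM_{ik}\partial_k$ and derivatives are evaluated at $\xi$. For this $\phi$ it is a constant in $\xi$; with $A=\nabla^2Q_1$, $B=\nabla^2Q_2$ (the constant Hessians), it equals a positive dimensional constant times $$\Big[\inf_{M\in SL(\mathbb{R}^d)}\Big(\sum_{j_1,j_2,k_1,k_2=1}^d\big((MAM^\top)_{j_1j_2}(MBM^\top)_{k_1k_2}-(MAM^\top)_{k_1k_2}(MBM^\top)_{j_1j_2}\big)^2\Big)^{1/2}\Big]^{d/(d+4)}.$$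 The surface $\Sigma(Q_1,Q_2)$ is well-curved if this constant is non-zero, and flat if it is zero. *)

theory Defs
  imports "HOL-Probability.Essential_Supremum"
begin

definition quadratic_form :: "('a::real_vector \<Rightarrow> real) \<Rightarrow> bool" where
  "quadratic_form Q \<longleftrightarrow> (\<exists>b. bilinear b \<and> (\<forall>x. Q x = b x x))"

definition partial :: "'n::finite \<Rightarrow> (real^'n \<Rightarrow> 'b::real_normed_vector) \<Rightarrow> real^'n \<Rightarrow> 'b" where
  "partial k F \<xi> = frechet_derivative F (at \<xi>) (axis k 1)"

definition grad :: "(real^'n \<Rightarrow> real) \<Rightarrow> real^'n \<Rightarrow> real^'n" where
  "grad Q \<xi> = (\<chi> k. partial k Q \<xi>)"

definition unit_cube :: "(real^'n) set" where
  "unit_cube = {\<xi>. \<forall>k. \<xi> $ k \<in> {-1..1}}"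


subsection \<open>Well-curved quadratic surfaces of codimension two\<close>

text \<open>For determinants the ambient space of dimension \<open>d + 2\<close> is indexed by \<open>'n + 2\<close>; elsewhere it is
  the Euclidean product \<open>real^'n \<times> real \<times> real\<close>.\<close>

definition surface_param ::
    "(real^'n \<Rightarrow> real) \<Rightarrow> (real^'n \<Rightarrow> real) \<Rightarrow> real^'n \<Rightarrow> real^('n + 2)" where
  "surface_param Q1 Q2 \<xi> =
     (\<chi> r. case r of Inl k \<Rightarrow> \<xi> $ k | Inr c \<Rightarrow> if c = 0 then Q1 \<xi> else Q2 \<xi>)"

definition frame_deriv ::
    "real^'n^'n \<Rightarrow> 'n::finite \<Rightarrow> (real^'n \<Rightarrow> 'b::real_normed_vector) \<Rightarrow> real^'n \<Rightarrow> 'b" where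
  "frame_deriv M i F \<xi> = (\<Sum>k\<in>UNIV. M $ i $ k *\<^sub>R partial k F \<xi>)"

text \<open>The vectors are the rows of the matrix; \<open>i\<close> is the multi-index \<open>(i\<^sub>1, \<dots>, i\<^sub>d)\<close>.\<close>

definition frame_matrix ::
    "(real^'n \<Rightarrow> real^('n + 2)) \<Rightarrow> real^'n \<Rightarrow> real^'n^'n \<Rightarrow>
     ('n \<Rightarrow> 'n) \<Rightarrow> 'n \<Rightarrow> 'n \<Rightarrow> 'n \<Rightarrow> 'n \<Rightarrow> real^('n + 2)^('n + 2)" where
  "frame_matrix \<phi> \<xi> M i j1 j2 k1 k2 =
     (\<chi> r. case r of
        Inl m \<Rightarrow> frame_deriv M (i m) \<phi> \<xi>
      | Inr c \<Rightarrow>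
          if c = 0 then frame_deriv M j1 (frame_deriv M j2 \<phi>) \<xi>
          else frame_deriv M k1 (frame_deriv M k2 \<phi>) \<xi>)"

definition affine_density :: "(real^'n \<Rightarrow> real^('n + 2)) \<Rightarrow> real^'n \<Rightarrow> real" where
  "affine_density \<phi> \<xi> =
     (INF M\<in>{M :: real^'n^'n. det M = 1}.
        sqrt (\<Sum>i\<in>UNIV. \<Sum>j1\<in>UNIV. \<Sum>j2\<in>UNIV. \<Sum>k1\<in>UNIV. \<Sum>k2\<in>UNIV.
                \<bar>det (frame_matrix \<phi> \<xi> M i j1 j2 k1 k2)\<bar>\<^sup>2))
     powr (real CARD('n) / (real CARD('n) + 4))"

definition well_curved :: "(real^'n \<Rightarrow> real) \<Rightarrow> (real^'n \<Rightarrow> real) \<Rightarrow> bool" where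
  "well_curved Q1 Q2 \<longleftrightarrow>
     (\<exists>c. c \<noteq> 0 \<and> (\<forall>\<xi>\<in>unit_cube. affine_density (surface_param Q1 Q2) \<xi> = c))"

definition flat :: "(real^'n \<Rightarrow> real) \<Rightarrow> (real^'n \<Rightarrow> real) \<Rightarrow> bool" where
  "flat Q1 Q2 \<longleftrightarrow> (\<forall>\<xi>\<in>unit_cube. affine_density (surface_param Q1 Q2) \<xi> = 0)"


subsection \<open>The density is constant on a quadratic surface\<close>

lemma frame_deriv_eq:
  assumes "(F has_derivative F') (at \<xi>)"
  shows "frame_deriv M i F \<xi> = F' (M $ i)"
proof -
  have lin: "linear F'"
    using assms has_derivative_linear by blast
  have "frame_deriv M i F \<xi> = (\<Sum>k\<in>UNIV. F' (M $ i $ k *\<^sub>R axis k 1))"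
    unfolding frame_deriv_def partial_def frechet_derivative_at[OF assms, symmetric]
    by (simp add: linear_cmul[OF lin])
  also have "\<dots> = F' (\<Sum>k\<in>UNIV. M $ i $ k *\<^sub>R axis k 1)"
    by (simp add: linear_sum[OF lin])
  also have "(\<Sum>k\<in>UNIV. M $ i $ k *\<^sub>R axis k 1) = M $ i"
    using basis_expansion[of "M $ i"] by (simp add: scalar_mult_eq_scaleR)
  finally show ?thesis .
qed

lemma has_derivative_vecI:
  fixes F :: "'a::real_normed_vector \<Rightarrow> real^'m"
  assumes "\<And>r. ((\<lambda>x. F x $ r) has_derivative (\<lambda>h. F' h $ r)) (at x)"
  shows "(F has_derivative F') (at x)"
  by (subst has_derivative_componentwise_within) (auto simp: Basis_vec_def inner_axis assms)

definition surface_shear ::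
    "(real^'n \<Rightarrow> real^'n \<Rightarrow> real) \<Rightarrow> (real^'n \<Rightarrow> real^'n \<Rightarrow> real) \<Rightarrow> real^'n \<Rightarrow>
     real^('n + 2) \<Rightarrow> real^('n + 2)" where
  "surface_shear P1 P2 \<xi> v =
     (\<chi> r. case r of Inl k \<Rightarrow> v $ r
        | Inr c \<Rightarrow> v $ r + (if c = 0 then P1 else P2) \<xi> (\<chi> k. v $ Inl k))"

lemma
  fixes P1 P2 :: "real^'n \<Rightarrow> real^'n \<Rightarrow> real"
  assumes "bilinear P1" and "bilinear P2"
  shows linear_surface_shear: "linear (surface_shear P1 P2 \<xi>)"
    and det_surface_shear: "\<bar>det (matrix (surface_shear P1 P2 \<xi>))\<bar> = 1"
proof -
  let ?L = "surface_shear P1 P2"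
  let ?D = "\<lambda>v :: real^('n + 2). \<chi> r. case r of Inl k \<Rightarrow> v $ r | Inr c \<Rightarrow> - (v $ r)"
  have add: "(\<chi> k. (v + w) $ Inl k) = (\<chi> k. v $ Inl k) + (\<chi> k. w $ Inl k)"
    for v w :: "real^('n + 2)"
    by (simp add: vec_eq_iff)
  have scale: "(\<chi> k. (a *\<^sub>R v) $ Inl k) = a *\<^sub>R (\<chi> k. v $ Inl k)"
    for a and v :: "real^('n + 2)"
    by (simp add: vec_eq_iff)
  have lin: "linear (?L \<xi>)" for \<xi>
    unfolding surface_shear_def
    by (rule linearI)
       (simp_all only: add scale, auto simp: vec_eq_iff algebra_simps split: sum.splits
         simp: bilinear_radd[OF assms(1)] bilinear_radd[OF assms(2)]
           bilinear_rmul[OF assms(1)] bilinear_rmul[OF assms(2)])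
  have linD: "linear ?D"
    by (rule linearI) (auto simp: vec_eq_iff split: sum.splits)
  have inv: "?L (- \<xi>) \<circ> ?L \<xi> = id"
    by (auto simp: fun_eq_iff vec_eq_iff surface_shear_def bilinear_lneg[OF assms(1)]
        bilinear_lneg[OF assms(2)] split: sum.splits)
  have conj: "?D \<circ> (?L \<xi> \<circ> ?D) = ?L (- \<xi>)"
    by (auto simp: fun_eq_iff vec_eq_iff surface_shear_def bilinear_lneg[OF assms(1)]
        bilinear_lneg[OF assms(2)] split: sum.splits)
  have invD: "?D \<circ> ?D = id"
    by (auto simp: fun_eq_iff vec_eq_iff split: sum.splits)
  have 1: "det (matrix (?L (- \<xi>))) * det (matrix (?L \<xi>)) = 1"
    by (simp only: inv matrix_id flip: det_mul matrix_compose[OF lin lin])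
  have 2: "det (matrix ?D) * det (matrix ?D) = 1"
    by (simp only: invD matrix_id flip: det_mul matrix_compose[OF linD linD])
  have "matrix (?L (- \<xi>)) = matrix ?D ** (matrix (?L \<xi>) ** matrix ?D)"
    unfolding conj[symmetric]
    by (simp add: matrix_compose[OF linear_compose[OF linD lin] linD] matrix_compose[OF linD lin])
  then have "det (matrix (?L (- \<xi>))) = det (matrix (?L \<xi>))"
    using 2 by (simp add: det_mul)
  with 1 have "(det (matrix (?L \<xi>)))\<^sup>2 = 1"
    by (simp add: power2_eq_square)
  then show "\<bar>det (matrix (?L \<xi>))\<bar> = 1"
    by (auto simp: power2_eq_1_iff)
  show "linear (?L \<xi>)" by (rule lin)
qed

lemma affine_density_surface_param_const:
  fixes Q1 Q2 :: "real^'n \<Rightarrow> real"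
  assumes "quadratic_form Q1" and "quadratic_form Q2"
  shows "affine_density (surface_param Q1 Q2) \<xi> = affine_density (surface_param Q1 Q2) \<eta>"
proof -
  obtain b1 b2 where b: "bilinear b1" "bilinear b2"
    and Q: "Q1 = (\<lambda>x. b1 x x)" "Q2 = (\<lambda>x. b2 x x)"
    using assms unfolding quadratic_form_def fun_eq_iff by metis
  define P1 where "P1 x y = b1 x y + b1 y x" for x y
  define P2 where "P2 x y = b2 x y + b2 y x" for x y
  let ?\<phi> = "surface_param Q1 Q2"
  let ?e = "\<lambda>x y h. \<chi> r. case r of Inl k \<Rightarrow> h $ k | Inr c \<Rightarrow> if c = (0::2) then x else (y::real)"
  have P: "bilinear P1" "bilinear P2"
    using b unfolding bilinear_def P1_def P2_def
    by (auto intro: linear_compose_add)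
  have bb: "bounded_bilinear b1" "bounded_bilinear b2" "bounded_bilinear P1" "bounded_bilinear P2"
    using b P by (auto simp: bilinear_conv_bounded_bilinear)
  have dQ: "(Q1 has_derivative (\<lambda>h. P1 x h)) (at x)" "(Q2 has_derivative (\<lambda>h. P2 x h)) (at x)" for x
    unfolding Q P1_def P2_def
    by (rule bounded_bilinear.FDERIV[OF bb(1) has_derivative_ident has_derivative_ident]
         bounded_bilinear.FDERIV[OF bb(2) has_derivative_ident has_derivative_ident])+
  have d\<phi>: "(?\<phi> has_derivative (\<lambda>h. ?e (P1 x h) (P2 x h) h)) (at x)" for x
    unfolding surface_param_def
  proof (rule has_derivative_vecI)
    fix r :: "'n + 2"
    show "((\<lambda>x. (\<chi> r. case r of Inl k \<Rightarrow> x $ k | Inr c \<Rightarrow> if c = 0 then Q1 x else Q2 x) $ r)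
        has_derivative (\<lambda>h. ?e (P1 x h) (P2 x h) h $ r)) (at x)"
      by (cases r; cases "projr r = 0") (auto intro!: dQ bounded_linear_imp_has_derivative bounded_linear_vec_nth)
  qed
  have X: "frame_deriv M i ?\<phi> = (\<lambda>x. ?e (P1 x (M $ i)) (P2 x (M $ i)) (M $ i))" for M i
    by (simp add: fun_eq_iff frame_deriv_eq[OF d\<phi>])
  have dX: "(frame_deriv M i ?\<phi> has_derivative (\<lambda>h. ?e (P1 h (M $ i)) (P2 h (M $ i)) 0)) (at x)"
    for M i x
    unfolding X
  proof (rule has_derivative_vecI)
    fix r :: "'n + 2"
    show "((\<lambda>x. ?e (P1 x (M $ i)) (P2 x (M $ i)) (M $ i) $ r)
        has_derivative (\<lambda>h. ?e (P1 h (M $ i)) (P2 h (M $ i)) 0 $ r)) (at x)"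
      by (cases r; cases "projr r = 0")
         (auto intro!: bounded_linear_imp_has_derivative
            bounded_bilinear.bounded_linear_left[OF bb(3)]
            bounded_bilinear.bounded_linear_left[OF bb(4)])
  qed
  have XX: "frame_deriv M j (frame_deriv M i ?\<phi>) x = ?e (P1 (M $ j) (M $ i)) (P2 (M $ j) (M $ i)) 0"
    for M i j x
    by (rule frame_deriv_eq[OF dX])
  have det_eq: "det (frame_matrix ?\<phi> x M i j1 j2 k1 k2) =
        det (matrix (surface_shear P1 P2 x)) * det (frame_matrix ?\<phi> 0 M i j1 j2 k1 k2)"
    for x M i j1 j2 k1 k2
  proof -
    let ?S = "surface_shear P1 P2 x" and ?R = "frame_matrix ?\<phi> 0 M i j1 j2 k1 k2"
    have S: "matrix ?S *v v = ?S v" for v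
      by (simp only: matrix_vector_mul(2)[OF linear_surface_shear[OF P]])
    have "frame_matrix ?\<phi> x M i j1 j2 k1 k2 $ r = matrix ?S *v (?R $ r)" for r
      unfolding S frame_matrix_def XX unfolding X
      by (auto simp: surface_shear_def vec_eq_iff split: sum.splits
          simp: bilinear_rzero[OF P(1)] bilinear_rzero[OF P(2)]
            bilinear_lzero[OF P(1)] bilinear_lzero[OF P(2)] zero_vec_def[symmetric])
    then have "frame_matrix ?\<phi> x M i j1 j2 k1 k2 = transpose (matrix ?S ** transpose ?R)"
      by (simp add: vec_eq_iff transpose_def matrix_matrix_mult_def matrix_vector_mult_def)
    then show ?thesis
      by (simp add: det_mul)
  qed
  have *: "\<bar>det (frame_matrix ?\<phi> x M i j1 j2 k1 k2)\<bar> = \<bar>det (frame_matrix ?\<phi> 0 M i j1 j2 k1 k2)\<bar>"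
    for x M i j1 j2 k1 k2
    by (subst det_eq) (simp only: abs_mult det_surface_shear[OF P] mult_1_left)
  show ?thesis
    unfolding affine_density_def *[of \<xi>] *[of \<eta>] ..
qed

lemma not_well_curved_iff_flat:
  fixes Q1 Q2 :: "real^'n \<Rightarrow> real"
  assumes "quadratic_form Q1" and "quadratic_form Q2"
  shows "\<not> well_curved Q1 Q2 \<longleftrightarrow> flat Q1 Q2"
proof -
  have "0 \<in> (unit_cube :: (real^'n) set)"
    by (simp add: unit_cube_def)
  then show ?thesis
    unfolding well_curved_def flat_def
    using affine_density_surface_param_const[OF assms] by metis
qed


subsection \<open>The restricted 2-plane transform and its estimates\<close>

definition plane_transform ::
    "(real^'n \<Rightarrow> real) \<Rightarrow> (real^'n \<Rightarrow> real) \<Rightarrow> ((real^'n) \<times> real \<times> real \<Rightarrow> complex) \<Rightarrow>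
     (real^'n) \<times> (real^'n) \<Rightarrow> complex" where
  "plane_transform Q1 Q2 f = (\<lambda>(x, \<xi>).
     LINT (s, t) : {-1..1} \<times> {-1..1} | lebesgue.
       f (x - s *\<^sub>R grad Q1 \<xi> - t *\<^sub>R grad Q2 \<xi>, s, t))"

definition Lp_norm :: "ennreal \<Rightarrow> 'a measure \<Rightarrow> ('a \<Rightarrow> complex) \<Rightarrow> ennreal" where
  "Lp_norm p M f =
     (if p = \<infinity> then esssup M (\<lambda>x. ennreal (norm (f x)))
      else let I = (\<integral>\<^sup>+x. ennreal (norm (f x) powr enn2real p) \<partial>M)
           in if I = \<infinity> then \<infinity> else ennreal (enn2real I powr (1 / enn2real p)))"

text \<open>For \<open>f\<close> of finite norm the integral defining the transform converges absolutely at almost every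
  point, so the value 0 that the Bochner integral takes elsewhere has no effect on the left-hand side.\<close>

definition plane_transform_estimate ::
    "(real^'n \<Rightarrow> real) \<Rightarrow> (real^'n \<Rightarrow> real) \<Rightarrow> real \<Rightarrow> ennreal \<Rightarrow> ennreal \<Rightarrow> real \<Rightarrow> bool" where
  "plane_transform_estimate Q1 Q2 C p q K \<longleftrightarrow>
     (\<forall>f. f \<in> borel_measurable lebesgue \<longrightarrow> Lp_norm p lebesgue f < \<infinity> \<longrightarrow>
        (\<forall>z. z \<notin> ball 0 C \<times> {-1..1} \<times> {-1..1} \<longrightarrow> f z = 0) \<longrightarrow>
        Lp_norm q (lebesgue_on (UNIV \<times> unit_cube)) (plane_transform Q1 Q2 f)
          \<le> ennreal K * Lp_norm p lebesgue f)"

end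

theory Submission
  imports Defs "HOL-Computational_Algebra.Polynomial"
begin

text \<open>
Write \<open>A\<close> and \<open>B\<close> for the Hessians of the two quadratic forms, so that the point over \<open>(s, t)\<close> of the
plane with parameters \<open>(x, \<xi>)\<close> is \<open>(x - (s A + t B) \<xi>, s, t)\<close>. Everything is decided by the binary form
\<open>D (s, t) = det (s A + t B)\<close> of degree \<open>d\<close>: the surface is flat exactly if \<open>D\<close> vanishes to order greater
than \<open>d / 2\<close> along some line through the origin (possibly identically).

\<^bold>\<open>The criterion.\<close> The affine density is, up to a constant factor, a positive power of the infimum of \<open>\<bar>A \<and> B\<bar>\<close> over all congruences by
matrices of determinant one (\<open>well_curved_iff_not_unstable\<close>); the pair is called unstable if this infimum is
zero, which is instability in the sense of geometric invariant theory. The equivalence with multiple roots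
(\<open>unstable_pair_iff_deep_root\<close>) is proved by hand. If \<open>\<bar>A \<and> B\<bar>\<close> is small, subtracting from the shorter matrix
its projection to the longer one leaves matrices of norms \<open>a \<ge> b\<close> with \<open>a b\<close> small. The coefficient of
\<open>s^k\<close> in \<open>det (B + s A)\<close> is of size \<open>a^k b^(d - k)\<close>, hence small for \<open>k \<le> d / 2\<close>, and it does not change under
the congruences; by compactness some combination \<open>B + c A\<close> has coefficients exactly zero. Conversely, a pivoting
procedure turns the order of vanishing into a basis with weights \<open>w\<close> of sum greater than \<open>d / 4\<close>
such that \<open>A\<close> only has entries \<open>(i, j)\<close> with \<open>w i + w j \<le> 1\<close> and \<open>B\<close> only those with \<open>w i + w j \<le> 0\<close>
(\<open>vanishing_weighted\<close>); scaling the basis by powers of \<open>\<epsilon>\<close> given by these weights sends the wedge to zero.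

\<^bold>\<open>Unstable pairs.\<close> The same weights give a Knapp example: boxes with sides \<open>\<epsilon>^(w i)\<close> in \<open>x\<close> and \<open>\<epsilon>^(- w i)\<close> in
\<open>\<xi>\<close>, shrunk by a common power of \<open>\<epsilon>\<close>, and a parallelogram of sides comparable to \<open>\<epsilon>\<close> and \<open>1\<close> in \<open>(s, t)\<close>.
The transform of the indicator of a box is constant on another box, and comparing powers of \<open>\<epsilon>\<close> refutes every
estimate near \<open>((d + 4) / 4, (d + 4) / 2)\<close>, precisely because the weights have sum greater than \<open>d / 4\<close>
(\<open>unstable_pair_no_estimate\<close>).

\<^bold>\<open>Stable pairs.\<close> For two parameter values \<open>\<sigma>\<close> and \<open>\<tau>\<close>, the map that sends a plane to its two points over \<open>\<sigma>\<close>
and \<open>\<tau>\<close> has Jacobian \<open>\<bar>D (\<sigma> - \<tau>)\<bar>\<close>. Hence, with the weight \<open>\<bar>D (\<sigma> - \<tau>)\<bar>\<close>, the square of an average over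
planes is controlled by the square of the mass of the function (\<open>bilinear_plane_bound\<close>). Since no line is a root
of multiplicity greater than \<open>d / 2\<close>, the power \<open>\<bar>D\<bar>^(-b)\<close> is locally integrable for \<open>b < 2 / d\<close>, so \<open>D\<close> is small
only on small sets of parameters and the weight can be removed. This gives
\<open>\<integral> G^(2 + 1 / b) \<le> c \<bar>E\<bar>^2\<close> for the averages \<open>G\<close> of the indicator of a set \<open>E\<close>
(\<open>restricted_plane_estimate\<close>), a family of estimates that approaches the critical exponents as \<open>b\<close> tends to
\<open>2 / d\<close>. Interpolating with the trivial bound for \<open>\<integral> G\<close> and summing over the superlevel sets of a function gives
a strong type estimate with a small loss (\<open>plane_average_strong_type\<close>), which the strict inequality
between the exponents pays for. Smaller exponents \<open>q\<close> follow because the transform lives on a set of finite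
measure.
\<close>

section \<open>Determinants of block diagonal matrices\<close>

definition block_diag :: "real^'n^'n \<Rightarrow> real^'m^'m \<Rightarrow> real^('n + 'm)^('n + 'm)" where
  "block_diag X Y = (\<chi> r c. case r of
      Inl i \<Rightarrow> (case c of Inl j \<Rightarrow> X $ i $ j | Inr _ \<Rightarrow> 0)
    | Inr i \<Rightarrow> (case c of Inl _ \<Rightarrow> 0 | Inr j \<Rightarrow> Y $ i $ j))"

lemma block_diag_nth [simp]:
  "block_diag X Y $ Inl i $ Inl j = X $ i $ j"
  "block_diag X Y $ Inl i $ Inr l = 0"
  "block_diag X Y $ Inr k $ Inl j = 0"
  "block_diag X Y $ Inr k $ Inr l = Y $ k $ l"
  by (simp_all add: block_diag_def)

lemma prod_UNIV_sum_type: 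
  fixes f :: "'n::finite + 'm::finite \<Rightarrow> real"
  shows "prod f UNIV = (\<Prod>i\<in>UNIV. f (Inl i)) * (\<Prod>j\<in>UNIV. f (Inr j))"
  by (simp add: UNIV_Plus_UNIV[symmetric] prod.Plus comp_def del: UNIV_Plus_UNIV)

text \<open>A row operation on the upper block is a row operation on the whole matrix, so the induction over row operations
  reduces the claim to a diagonal upper block. It ends with a diagonal matrix only if the lower block is diagonal as
  well; a second induction, now on the lower block, removes this restriction.\<close>

lemma det_block_diag_diagonal:
  fixes X :: "real^'n^'n" and Y :: "real^'m^'m"
  assumes Y: "\<And>i j. i \<noteq> j \<Longrightarrow> Y $ i $ j = 0"
  shows "det (block_diag X Y) = det X * det Y"
proof (rule induct_matrix_row_operations[where P="\<lambda>X. det (block_diag X Y) = det X * det Y"])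
  fix A :: "real^'n^'n" and i assume "row i A = 0"
  then have "row i A = 0" and "row (Inl i) (block_diag A Y) = 0"
    by (auto simp: row_def vec_eq_iff block_diag_def split: sum.splits)
  then have "det A = 0" "det (block_diag A Y) = 0"
    by (auto intro: det_zero_row(1) simp: row_def)
  then show "det (block_diag A Y) = det A * det Y" by simp
next
  fix A :: "real^'n^'n" assume A: "\<And>i j. i \<noteq> j \<Longrightarrow> A $ i $ j = 0"
  have *: "block_diag A Y $ r $ c = 0" if "r \<noteq> c" for r c
    using that A Y by (cases r; cases c) auto
  show "det (block_diag A Y) = det A * det Y"
    by (simp add: det_diagonal[OF *] det_diagonal[OF A] det_diagonal[OF Y] prod_UNIV_sum_type)
next
  fix A :: "real^'n^'n" and m n :: 'n
  assume IH: "det (block_diag A Y) = det A * det Y" and "m \<noteq> n"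
  let ?p = "Transposition.transpose m n" and ?q = "Transposition.transpose (Inl m) (Inl n :: 'n + 'm)"
  have p: "?p permutes UNIV" "?q permutes UNIV" by (simp_all add: permutes_swap_id)
  have "block_diag (\<chi> i j. A $ i $ ?p j) Y = (\<chi> i j. block_diag A Y $ i $ ?q j)"
    apply (simp add: vec_eq_iff, intro allI)
    subgoal for r c by (cases r; cases c) (auto simp: Transposition.transpose_def)
    done
  then show "det (block_diag (\<chi> i j. A $ i $ ?p j) Y) = det (\<chi> i j. A $ i $ ?p j) * det Y"
    using det_permute_columns[OF p(1), of A] det_permute_columns[OF p(2), of "block_diag A Y"] IH \<open>m \<noteq> n\<close>
    by (simp add: sign_swap_id)
next
  fix A :: "real^'n^'n" and m n :: 'n and c :: real
  assume IH: "det (block_diag A Y) = det A * det Y" and "m \<noteq> n"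
  have "block_diag (\<chi> i. if i = m then row m A + c *\<^sub>R row n A else row i A) Y =
     (\<chi> i. if i = Inl m then row (Inl m) (block_diag A Y) + c *s row (Inl n) (block_diag A Y) else row i (block_diag A Y))"
    by (auto simp: vec_eq_iff row_def block_diag_def split: sum.splits)
  then show "det (block_diag (\<chi> i. if i = m then row m A + c *\<^sub>R row n A else row i A) Y) =
       det (\<chi> i. if i = m then row m A + c *\<^sub>R row n A else row i A) * det Y"
    using det_row_operation[of m n A c] det_row_operation[of "Inl m" "Inl n" "block_diag A Y" c] IH \<open>m \<noteq> n\<close>
    by (simp add: scalar_mult_eq_scaleR cong: if_cong)
qed

lemma det_block_diag:
  fixes X :: "real^'n^'n" and Y :: "real^'m^'m"
  shows "det (block_diag X Y) = det X * det Y"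
proof (rule induct_matrix_row_operations[where P="\<lambda>Y. det (block_diag X Y) = det X * det Y"])
  fix A :: "real^'m^'m" and i assume "row i A = 0"
  then have "row i A = 0" and "row (Inr i) (block_diag X A) = 0"
    by (auto simp: row_def vec_eq_iff block_diag_def split: sum.splits)
  then have "det A = 0" "det (block_diag X A) = 0"
    by (auto intro: det_zero_row(1) simp: row_def)
  then show "det (block_diag X A) = det X * det A" by simp
next
  fix A :: "real^'m^'m" assume A: "\<And>i j. i \<noteq> j \<Longrightarrow> A $ i $ j = 0"
  then show "det (block_diag X A) = det X * det A"
    by (rule det_block_diag_diagonal)
next
  fix A :: "real^'m^'m" and m n :: 'm
  assume IH: "det (block_diag X A) = det X * det A" and "m \<noteq> n"
  let ?p = "Transposition.transpose m n" and ?q = "Transposition.transpose (Inr m) (Inr n :: 'n + 'm)"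
  have p: "?p permutes UNIV" "?q permutes UNIV" by (simp_all add: permutes_swap_id)
  have "block_diag X (\<chi> i j. A $ i $ ?p j) = (\<chi> i j. block_diag X A $ i $ ?q j)"
    apply (simp add: vec_eq_iff, intro allI)
    subgoal for r c by (cases r; cases c) (auto simp: Transposition.transpose_def)
    done
  then show "det (block_diag X (\<chi> i j. A $ i $ ?p j)) = det X * det (\<chi> i j. A $ i $ ?p j)"
    using det_permute_columns[OF p(1), of A] det_permute_columns[OF p(2), of "block_diag X A"] IH \<open>m \<noteq> n\<close>
    by (simp add: sign_swap_id)
next
  fix A :: "real^'m^'m" and m n :: 'm and c :: real
  assume IH: "det (block_diag X A) = det X * det A" and "m \<noteq> n"
  have "block_diag X (\<chi> i. if i = m then row m A + c *\<^sub>R row n A else row i A) =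
     (\<chi> i. if i = Inr m then row (Inr m) (block_diag X A) + c *s row (Inr n) (block_diag X A) else row i (block_diag X A))"
    by (auto simp: vec_eq_iff row_def block_diag_def split: sum.splits)
  then show "det (block_diag X (\<chi> i. if i = m then row m A + c *\<^sub>R row n A else row i A)) =
       det X * det (\<chi> i. if i = m then row m A + c *\<^sub>R row n A else row i A)"
    using det_row_operation[of m n A c] det_row_operation[of "Inr m" "Inr n" "block_diag X A" c] IH \<open>m \<noteq> n\<close>
    by (simp add: scalar_mult_eq_scaleR cong: if_cong)
qed

section \<open>The affine density in terms of the Hessians\<close>

text \<open>The matrix is the polarisation of the form on coordinate vectors; it is the Hessian, which explains the factor \<open>1 / 2\<close>.\<close>

lemma quadratic_form_hessian:
  fixes Q :: "real^'n \<Rightarrow> real"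
  assumes "quadratic_form Q"
  obtains A :: "real^'n^'n" where "transpose A = A" "\<And>x. Q x = (x \<bullet> (A *v x)) / 2"
proof -
  obtain b where b: "bilinear b" "\<And>x. Q x = b x x"
    using assms unfolding quadratic_form_def by blast
  define P where "P x y = b x y + b y x" for x y
  define A where "A = (\<chi> i j. P (axis i 1) (axis j 1))"
  have lin: "linear (P x)" "linear (\<lambda>y. P y x)" for x
    using b(1) unfolding bilinear_def P_def by (auto intro: linear_compose_add)
  have Ax: "(A *v x) $ i = P (axis i 1) x" for i x
  proof -
    have "(A *v x) $ i = (\<Sum>j\<in>UNIV. P (axis i 1) (x $ j *\<^sub>R axis j 1))"
      by (simp add: A_def matrix_vector_mult_def linear_cmul[OF lin(1)] mult.commute)
    also have "\<dots> = P (axis i 1) x"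
      using basis_expansion[of x] linear_sum[OF lin(1), of "axis i 1" "\<lambda>j. x $ j *\<^sub>R axis j 1" UNIV]
      by (simp add: scalar_mult_eq_scaleR)
    finally show ?thesis .
  qed
  have "y \<bullet> (A *v x) = P y x" for x y
  proof -
    have "y \<bullet> (A *v x) = (\<Sum>i\<in>UNIV. P (y $ i *\<^sub>R axis i 1) x)"
      by (simp add: inner_vec_def Ax linear_cmul[OF lin(2)])
    also have "\<dots> = P y x"
      using basis_expansion[of y] linear_sum[OF lin(2), of "\<lambda>j. y $ j *\<^sub>R axis j 1" UNIV x]
      by (simp add: scalar_mult_eq_scaleR)
    finally show ?thesis .
  qed
  then have "Q x = (x \<bullet> (A *v x)) / 2" for x
    by (simp add: P_def b)
  moreover have "transpose A = A"
    by (simp add: A_def transpose_def vec_eq_iff P_def add.commute)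
  ultimately show thesis using that by blast
qed

lemma symmetric_matrix_inner:
  fixes A :: "real^'n^'n"
  assumes "transpose A = A"
  shows "x \<bullet> (A *v y) = (A *v x) \<bullet> y"
  unfolding dot_lmul_matrix[symmetric]
  by (subst assms[symmetric]) (simp only: vector_transpose_matrix)

lemma has_derivative_quadratic:
  fixes A :: "real^'n^'n"
  assumes "transpose A = A" "\<And>x. Q x = (x \<bullet> (A *v x)) / 2"
  shows "(Q has_derivative (\<lambda>h. (A *v x) \<bullet> h)) (at x)"
proof -
  have "((\<lambda>x. (x \<bullet> (A *v x)) / 2) has_derivative
      (\<lambda>h. (x \<bullet> (A *v h) + h \<bullet> (A *v x)) / 2)) (at x)"
    by (rule bounded_linear.has_derivative[OF bounded_linear_divide
          has_derivative_inner[OF has_derivative_ident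
            bounded_linear_imp_has_derivative[OF matrix_vector_mul_bounded_linear]]])
  also have "(\<lambda>h. (x \<bullet> (A *v h) + h \<bullet> (A *v x)) / 2) = (\<lambda>h. (A *v x) \<bullet> h)"
    by (simp add: fun_eq_iff symmetric_matrix_inner[OF assms(1), of x] inner_commute[of _ "A *v x"])
  finally show ?thesis
    by (simp add: assms(2) [abs_def])
qed

lemma grad_quadratic:
  fixes A :: "real^'n^'n"
  assumes "transpose A = A" "\<And>x. Q x = (x \<bullet> (A *v x)) / 2"
  shows "grad Q x = A *v x"
  unfolding grad_def partial_def
  by (simp add: frechet_derivative_at[OF has_derivative_quadratic[OF assms], symmetric]
      vec_eq_iff inner_axis)

text \<open>The Gram matrix of the bilinear form \<open>A\<close> on the rows of \<open>M\<close>.\<close>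

definition congr_by :: "real^'n^'n \<Rightarrow> real^'n^'n \<Rightarrow> real^'n^'n" where
  "congr_by M A = M ** A ** transpose M"

text \<open>Up to the factor 2 that comes from summing over ordered pairs of entries, this is the squared norm of \<open>A \<and> B\<close>.\<close>

definition pair_wedge :: "real^'n^'n \<Rightarrow> real^'n^'n \<Rightarrow> real" where
  "pair_wedge A B = (\<Sum>j1\<in>UNIV. \<Sum>j2\<in>UNIV. \<Sum>k1\<in>UNIV. \<Sum>k2\<in>UNIV.
     (A $ j1 $ j2 * B $ k1 $ k2 - A $ k1 $ k2 * B $ j1 $ j2)\<^sup>2)"

text \<open>In the terms of geometric invariant theory: zero lies in the closure of the orbit of \<open>A \<and> B\<close> under the special
  linear group.\<close>

definition unstable_pair :: "real^'n^'n \<Rightarrow> real^'n^'n \<Rightarrow> bool" where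
  "unstable_pair A B \<longleftrightarrow>
     (\<forall>\<epsilon>>0. \<exists>M. det M = 1 \<and> pair_wedge (congr_by M A) (congr_by M B) < \<epsilon>)"

lemma congr_by_nth: "congr_by M A $ i $ j = M $ i \<bullet> (A *v M $ j)"
proof -
  have "(M ** A ** transpose M) $ i $ j = (\<Sum>l\<in>UNIV. \<Sum>k\<in>UNIV. M $ i $ k * A $ k $ l * M $ j $ l)"
    by (simp add: matrix_matrix_mult_def transpose_def sum_distrib_right)
  also have "\<dots> = (\<Sum>k\<in>UNIV. \<Sum>l\<in>UNIV. M $ i $ k * A $ k $ l * M $ j $ l)"
    by (rule sum.swap)
  also have "\<dots> = M $ i \<bullet> (A *v M $ j)"
    by (simp add: inner_vec_def matrix_vector_mult_def sum_distrib_left mult_ac)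
  finally show ?thesis unfolding congr_by_def .
qed

lemma pair_wedge_nonneg: "0 \<le> pair_wedge A B"
  unfolding pair_wedge_def by (intro sum_nonneg) auto

text \<open>At the origin the forms have gradient zero and the second derivatives of the parametrisation only have the
  two normal components. The frame matrix is therefore block diagonal, and its lower block is a 2 by 2 determinant of
  second derivatives along the frame.\<close>

lemma det_frame_matrix_zero:
  fixes A B :: "real^'n^'n"
  assumes A: "transpose A = A" "\<And>x. Q1 x = (x \<bullet> (A *v x)) / 2"
    and B: "transpose B = B" "\<And>x. Q2 x = (x \<bullet> (B *v x)) / 2"
  shows "det (frame_matrix (surface_param Q1 Q2) 0 M i j1 j2 k1 k2) =
     det (\<chi> m. M $ i m) * (congr_by M A $ j1 $ j2 * congr_by M B $ k1 $ k2
        - congr_by M A $ k1 $ k2 * congr_by M B $ j1 $ j2)"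
proof -
  let ?\<phi> = "surface_param Q1 Q2"
  let ?e = "\<lambda>x y h. \<chi> r. case r of Inl k \<Rightarrow> h $ k | Inr c \<Rightarrow> if c = (0::2) then x else (y::real)"
  have dQ: "(Q1 has_derivative (\<lambda>h. (A *v x) \<bullet> h)) (at x)" "(Q2 has_derivative (\<lambda>h. (B *v x) \<bullet> h)) (at x)" for x
    by (rule has_derivative_quadratic[OF A] has_derivative_quadratic[OF B])+
  have d\<phi>: "(?\<phi> has_derivative (\<lambda>h. ?e ((A *v x) \<bullet> h) ((B *v x) \<bullet> h) h)) (at x)" for x
    unfolding surface_param_def
  proof (rule has_derivative_vecI)
    fix r :: "'n + 2"
    show "((\<lambda>x. (\<chi> r. case r of Inl k \<Rightarrow> x $ k | Inr c \<Rightarrow> if c = 0 then Q1 x else Q2 x) $ r)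
        has_derivative (\<lambda>h. ?e ((A *v x) \<bullet> h) ((B *v x) \<bullet> h) h $ r)) (at x)"
      by (cases r; cases "projr r = 0")
        (auto intro!: dQ bounded_linear_imp_has_derivative bounded_linear_vec_nth)
  qed
  have X: "frame_deriv M i ?\<phi> = (\<lambda>x. ?e ((A *v x) \<bullet> (M $ i)) ((B *v x) \<bullet> (M $ i)) (M $ i))" for i
    by (simp add: fun_eq_iff frame_deriv_eq[OF d\<phi>])
  have dX: "(frame_deriv M i ?\<phi> has_derivative (\<lambda>h. ?e ((A *v h) \<bullet> (M $ i)) ((B *v h) \<bullet> (M $ i)) 0)) (at x)"
    for i x
    unfolding X
  proof (rule has_derivative_vecI)
    fix r :: "'n + 2"
    have lin: "bounded_linear (\<lambda>x. (C *v x) \<bullet> y)" for C :: "real^'n^'n" and y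
      unfolding linear_conv_bounded_linear[symmetric]
      by (rule linearI) (simp_all add: matrix_vector_right_distrib inner_left_distrib
          matrix_vector_mult_scaleR)
    show "((\<lambda>x. ?e ((A *v x) \<bullet> (M $ i)) ((B *v x) \<bullet> (M $ i)) (M $ i) $ r)
        has_derivative (\<lambda>h. ?e ((A *v h) \<bullet> (M $ i)) ((B *v h) \<bullet> (M $ i)) 0 $ r)) (at x)"
      by (cases r; cases "projr r = 0")
         (auto intro!: bounded_linear_imp_has_derivative lin)
  qed
  have XX: "frame_deriv M j (frame_deriv M i ?\<phi>) x =
      ?e (congr_by M A $ j $ i) (congr_by M B $ j $ i) 0" for i j x
    unfolding frame_deriv_eq[OF dX] congr_by_nth symmetric_matrix_inner[OF A(1)] symmetric_matrix_inner[OF B(1)] ..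
  let ?Y = "\<chi> r c. if (c::2) = 0
     then (if (r::2) = 0 then congr_by M A $ j1 $ j2 else congr_by M A $ k1 $ k2)
     else (if r = 0 then congr_by M B $ j1 $ j2 else congr_by M B $ k1 $ k2)"
  have "frame_matrix ?\<phi> 0 M i j1 j2 k1 k2 = block_diag (\<chi> m. M $ i m) ?Y"
  proof (subst vec_eq_iff, subst vec_eq_iff, intro allI)
    fix r c :: "'n + 2"
    show "frame_matrix ?\<phi> 0 M i j1 j2 k1 k2 $ r $ c = block_diag (\<chi> m. M $ i m) ?Y $ r $ c"
      unfolding frame_matrix_def XX unfolding X by (cases r; cases c) simp_all
  qed
  moreover have "det ?Y = congr_by M A $ j1 $ j2 * congr_by M B $ k1 $ k2
        - congr_by M A $ k1 $ k2 * congr_by M B $ j1 $ j2"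
    by (simp add: det_2)
  ultimately show ?thesis by (simp add: det_block_diag)
qed

text \<open>By the constancy of the density it suffices to look at the origin. There the sum over the multi-index
  \<open>i\<close> factors out as a positive constant, since a frame of determinant one contributes the same determinants as the
  coordinate frame, and what remains is the wedge.\<close>

lemma well_curved_iff_not_unstable:
  fixes A B :: "real^'n^'n"
  assumes A: "transpose A = A" "\<And>x. Q1 x = (x \<bullet> (A *v x)) / 2"
    and B: "transpose B = B" "\<And>x. Q2 x = (x \<bullet> (B *v x)) / 2"
    and Q: "quadratic_form Q1" "quadratic_form Q2"
  shows "well_curved Q1 Q2 \<longleftrightarrow> \<not> unstable_pair A B"
proof -
  let ?\<phi> = "surface_param Q1 Q2"
  let ?W = "\<lambda>M. pair_wedge (congr_by M A) (congr_by M B)"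
  (* The sum over all matrices whose rows are coordinate vectors; the identity
     is one of them, so it is at least 1. *)
  define \<kappa> where "\<kappa> = (\<Sum>i\<in>UNIV. (det (\<chi> m. axis (i m) 1 :: real^'n^'n))\<^sup>2)"
  have "(det (\<chi> m. axis (id m) 1 :: real^'n^'n))\<^sup>2 \<le> \<kappa>"
    unfolding \<kappa>_def
    using member_le_sum[of id UNIV "\<lambda>i. (det (\<chi> m. axis (i m) 1 :: real^'n^'n))\<^sup>2"]
    by (simp only: UNIV_I finite_class.finite_UNIV zero_le_power2)
  moreover have "(\<chi> m. axis (id m) 1 :: real^'n^'n) = mat 1"
    by (auto simp: vec_eq_iff mat_def axis_def)
  ultimately have \<kappa>: "\<kappa> \<ge> 1" by simp
  have sub: "(\<Sum>i\<in>UNIV. \<Sum>j1\<in>UNIV. \<Sum>j2\<in>UNIV. \<Sum>k1\<in>UNIV. \<Sum>k2\<in>UNIV.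
                \<bar>det (frame_matrix ?\<phi> 0 M i j1 j2 k1 k2)\<bar>\<^sup>2) = \<kappa> * ?W M" if "det M = 1" for M
  proof -
    have "(\<chi> m. M $ i m) = (\<chi> m. axis (i m) 1 :: real^'n^'n) ** M" for i
      by (simp add: vec_eq_iff matrix_matrix_mult_def axis_def if_distrib[of "\<lambda>x. x * _"] cong: if_cong)
    then have "det (\<chi> m. M $ i m) = det (\<chi> m. axis (i m) 1 :: real^'n^'n)" for i
      using that by (simp add: det_mul)
    then have "(\<Sum>j1\<in>UNIV. \<Sum>j2\<in>UNIV. \<Sum>k1\<in>UNIV. \<Sum>k2\<in>UNIV.
          \<bar>det (frame_matrix ?\<phi> 0 M i j1 j2 k1 k2)\<bar>\<^sup>2) = (det (\<chi> m. axis (i m) 1 :: real^'n^'n))\<^sup>2 * ?W M" for i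
      unfolding det_frame_matrix_zero[OF A B] power2_abs power_mult_distrib pair_wedge_def
      by (simp only: sum_distrib_left)
    then show ?thesis
      by (simp only: \<kappa>_def sum_distrib_right)
  qed
  let ?S = "{M :: real^'n^'n. det M = 1}"
  let ?I = "INF M\<in>?S. sqrt (\<kappa> * ?W M)"
  have ne: "?S \<noteq> {}" by (auto intro!: exI[of _ "mat 1"])
  have bdd: "bdd_below ((\<lambda>M. sqrt (\<kappa> * ?W M)) ` ?S)"
    using \<kappa> by (intro bdd_belowI2[of _ 0]) (auto simp: pair_wedge_nonneg)
  have I0: "?I \<ge> 0"
    using \<kappa> by (intro cINF_greatest[OF ne]) (auto simp: pair_wedge_nonneg)
  have ad: "affine_density ?\<phi> 0 = ?I powr (real CARD('n) / (real CARD('n) + 4))"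
    unfolding affine_density_def by (intro arg_cong2[of _ _ _ _ "(powr)"] INF_cong refl) (simp only: sub mem_Collect_eq)
  have "0 \<in> (unit_cube :: (real^'n) set)"
    by (simp add: unit_cube_def)
  then have "well_curved Q1 Q2 \<longleftrightarrow> affine_density ?\<phi> 0 \<noteq> 0"
    unfolding well_curved_def using affine_density_surface_param_const[OF Q] by metis
  also have "\<dots> \<longleftrightarrow> ?I \<noteq> 0" by (simp add: ad)
  also have "\<dots> \<longleftrightarrow> \<not> unstable_pair A B"
  proof -
    have "unstable_pair A B" if "?I = 0"
      unfolding unstable_pair_def
    proof (intro allI impI)
      fix \<epsilon> :: real assume "\<epsilon> > 0"
      then have "?I < sqrt (\<kappa> * \<epsilon>)" using that \<kappa> by simp
      then obtain M where "M \<in> ?S" "sqrt (\<kappa> * ?W M) < sqrt (\<kappa> * \<epsilon>)"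
        using cINF_less_iff[OF ne bdd] by blast
      then show "\<exists>M. det M = 1 \<and> ?W M < \<epsilon>" using \<kappa> by auto
    qed
    moreover have "?I = 0" if u: "unstable_pair A B"
    proof (rule ccontr)
      assume "?I \<noteq> 0"
      with I0 have pos: "?I > 0" by linarith
      then have "?I\<^sup>2 / \<kappa> > 0" using \<kappa> by simp
      then obtain M where M: "det M = 1" "?W M < ?I\<^sup>2 / \<kappa>"
        using u unfolding unstable_pair_def by blast
      then have "\<kappa> * ?W M < ?I\<^sup>2" using \<kappa> by (simp add: field_simps)
      then have "sqrt (\<kappa> * ?W M) < ?I" using pos real_less_lsqrt by (simp add: real_sqrt_less_iff real_less_lsqrt)
      moreover have "?I \<le> sqrt (\<kappa> * ?W M)" using M(1) by (intro cINF_lower[OF bdd]) auto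
      ultimately show False by linarith
    qed
    ultimately show ?thesis by blast
  qed
  finally show ?thesis .
qed

section \<open>Unstable pairs have a root of high multiplicity\<close>

definition pencil_poly :: "real^'n^'n \<Rightarrow> real^'n^'n \<Rightarrow> real poly" where
  "pencil_poly A B = det (\<chi> i j. [:B $ i $ j, A $ i $ j:])"

lemma poly_pencil_poly: "poly (pencil_poly A B) s = det (B + s *\<^sub>R A)"
  by (simp add: pencil_poly_def det_def poly_sum poly_prod)

lemma congr_by_add_scaleR: "congr_by M (B + s *\<^sub>R A) = congr_by M B + s *\<^sub>R congr_by M A"
  by (simp add: vec_eq_iff congr_by_nth matrix_vector_mult_add_rdistrib inner_right_distrib
      scaleR_matrix_vector_assoc[symmetric])

lemma det_congr_by: "det (congr_by M A) = (det M)\<^sup>2 * det A"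
  by (simp add: congr_by_def det_mul power2_eq_square)

lemma pencil_poly_congr_by:
  assumes "det M = 1"
  shows "pencil_poly (congr_by M A) (congr_by M B) = pencil_poly A B"
  by (simp add: poly_eq_poly_eq_iff[symmetric] fun_eq_iff poly_pencil_poly
      congr_by_add_scaleR[symmetric] det_congr_by assms)

lemma pencil_poly_shift: "pencil_poly A (B + c *\<^sub>R A) = pcompose (pencil_poly A B) [:c, 1:]"
  by (simp add: poly_eq_poly_eq_iff[symmetric] fun_eq_iff poly_pencil_poly poly_pcompose
      scaleR_left_distrib add.assoc)

text \<open>Each linear factor contributes either its leading coefficient or its constant one. The factor \<open>b ^ k\<close>
  on the left replaces \<open>b ^ (card S - k)\<close> on the right, so that the statement makes sense, and is inductive, for
  every \<open>k\<close>.\<close>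

lemma coeff_prod_linear_bound:
  fixes \<alpha> \<beta> :: "'i \<Rightarrow> real"
  assumes "finite S" "\<And>i. i \<in> S \<Longrightarrow> \<bar>\<alpha> i\<bar> \<le> a" "\<And>i. i \<in> S \<Longrightarrow> \<bar>\<beta> i\<bar> \<le> b" "0 \<le> a" "0 \<le> b"
  shows "\<bar>coeff (\<Prod>i\<in>S. [:\<beta> i, \<alpha> i:]) k\<bar> * b ^ k \<le> 2 ^ card S * a ^ k * b ^ card S"
  using assms(1,2,3)
proof (induction S arbitrary: k rule: finite_induct)
  case empty
  show ?case using assms by (cases k) auto
next
  case (insert x S)
  let ?p = "\<Prod>i\<in>S. [:\<beta> i, \<alpha> i:]"
  have IH: "\<bar>coeff ?p k\<bar> * b ^ k \<le> 2 ^ card S * a ^ k * b ^ card S" for k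
    by (intro insert.IH insert.prems) auto
  have ab: "\<bar>\<alpha> x\<bar> \<le> a" "\<bar>\<beta> x\<bar> \<le> b" using insert.prems by auto
  have p: "(\<Prod>i\<in>insert x S. [:\<beta> i, \<alpha> i:]) = smult (\<beta> x) ?p + pCons 0 (smult (\<alpha> x) ?p)"
    using insert.hyps by (simp add: mult_pCons_left)
  have 1: "\<bar>\<beta> x * coeff ?p k\<bar> * b ^ k \<le> 2 ^ card S * a ^ k * b ^ card (insert x S)"
  proof -
    have "\<bar>\<beta> x\<bar> * (\<bar>coeff ?p k\<bar> * b ^ k) \<le> b * (2 ^ card S * a ^ k * b ^ card S)"
      by (rule mult_mono[OF ab(2) IH[of k]]) (use assms in auto)
    moreover have "b * (2 ^ card S * a ^ k * b ^ card S) = 2 ^ card S * a ^ k * b ^ card (insert x S)"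
      using insert.hyps by simp
    ultimately show ?thesis by (simp only: abs_mult mult.assoc)
  qed
  have 2: "\<bar>coeff (pCons 0 (smult (\<alpha> x) ?p)) k\<bar> * b ^ k \<le> 2 ^ card S * a ^ k * b ^ card (insert x S)"
  proof (cases k)
    case 0 then show ?thesis using assms by simp
  next
    case (Suc l)
    have "(\<bar>\<alpha> x\<bar> * b) * (\<bar>coeff ?p l\<bar> * b ^ l) \<le> (a * b) * (2 ^ card S * a ^ l * b ^ card S)"
      by (rule mult_mono[OF mult_right_mono[OF ab(1)] IH[of l]]) (use assms in auto)
    moreover have "(a * b) * (2 ^ card S * a ^ l * b ^ card S) = 2 ^ card S * a ^ k * b ^ card (insert x S)"
      using insert.hyps Suc by simp
    moreover have "(\<bar>\<alpha> x\<bar> * b) * (\<bar>coeff ?p l\<bar> * b ^ l) = \<bar>coeff (pCons 0 (smult (\<alpha> x) ?p)) k\<bar> * b ^ k"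
      using Suc by (simp add: abs_mult)
    ultimately show ?thesis by simp
  qed
  have "\<bar>coeff (\<Prod>i\<in>insert x S. [:\<beta> i, \<alpha> i:]) k\<bar> * b ^ k
     \<le> \<bar>\<beta> x * coeff ?p k\<bar> * b ^ k + \<bar>coeff (pCons 0 (smult (\<alpha> x) ?p)) k\<bar> * b ^ k"
    unfolding p coeff_add coeff_smult distrib_right[symmetric]
    using assms by (intro mult_right_mono abs_triangle_ineq) auto
  also have "\<dots> \<le> 2 ^ card (insert x S) * a ^ k * b ^ card (insert x S)"
    using 1 2 insert.hyps by simp
  finally show ?case .
qed

lemma coeff_pencil_poly_bound:
  fixes A B :: "real^'n^'n"
  assumes "norm A \<le> a" "norm B \<le> b"
  shows "\<bar>coeff (pencil_poly A B) k\<bar> * b ^ k \<le> fact CARD('n) * 2 ^ CARD('n) * a ^ k * b ^ CARD('n)"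
proof -
  let ?P = "{p. p permutes (UNIV::'n set)}"
  have nth: "\<bar>X $ i $ j\<bar> \<le> norm X" for X :: "real^'n^'n" and i j
    using order_trans[OF component_le_norm_cart Finite_Cartesian_Product.norm_nth_le] by blast
  have ab: "0 \<le> a" "0 \<le> b"
    using assms norm_ge_zero order_trans by blast+
  have sgn: "\<bar>coeff (of_int (sign p) * q) k\<bar> = \<bar>coeff q k\<bar>" for p :: "'n \<Rightarrow> 'n" and q :: "real poly"
  proof -
    have "sign p = 1 \<or> sign p = -1" by (simp add: sign_def)
    then show ?thesis by (elim disjE) simp_all
  qed
  have "\<bar>coeff (pencil_poly A B) k\<bar> * b ^ k
      \<le> (\<Sum>p\<in>?P. \<bar>coeff (\<Prod>i\<in>UNIV. [:B $ i $ p i, A $ i $ p i:]) k\<bar>) * b ^ k"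
    unfolding pencil_poly_def det_def coeff_sum
    using ab by (intro mult_right_mono order_trans[OF sum_abs]) (auto simp: sgn)
  also have "\<dots> \<le> (\<Sum>p\<in>?P. 2 ^ CARD('n) * a ^ k * b ^ CARD('n))"
    unfolding sum_distrib_right
    using ab order_trans[OF nth assms(1)] order_trans[OF nth assms(2)]
    by (intro sum_mono coeff_prod_linear_bound) auto
  also have "\<dots> = fact CARD('n) * 2 ^ CARD('n) * a ^ k * b ^ CARD('n)"
    by (simp add: card_permutations[OF refl])
  finally show ?thesis .
qed

lemma continuous_on_coeff_pcompose_shift:
  fixes p :: "real poly"
  shows "continuous_on S (\<lambda>c. coeff (pcompose p [:c, 1:]) k)"
proof (induction p arbitrary: k)
  case 0
  then show ?case by simp
next
  case (pCons a p)
  have "coeff (pcompose (pCons a p) [:c, 1:]) k =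
      coeff [:a:] k + (c * coeff (pcompose p [:c, 1:]) k
        + (case k of 0 \<Rightarrow> 0 | Suc l \<Rightarrow> coeff (pcompose p [:c, 1:]) l))" for c
    by (simp add: pcompose_pCons mult_pCons_left coeff_pCons split: nat.split)
  then show ?case
    by (simp, intro continuous_intros pCons.IH) (cases k; auto intro: pCons.IH)
qed

text \<open>Lagrange's identity, with matrices regarded as vectors of entries.\<close>

lemma pair_wedge_eq:
  fixes A B :: "real^'a^'a"
  shows "pair_wedge A B = 2 * ((norm A)\<^sup>2 * (norm B)\<^sup>2 - (A \<bullet> B)\<^sup>2)"
proof -
  have n: "(norm X)\<^sup>2 = (\<Sum>i\<in>UNIV. \<Sum>j\<in>UNIV. (X $ i $ j)\<^sup>2)" for X :: "real^'n^'n"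
    unfolding power2_norm_eq_inner by (simp add: inner_vec_def power2_eq_square)
  have i: "A \<bullet> B = (\<Sum>i\<in>UNIV. \<Sum>j\<in>UNIV. A $ i $ j * B $ i $ j)"
    by (simp add: inner_vec_def)
  have prod: "(\<Sum>j1\<in>UNIV. \<Sum>j2\<in>UNIV. \<Sum>k1\<in>UNIV. \<Sum>k2\<in>UNIV. f j1 j2 * g k1 k2) =
      (\<Sum>i\<in>UNIV. \<Sum>j\<in>UNIV. f i j) * (\<Sum>i\<in>UNIV. \<Sum>j\<in>UNIV. g i j)" for f g :: "'a \<Rightarrow> 'a \<Rightarrow> real"
    by (simp only: sum_distrib_left[symmetric] sum_distrib_right[symmetric])
  have "pair_wedge A B = (\<Sum>j1\<in>UNIV. \<Sum>j2\<in>UNIV. \<Sum>k1\<in>UNIV. \<Sum>k2\<in>UNIV.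
      (A $ j1 $ j2)\<^sup>2 * (B $ k1 $ k2)\<^sup>2 + (B $ j1 $ j2)\<^sup>2 * (A $ k1 $ k2)\<^sup>2
      - (A $ j1 $ j2 * B $ j1 $ j2) * (2 * (A $ k1 $ k2 * B $ k1 $ k2)))"
    unfolding pair_wedge_def by (intro sum.cong refl) (simp add: power2_eq_square algebra_simps)
  also have "\<dots> = (norm A)\<^sup>2 * (norm B)\<^sup>2 + (norm B)\<^sup>2 * (norm A)\<^sup>2 - (A \<bullet> B) * (2 * (A \<bullet> B))"
    unfolding sum_subtractf sum.distrib prod n i sum_distrib_left ..
  finally show ?thesis by (simp add: power2_eq_square)
qed

text \<open>The multiplicity of the root \<open>0\<close> of \<open>det (B + s A)\<close> exceeds half the degree of the homogeneous form
  \<open>det (s A + t B)\<close>. Stating this by coefficients includes the zero polynomial, which has no multiplicity.\<close>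

definition deep_root :: "real^'n^'n \<Rightarrow> real^'n^'n \<Rightarrow> bool" where
  "deep_root A B \<longleftrightarrow> (\<forall>k. 2 * k \<le> CARD('n) \<longrightarrow> coeff (pencil_poly A B) k = 0)"

text \<open>The coefficients of the pencil polynomial are invariant under congruences of determinant one, so they may be
  estimated after the congruence. Replacing the shorter matrix by its component orthogonal to the longer one preserves
  the wedge, which then is twice the square of the product of the two norms. A coefficient of order \<open>k \<le> d / 2\<close> contains the smaller
  norm at least as often as the larger one, and so is bounded by a positive power of the product.\<close>

lemma small_coeffs_of_small_wedge:
  fixes A B :: "real^'n^'n"
  assumes "det M = 1" and W: "pair_wedge (congr_by M A) (congr_by M B) < \<delta>\<^sup>2 / 2"
    and \<delta>: "0 < \<delta>" "\<delta> \<le> 1"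
    and le: "norm (congr_by M B) \<le> norm (congr_by M A)"
  shows "\<exists>c\<in>{-1..1}. \<forall>k. 2 * k \<le> CARD('n) \<longrightarrow>
           (coeff (pencil_poly A (B + c *\<^sub>R A)) k)\<^sup>2 \<le> (fact CARD('n) * 2 ^ CARD('n))\<^sup>2 * \<delta>"
proof -
  let ?A = "congr_by M A" and ?B = "congr_by M B"
  (* This c makes B0 orthogonal to the longer matrix; it is at most 1 in
     absolute value since ?B is the shorter one. *)
  define c where "c = - (?A \<bullet> ?B) / (norm ?A)\<^sup>2"
  define B0 where "B0 = ?B + c *\<^sub>R ?A"
  have prod: "(norm ?A)\<^sup>2 * (norm B0)\<^sup>2 = pair_wedge ?A ?B / 2 \<and> norm B0 \<le> norm ?A \<and> \<bar>c\<bar> \<le> 1"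
  proof (cases "norm ?A = 0")
    case True
    then show ?thesis using le by (simp add: pair_wedge_eq B0_def c_def)
  next
    case False
    let ?a = "(norm ?A)\<^sup>2"
    have a: "?a > 0" using False by simp
    have "(norm B0)\<^sup>2 = (norm ?B)\<^sup>2 + 2 * c * (?A \<bullet> ?B) + c\<^sup>2 * ?a"
      unfolding B0_def power2_norm_eq_inner
      by (simp add: inner_add_left inner_add_right inner_commute power2_eq_square algebra_simps)
    also have "\<dots> = (norm ?B)\<^sup>2 - (?A \<bullet> ?B)\<^sup>2 / ?a"
      using a by (simp add: c_def power2_eq_square field_simps)
    finally have n: "(norm B0)\<^sup>2 = (norm ?B)\<^sup>2 - (?A \<bullet> ?B)\<^sup>2 / ?a" .
    then have "(norm B0)\<^sup>2 \<le> (norm ?B)\<^sup>2" using a by simp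
    then have "norm B0 \<le> norm ?B" by (simp add: power2_le_iff_abs_le)
    moreover have "\<bar>?A \<bullet> ?B\<bar> \<le> ?a"
      using order_trans[OF Cauchy_Schwarz_ineq2 mult_left_mono[OF le norm_ge_zero[of ?A]]]
      by (simp add: power2_eq_square)
    ultimately show ?thesis
      using a le n by (simp add: c_def pair_wedge_eq field_simps)
  qed
  have "(norm ?A * norm B0)\<^sup>2 < (\<delta> / 2)\<^sup>2"
    using prod W by (simp add: power_mult_distrib power_divide)
  then have AB: "norm ?A * norm B0 < \<delta> / 2"
    using \<delta> power2_less_imp_less by (metis half_gt_zero less_eq_real_def)
  define S where "S = norm ?A + norm B0 + 1"
  have S: "S \<ge> 1" by (simp add: S_def)
  (* Both norms are enlarged slightly: the coefficient bound is divided by a power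
     of b, which must not be zero. *)
  define \<eta> where "\<eta> = \<delta> / (2 * S)"
  define a b where "a = norm ?A + \<eta>" and "b = norm B0 + \<eta>"
  have \<eta>: "0 < \<eta>" "\<eta> \<le> 1" unfolding \<eta>_def using \<delta> S by auto
  have "a * b = norm ?A * norm B0 + \<eta> * (norm ?A + norm B0 + \<eta>)"
    by (simp add: a_def b_def algebra_simps)
  also have "\<dots> \<le> norm ?A * norm B0 + \<eta> * S"
    using \<eta> by (simp add: S_def)
  also have "\<eta> * S = \<delta> / 2"
    unfolding \<eta>_def using S by simp
  finally have ab: "a * b \<le> \<delta>" using AB by linarith
  have ba: "0 < b" "b \<le> a" using \<eta> prod by (auto simp: a_def b_def add_pos_nonneg add_nonneg_pos)
  have c: "c \<in> {-1..1}" using prod by auto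
  have "(coeff (pencil_poly A (B + c *\<^sub>R A)) k)\<^sup>2 \<le> (fact CARD('n) * 2 ^ CARD('n))\<^sup>2 * \<delta>"
    if k: "2 * k \<le> CARD('n)" for k
  proof -
    let ?N = "fact CARD('n) * 2 ^ CARD('n) :: real" and ?d = "CARD('n)"
    let ?x = "\<bar>coeff (pencil_poly A (B + c *\<^sub>R A)) k\<bar>"
    have eq: "pencil_poly A (B + c *\<^sub>R A) = pencil_poly ?A B0"
      unfolding B0_def congr_by_add_scaleR[symmetric] using assms(1) by (simp add: pencil_poly_congr_by)
    have "?x * b ^ k \<le> ?N * a ^ k * b ^ ?d"
      unfolding eq using \<eta> by (intro coeff_pencil_poly_bound) (auto simp: a_def b_def)
    also have "\<dots> = ?N * a ^ k * b ^ (?d - k) * b ^ k"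
      using k by (simp add: mult.assoc power_add[symmetric])
    finally have x: "?x \<le> ?N * a ^ k * b ^ (?d - k)" using ba by simp
    define e where "e = ?d - 2 * k"
    have e: "?d - k = k + e" "?d = 2 * k + e" using k by (auto simp: e_def)
    have "a ^ k * b ^ (?d - k) = (a * b) ^ k * b ^ e"
      unfolding e(1) by (simp add: power_add power_mult_distrib)
    then have "(a ^ k * b ^ (?d - k))\<^sup>2 = ((a * b) ^ k)\<^sup>2 * (b ^ e)\<^sup>2"
      by (simp only: power_mult_distrib)
    also have "\<dots> = (a * b) ^ (2 * k) * (b\<^sup>2) ^ e"
      by (simp add: power_mult[symmetric] mult.commute)
    also have "\<dots> \<le> \<delta> ^ (2 * k) * \<delta> ^ e"
    proof (intro mult_mono power_mono)
      have "b\<^sup>2 \<le> a * b" using ba by (simp add: power2_eq_square)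
      then show "b\<^sup>2 \<le> \<delta>" using ab by linarith
    qed (use ab ba \<delta> in auto)
    also have "\<dots> = \<delta> ^ ?d" unfolding e(2) by (simp only: power_add)
    also have "\<dots> \<le> \<delta> ^ 1" using \<delta> by (intro power_decreasing) (auto simp: Suc_leI)
    finally have "?N\<^sup>2 * (a ^ k * b ^ (?d - k))\<^sup>2 \<le> ?N\<^sup>2 * \<delta>" by (simp add: mult_left_mono)
    moreover have "?x\<^sup>2 \<le> (?N * a ^ k * b ^ (?d - k))\<^sup>2" using x by (intro power_mono) auto
    moreover have "(?N * a ^ k * b ^ (?d - k))\<^sup>2 = ?N\<^sup>2 * (a ^ k * b ^ (?d - k))\<^sup>2"
      by (simp only: power_mult_distrib mult.assoc)
    ultimately have "?x\<^sup>2 \<le> ?N\<^sup>2 * \<delta>" by linarith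
    then show ?thesis by (simp only: power2_abs)
  qed
  then show ?thesis using c by blast
qed

text \<open>The sum of the squares of the low coefficients is continuous in \<open>c\<close>, hence attains its infimum zero on the compact
  interval.\<close>

lemma deep_root_of_small_coeffs:
  fixes A B :: "real^'n^'n"
  assumes "\<And>\<delta>. 0 < \<delta> \<Longrightarrow> \<delta> \<le> 1 \<Longrightarrow> \<exists>c\<in>{-1..1}. \<forall>k. 2 * k \<le> CARD('n) \<longrightarrow>
           (coeff (pencil_poly A (B + c *\<^sub>R A)) k)\<^sup>2 \<le> N * \<delta>"
  shows "\<exists>c. deep_root A (B + c *\<^sub>R A)"
proof -
  let ?K = "{k. 2 * k \<le> CARD('n)}"
  (* The minimum of g over the interval is zero. *)
  define g where "g c = (\<Sum>k\<in>?K. (coeff (pencil_poly A (B + c *\<^sub>R A)) k)\<^sup>2)" for c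
  have fin: "finite ?K" by (rule finite_subset[of _ "{..CARD('n)}"]) auto
  have "continuous_on {-1..1} g"
    unfolding g_def pencil_poly_shift
    by (intro continuous_intros continuous_on_coeff_pcompose_shift)
  then obtain c where c: "c \<in> {-1..1}" "\<And>y. y \<in> {-1..1} \<Longrightarrow> g c \<le> g y"
    using continuous_attains_inf[of "{-1..1::real}" g] by auto
  have g0: "g x \<ge> 0" for x unfolding g_def by (intro sum_nonneg) auto
  have "g c \<le> card ?K * \<bar>N\<bar> * \<delta>" if d: "0 < \<delta>" "\<delta> \<le> 1" for \<delta>
  proof -
    obtain y where y: "y \<in> {-1..1}" "\<And>k. 2 * k \<le> CARD('n) \<Longrightarrow>
           (coeff (pencil_poly A (B + y *\<^sub>R A)) k)\<^sup>2 \<le> N * \<delta>"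
      using assms[OF d] by blast
    have "g c \<le> g y" using c y by blast
    also have "\<dots> \<le> (\<Sum>k\<in>?K. \<bar>N\<bar> * \<delta>)"
      unfolding g_def using d
      by (intro sum_mono order_trans[OF y(2)] mult_right_mono) auto
    finally show ?thesis by simp
  qed
  then have lim: "\<forall>\<^sub>F \<delta> in at_right 0. g c \<le> card ?K * \<bar>N\<bar> * \<delta>"
    by (intro eventually_at_rightI[of 0 1]) auto
  have "((\<lambda>\<delta>. card ?K * \<bar>N\<bar> * \<delta>) \<longlongrightarrow> card ?K * \<bar>N\<bar> * 0) (at_right 0)"
    by (intro tendsto_intros)
  then have "g c \<le> 0"
    using tendsto_lowerbound[OF _ lim] by simp
  then have "g c = 0" using g0[of c] by simp
  then have "coeff (pencil_poly A (B + c *\<^sub>R A)) k = 0" if "2 * k \<le> CARD('n)" for k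
    using that fin unfolding g_def by (subst (asm) sum_nonneg_eq_0_iff) auto
  then show ?thesis unfolding deep_root_def by blast
qed

lemma pair_wedge_commute: "pair_wedge A B = pair_wedge B A"
  by (simp add: pair_wedge_eq inner_commute)

text \<open>Which of the two congruent matrices is the longer one may change with the congruence, but one of the two cases
  must occur for arbitrarily small wedges. The second alternative of the conclusion corresponds to the direction in
  which the first pencil has its point at infinity.\<close>

lemma unstable_pair_deep_root:
  fixes A B :: "real^'n^'n"
  assumes "unstable_pair A B"
  shows "(\<exists>c. deep_root A (B + c *\<^sub>R A)) \<or> (\<exists>c. deep_root B (A + c *\<^sub>R B))"
proof -
  let ?N = "(fact CARD('n) * 2 ^ CARD('n))\<^sup>2 :: real"
  define P where "P A B \<delta> \<longleftrightarrow> (\<exists>c\<in>{-1..1}. \<forall>k. 2 * k \<le> CARD('n) \<longrightarrow>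
           (coeff (pencil_poly A (B + c *\<^sub>R A)) k)\<^sup>2 \<le> ?N * \<delta>)" for A B :: "real^'n^'n" and \<delta>
  have mono: "P A B \<delta>'" if "P A B \<delta>" "\<delta> \<le> \<delta>'" for A B \<delta> \<delta>'
  proof -
    have "?N * \<delta> \<le> ?N * \<delta>'" using that by (intro mult_left_mono) auto
    then show ?thesis using that(1) unfolding P_def by (meson order_trans)
  qed
  have *: "P A B \<delta> \<or> P B A \<delta>" if \<delta>: "0 < \<delta>" "\<delta> \<le> 1" for \<delta>
  proof -
    have "\<delta>\<^sup>2 / 2 > 0" using \<delta> by simp
    then obtain M where M: "det M = 1" "pair_wedge (congr_by M A) (congr_by M B) < \<delta>\<^sup>2 / 2"
      using assms unfolding unstable_pair_def by blast
    show ?thesis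
    proof (cases "norm (congr_by M B) \<le> norm (congr_by M A)")
      case True
      then show ?thesis unfolding P_def using small_coeffs_of_small_wedge[OF M \<delta>] by blast
    next
      case False
      then have "norm (congr_by M A) \<le> norm (congr_by M B)" by simp
      then show ?thesis
        unfolding P_def using small_coeffs_of_small_wedge[OF M(1) _ \<delta>, of B A] M(2)
        by (simp add: pair_wedge_commute)
    qed
  qed
  have "(\<forall>\<delta>. 0 < \<delta> \<and> \<delta> \<le> 1 \<longrightarrow> P A B \<delta>) \<or> (\<forall>\<delta>. 0 < \<delta> \<and> \<delta> \<le> 1 \<longrightarrow> P B A \<delta>)"
  proof (rule ccontr)
    assume "\<not> ?thesis"
    then obtain x y where xy: "0 < x" "x \<le> 1" "\<not> P A B x" "0 < y" "y \<le> 1" "\<not> P B A y" by blast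
    have "min x y \<le> 1" "min x y > 0" using xy by auto
    then show False using xy *[of "min x y"] mono[of A B "min x y" x] mono[of B A "min x y" y] by auto
  qed
  then show ?thesis
    using deep_root_of_small_coeffs[of A B ?N] deep_root_of_small_coeffs[of B A ?N]
    unfolding P_def by blast
qed

text \<open>The weights are constructed from the rate of decay, a condition that passes more easily to principal
  submatrices than the multiplicity of a root.\<close>

lemma deep_root_det_bound:
  fixes A B :: "real^'n^'n"
  assumes "deep_root A B"
  shows "\<exists>C. \<forall>s. 0 < s \<and> s < 1 \<longrightarrow> \<bar>det (B + s *\<^sub>R A)\<bar> \<le> C * s powr real (CARD('n) div 2 + 1)"
proof -
  let ?p = "pencil_poly A B" and ?m = "CARD('n) div 2 + 1"
  have "\<bar>det (B + s *\<^sub>R A)\<bar> \<le> (\<Sum>i\<le>degree ?p. \<bar>coeff ?p i\<bar>) * s powr real ?m" if s: "0 < s" "s < 1" for s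
  proof -
    have "\<bar>det (B + s *\<^sub>R A)\<bar> \<le> (\<Sum>i\<le>degree ?p. \<bar>coeff ?p i * s ^ i\<bar>)"
      unfolding poly_pencil_poly[symmetric] poly_altdef by (rule sum_abs)
    also have "\<dots> \<le> (\<Sum>i\<le>degree ?p. \<bar>coeff ?p i\<bar> * s ^ ?m)"
    proof (rule sum_mono)
      fix i
      show "\<bar>coeff ?p i * s ^ i\<bar> \<le> \<bar>coeff ?p i\<bar> * s ^ ?m"
      proof (cases "2 * i \<le> CARD('n)")
        case True then show ?thesis using assms s by (simp add: deep_root_def)
      next
        case False
        then have "s ^ i \<le> s ^ ?m" using s by (intro power_decreasing) auto
        then show ?thesis using s by (simp add: abs_mult mult_left_mono)
      qed
    qed
    finally show ?thesis
      unfolding powr_realpow[OF s(1)] by (simp only: sum_distrib_right)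
  qed
  then show ?thesis by blast
qed

section \<open>Weights from the order of vanishing of a determinant\<close>

text \<open>The principal submatrix on \<open>I\<close>, completed by the identity: its determinant is the principal minor, and
  matrices of all sizes share one type, so that it is possible to induct over \<open>I\<close>.\<close>

definition mask :: "'n set \<Rightarrow> real^'n^'n \<Rightarrow> real^'n^'n" where
  "mask I X = (\<chi> i j. if i \<in> I \<and> j \<in> I then X $ i $ j else if i = j then 1 else 0)"

text \<open>Coordinate changes that involve only the coordinates in \<open>I\<close>.\<close>

definition identity_outside :: "'n set \<Rightarrow> real^'n^'n \<Rightarrow> bool" where
  "identity_outside I M \<longleftrightarrow> (\<forall>i j. i \<notin> I \<or> j \<notin> I \<longrightarrow> M $ i $ j = (if i = j then 1 else 0))"

lemma congr_by_sum: "congr_by M X $ i $ j = (\<Sum>k\<in>UNIV. \<Sum>l\<in>UNIV. M $ i $ k * X $ k $ l * M $ j $ l)"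
  by (simp add: congr_by_nth inner_vec_def matrix_vector_mult_def sum_distrib_left mult.assoc)

lemma sum_eq_single:
  fixes f :: "'a::finite \<Rightarrow> real"
  assumes "\<And>k. k \<noteq> i \<Longrightarrow> f k = 0"
  shows "sum f UNIV = f i"
  using sum.mono_neutral_right[of UNIV "{i}" f] assms by simp

lemma congr_by_outside:
  assumes "identity_outside J M" "k \<notin> J"
  shows "congr_by M X $ k $ j = (\<Sum>l\<in>UNIV. X $ k $ l * M $ j $ l)"
proof -
  have "congr_by M X $ k $ j = (\<Sum>l\<in>UNIV. M $ k $ k * X $ k $ l * M $ j $ l)"
    unfolding congr_by_sum using assms
    by (intro sum_eq_single[where i=k and f="\<lambda>k'. \<Sum>l\<in>UNIV. M $ k $ k' * X $ k' $ l * M $ j $ l"])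
      (auto simp: identity_outside_def)
  then show ?thesis using assms by (simp add: identity_outside_def)
qed

lemma congr_by_outside_outside:
  assumes "identity_outside J M" "k \<notin> J" "j \<notin> J"
  shows "congr_by M X $ k $ j = X $ k $ j"
proof -
  have "(\<Sum>l\<in>UNIV. X $ k $ l * M $ j $ l) = X $ k $ j * M $ j $ j"
    using assms by (intro sum_eq_single[where f="\<lambda>l. X $ k $ l * M $ j $ l"]) (auto simp: identity_outside_def)
  then show ?thesis using assms by (simp add: congr_by_outside) (simp add: identity_outside_def)
qed

lemma congr_by_outside_inside:
  assumes "identity_outside J M" "k \<notin> J" "j \<in> J" "\<And>l. l \<in> J \<Longrightarrow> X $ k $ l = 0"
  shows "congr_by M X $ k $ j = 0"
  unfolding congr_by_outside[OF assms(1,2)]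
proof (rule sum.neutral, intro ballI)
  fix l show "X $ k $ l * M $ j $ l = 0"
    using assms by (cases "l \<in> J") (auto simp: identity_outside_def)
qed

lemma transpose_congr_by: "transpose (congr_by M X) = congr_by M (transpose X)"
  by (simp add: congr_by_def matrix_transpose_mul matrix_mul_assoc)

lemma symmetric_nth: "transpose X = X \<Longrightarrow> X $ i $ j = X $ j $ i"
  by (metis transpose_def vec_lambda_beta)

lemma congr_by_mult: "congr_by M (congr_by N X) = congr_by (M ** N) X"
  by (simp add: congr_by_def matrix_transpose_mul matrix_mul_assoc)

lemma mask_congr_by:
  assumes M: "identity_outside I M"
  shows "mask I (congr_by M X) = congr_by M (mask I X)"
proof (subst vec_eq_iff, subst vec_eq_iff, intro allI)
  fix i j
  have out: "congr_by M (mask I X) $ i $ j = (if i = j then 1 else 0)" if "i \<notin> I" for i j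
  proof -
    have "congr_by M (mask I X) $ i $ j = (\<Sum>l\<in>UNIV. mask I X $ i $ l * M $ j $ l)"
      using M that by (rule congr_by_outside)
    also have "\<dots> = mask I X $ i $ i * M $ j $ i"
      using that by (intro sum_eq_single[where f="\<lambda>l. mask I X $ i $ l * M $ j $ l"]) (auto simp: mask_def)
    also have "\<dots> = (if i = j then 1 else 0)"
      using that M by (auto simp: mask_def identity_outside_def)
    finally show ?thesis .
  qed
  have out2: "congr_by M (mask I X) $ i $ j = (if i = j then 1 else 0)" if "j \<notin> I" for i j
  proof -
    have "congr_by M (mask I X) $ i $ j = transpose (congr_by M (mask I X)) $ j $ i"
      by (simp add: transpose_def)
    also have "transpose (congr_by M (mask I X)) = congr_by M (mask I (transpose X))"
      unfolding transpose_congr_by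
      by (rule arg_cong[where f="congr_by M"]) (auto simp: vec_eq_iff mask_def transpose_def)
    also have "congr_by M (mask I (transpose X)) $ j $ i = (\<Sum>l\<in>UNIV. mask I (transpose X) $ j $ l * M $ i $ l)"
      using M that by (rule congr_by_outside)
    also have "\<dots> = mask I (transpose X) $ j $ j * M $ i $ j"
      using that by (intro sum_eq_single[where f="\<lambda>l. mask I (transpose X) $ j $ l * M $ i $ l"]) (auto simp: mask_def)
    also have "\<dots> = (if i = j then 1 else 0)"
      using that M by (auto simp: mask_def identity_outside_def)
    finally show ?thesis .
  qed
  show "mask I (congr_by M X) $ i $ j = congr_by M (mask I X) $ i $ j"
  proof (cases "i \<in> I \<and> j \<in> I")
    case True
    then have "congr_by M X $ i $ j = congr_by M (mask I X) $ i $ j"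
      unfolding congr_by_sum using M
      by (intro sum.cong refl) (auto simp: mask_def identity_outside_def)
    then show ?thesis using True by (simp add: mask_def)
  next
    case False
    then show ?thesis using out[of i j] out2[of j i] by (auto simp: mask_def)
  qed
qed

lemma identity_outside_mult:
  assumes "identity_outside I M" "identity_outside I N"
  shows "identity_outside I (M ** N)"
  unfolding identity_outside_def
proof (intro allI impI)
  fix i j assume "i \<notin> I \<or> j \<notin> I"
  then show "(M ** N) $ i $ j = (if i = j then 1 else 0)"
  proof
    assume i: "i \<notin> I"
    have "(M ** N) $ i $ j = M $ i $ i * N $ i $ j"
      unfolding matrix_matrix_mult_def vec_lambda_beta
      using assms i by (intro sum_eq_single[where f="\<lambda>k. M $ i $ k * N $ k $ j"]) (auto simp: identity_outside_def)
    then show ?thesis using assms i by (auto simp: identity_outside_def)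
  next
    assume j: "j \<notin> I"
    have "(M ** N) $ i $ j = M $ i $ j * N $ j $ j"
      unfolding matrix_matrix_mult_def vec_lambda_beta
      using assms j by (intro sum_eq_single[where f="\<lambda>k. M $ i $ k * N $ k $ j"]) (auto simp: identity_outside_def)
    then show ?thesis using assms j by (auto simp: identity_outside_def)
  qed
qed

lemma identity_outside_mono: "identity_outside J M \<Longrightarrow> J \<subseteq> I \<Longrightarrow> identity_outside I M"
  unfolding identity_outside_def by blast

text \<open>The congruence by this matrix adds \<open>v i\<close> times row and column \<open>k\<close> to row and column \<open>i\<close>.\<close>

definition shear :: "'n \<Rightarrow> ('n \<Rightarrow> real) \<Rightarrow> real^'n^'n" where
  "shear k v = (\<chi> i j. if j = k then (if i = k then 1 else v i) else if i = j then 1 else 0)"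

lemma det_shear:
  fixes k :: "'n::finite"
  shows "det (shear k v) = 1"
proof -
  let ?x = "\<chi> i. if i = k then 1 else v i"
  have "shear k v = (\<chi> i j. if j = k then ?x $ i else (mat 1 :: real^'n^'n) $ i $ j)"
    by (auto simp: vec_eq_iff shear_def mat_def)
  then have "det (shear k v) = ?x $ k"
    using cramer_lemma[of k "mat 1 :: real^'n^'n" ?x] by (simp only: matrix_vector_mul_lid det_I mult_1_right)
  then show ?thesis by simp
qed

lemma identity_outside_shear: "k \<in> I \<Longrightarrow> (\<And>i. i \<notin> I \<Longrightarrow> v i = 0) \<Longrightarrow> identity_outside I (shear k v)"
  by (auto simp: identity_outside_def shear_def)

lemma congr_by_shear:
  assumes "v k = 0"
  shows "congr_by (shear k v) X $ i $ j = X $ i $ j + v i * X $ k $ j + v j * X $ i $ k + v i * v j * X $ k $ k"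
proof -
  have row: "shear k v $ i = axis i 1 + v i *\<^sub>R axis k 1" for i
    using assms by (auto simp: vec_eq_iff shear_def axis_def)
  have ax: "axis i 1 \<bullet> (X *v axis j 1) = X $ i $ j" for i j
    by (simp add: inner_axis' matrix_vector_mul_component inner_axis)
  show ?thesis
    unfolding congr_by_nth row
    by (simp add: matrix_vector_right_distrib inner_add_left inner_add_right matrix_vector_mult_scaleR ax algebra_simps)
qed

lemma det_mask_split_diagonal:
  fixes X :: "real^'n^'n"
  assumes "k \<in> I" "\<And>j. j \<in> I - {k} \<Longrightarrow> X $ k $ j = 0" "\<And>j. j \<in> I - {k} \<Longrightarrow> X $ j $ k = 0"
  shows "det (mask I X) = X $ k $ k * det (mask (I - {k}) X)"
proof -
  let ?b = "\<lambda>i. mask (I - {k}) X $ i"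
  have "mask I X = (\<chi> i. if i = k then X $ k $ k *s axis k 1 else ?b i)"
    using assms by (auto simp: vec_eq_iff mask_def axis_def)
  moreover have "mask (I - {k}) X = (\<chi> i. if i = k then axis k 1 else ?b i)"
    by (auto simp: vec_eq_iff mask_def axis_def)
  ultimately show ?thesis
    using det_row_mul[of k "X $ k $ k" "\<lambda>i. axis k 1" ?b] by simp
qed

text \<open>When the diagonal entry of row \<open>k\<close> is zero, there is no 1 by 1 pivot, but the coordinates \<open>k\<close> and \<open>l\<close> span a
  hyperbolic plane. A shear clears row and column \<open>l\<close> outside it, which makes the matrix split; the plane itself
  has determinant \<open>- (X k l)^2\<close>.\<close>

lemma det_mask_split_hyperbolic:
  fixes X :: "real^'n^'n"
  assumes sym: "transpose X = X" and kl: "k \<in> I" "l \<in> I" "k \<noteq> l"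
    and k: "X $ k $ k = 0" "\<And>j. j \<in> I - {k, l} \<Longrightarrow> X $ k $ j = 0" and c: "X $ k $ l \<noteq> 0"
  shows "det (mask I X) = - (X $ k $ l)\<^sup>2 * det (mask (I - {k, l}) X)"
proof -
  let ?c = "X $ k $ l" and ?J = "I - {k, l}"
  (* The multiples of row k that clear row l; the diagonal entry (l, l) is met
     twice by the congruence, hence the factor 2. *)
  define v where "v i = (if i \<in> ?J then - X $ i $ l / ?c else if i = l then - X $ l $ l / (2 * ?c) else 0)" for i
  let ?Y = "congr_by (shear k v) X"
  have v: "v k = 0" using kl by (simp add: v_def)
  have Y: "?Y $ i $ j = X $ i $ j + v i * X $ k $ j + v j * X $ k $ i" for i j
    using congr_by_shear[of v k X i j, OF v] k symmetric_nth[OF sym, of i k] by simp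
  have "mask I ?Y = congr_by (shear k v) (mask I X)"
    using kl by (intro mask_congr_by identity_outside_shear) (auto simp: v_def)
  then have "det (mask I ?Y) = det (mask I X)"
    by (simp add: det_congr_by det_shear)
  moreover have "mask I ?Y = (\<chi> i. if i = k then ?c *s axis l 1 else if i = l then ?c *s axis k 1 else mask ?J X $ i)"
  proof (subst vec_eq_iff, subst vec_eq_iff, intro allI)
    fix i j
    have *: "i \<in> ?J \<Longrightarrow> j \<in> ?J \<Longrightarrow> ?Y $ i $ j = X $ i $ j" for i j
      using k by (simp add: Y)
    have **: "?Y $ l $ l = 0" using c kl by (simp add: Y v_def)
    have ***: "?Y $ i $ l = 0" "?Y $ l $ i = 0" if "i \<in> ?J" for i
      using c kl that k symmetric_nth[OF sym, of i l] by (auto simp: Y v_def)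
    have a: "?Y $ k $ i = X $ k $ i" "?Y $ i $ k = X $ k $ i" for i
      using k symmetric_nth[OF sym, of i k] v by (simp_all add: Y)
    show "mask I ?Y $ i $ j = (\<chi> i. if i = k then ?c *s axis l 1 else if i = l then ?c *s axis k 1 else mask ?J X $ i) $ i $ j"
      using kl k * ** *** a by (auto simp: mask_def axis_def)
  qed
  moreover have "det (\<chi> i. if i = k then ?c *s axis l 1 else if i = l then ?c *s axis k 1 else mask ?J X $ i)
     = ?c * det (\<chi> i. if i = k then axis l 1 else if i = l then ?c *s axis k 1 else mask ?J X $ i)"
    using det_row_mul[of k ?c "\<lambda>i. axis l 1" "\<lambda>i. if i = l then ?c *s axis k 1 else mask ?J X $ i"] .
  moreover have "(\<chi> i. if i = k then axis l 1 else if i = l then ?c *s axis k 1 else mask ?J X $ i)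
     = (\<chi> i. if i = l then ?c *s axis k 1 else if i = k then axis l 1 else mask ?J X $ i)"
    using kl by (auto simp: vec_eq_iff)
  moreover have "det (\<chi> i. if i = l then ?c *s axis k 1 else if i = k then axis l 1 else mask ?J X $ i)
     = ?c * det (\<chi> i. if i = l then axis k 1 else if i = k then axis l 1 else mask ?J X $ i)"
    using det_row_mul[of l ?c "\<lambda>i. axis k 1" "\<lambda>i. if i = k then axis l 1 else mask ?J X $ i"] .
  moreover have "(\<chi> i. if i = l then axis k 1 else if i = k then axis l 1 else mask ?J X $ i)
     = (\<chi> i. mask ?J X $ Transposition.transpose k l i)"
    using kl by (auto simp: vec_eq_iff mask_def axis_def Transposition.transpose_def)
  moreover have "det (\<chi> i. mask ?J X $ Transposition.transpose k l i) = - det (mask ?J X)"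
    using det_permute_rows[of "Transposition.transpose k l" "mask ?J X"] kl
    by (simp add: permutes_swap_id sign_swap_id)
  ultimately show ?thesis by (simp add: power2_eq_square)
qed

text \<open>The exponent is real and only an inequality is required: splitting off a pivot divides the determinant by \<open>s\<close> or
  \<open>s^2\<close>, and no divisibility in a polynomial ring has to be tracked.\<close>

definition vanishing :: "'n set \<Rightarrow> real^'n^'n \<Rightarrow> real^'n^'n \<Rightarrow> real \<Rightarrow> bool" where
  "vanishing I A B m \<longleftrightarrow>
     (\<exists>C. \<forall>s. 0 < s \<and> s < 1 \<longrightarrow> \<bar>det (mask I (B + s *\<^sub>R A))\<bar> \<le> C * s powr m)"

text \<open>A certificate of instability in the style of the Hilbert-Mumford criterion: in suitable coordinates, scaling
  coordinate \<open>i\<close> by \<open>\<epsilon>^(- w i)\<close> enlarges \<open>A\<close> by at most \<open>1 / \<epsilon>\<close> and leaves \<open>B\<close> bounded.\<close>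

definition weighted :: "'n set \<Rightarrow> real^'n^'n \<Rightarrow> real^'n^'n \<Rightarrow> real \<Rightarrow> bool" where
  "weighted I A B m \<longleftrightarrow> (\<exists>M w. det M \<noteq> 0 \<and> identity_outside I M \<and> m / 2 \<le> sum w I \<and>
     (\<forall>i\<in>I. \<forall>j\<in>I. (congr_by M A $ i $ j \<noteq> 0 \<longrightarrow> w i + w j \<le> 1) \<and>
                   (congr_by M B $ i $ j \<noteq> 0 \<longrightarrow> w i + w j \<le> 0)))"

lemma vanishing_congr_by:
  assumes "vanishing I A B m" "identity_outside I N"
  shows "vanishing I (congr_by N A) (congr_by N B) m"
proof -
  obtain C where C: "\<And>s. 0 < s \<Longrightarrow> s < 1 \<Longrightarrow> \<bar>det (mask I (B + s *\<^sub>R A))\<bar> \<le> C * s powr m"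
    using assms(1) unfolding vanishing_def by blast
  have "\<bar>det (mask I (congr_by N B + s *\<^sub>R congr_by N A))\<bar> \<le> (det N)\<^sup>2 * C * s powr m" if "0 < s" "s < 1" for s
  proof -
    have "\<bar>det (mask I (congr_by N B + s *\<^sub>R congr_by N A))\<bar> = (det N)\<^sup>2 * \<bar>det (mask I (B + s *\<^sub>R A))\<bar>"
      by (simp add: congr_by_add_scaleR[symmetric] mask_congr_by[OF assms(2)] det_congr_by abs_mult)
    also have "\<dots> \<le> (det N)\<^sup>2 * (C * s powr m)"
      by (intro mult_left_mono C that) auto
    finally show ?thesis by (simp add: mult.assoc)
  qed
  then show ?thesis unfolding vanishing_def by blast
qed

lemma weighted_congr_by:
  assumes "weighted I (congr_by N A) (congr_by N B) m" "identity_outside I N" "det N \<noteq> 0"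
  shows "weighted I A B m"
proof -
  obtain M w where M: "det M \<noteq> 0" "identity_outside I M" "m / 2 \<le> sum w I"
     "\<forall>i\<in>I. \<forall>j\<in>I. (congr_by M (congr_by N A) $ i $ j \<noteq> 0 \<longrightarrow> w i + w j \<le> 1) \<and>
                   (congr_by M (congr_by N B) $ i $ j \<noteq> 0 \<longrightarrow> w i + w j \<le> 0)"
    using assms(1) unfolding weighted_def by blast
  show ?thesis
    unfolding weighted_def
    by (rule exI[of _ "M ** N"], rule exI[of _ w])
      (use M assms in \<open>auto simp: congr_by_mult det_mul identity_outside_mult\<close>)
qed

lemma vanishing_singular:
  assumes "vanishing I A B m" "m > 0"
  shows "det (mask I B) = 0"
proof -
  obtain C where C: "\<And>s. 0 < s \<Longrightarrow> s < 1 \<Longrightarrow> \<bar>det (mask I (B + s *\<^sub>R A))\<bar> \<le> C * s powr m"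
    using assms(1) unfolding vanishing_def by blast
  define A0 where "A0 = (\<chi> i j. if i \<in> I \<and> j \<in> I then A $ i $ j else 0)"
  have eq: "det (mask I (B + s *\<^sub>R A)) = poly (pencil_poly A0 (mask I B)) s" for s
    unfolding poly_pencil_poly by (rule arg_cong[where f=det]) (auto simp: vec_eq_iff mask_def A0_def)
  have "((\<lambda>s. \<bar>det (mask I (B + s *\<^sub>R A))\<bar>) \<longlongrightarrow> \<bar>det (mask I (B + 0 *\<^sub>R A))\<bar>) (at_right 0)"
    unfolding eq by (intro tendsto_intros)
  moreover have "((\<lambda>s. C * s powr m) \<longlongrightarrow> C * 0 powr m) (at_right 0)"
    using assms(2) by (intro tendsto_intros tendsto_powr') (auto simp: eventually_at_right_less eventually_at_right intro!: exI[of _ 1])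
  moreover have "\<forall>\<^sub>F s in at_right 0. \<bar>det (mask I (B + s *\<^sub>R A))\<bar> \<le> C * s powr m"
    using C by (intro eventually_at_rightI[of 0 1]) auto
  ultimately have "\<bar>det (mask I (B + 0 *\<^sub>R A))\<bar> \<le> C * 0 powr m"
    using tendsto_le trivial_limit_at_right_real by blast
  then show ?thesis by simp
qed

text \<open>A kernel vector becomes the new coordinate vector \<open>k\<close>.\<close>

lemma singular_pivot:
  fixes B :: "real^'n^'n"
  assumes sing: "det (mask I B) = 0" and sym: "transpose B = B"
  obtains N k where "k \<in> I" "identity_outside I N" "det N \<noteq> 0" "\<And>j. j \<in> I \<Longrightarrow> congr_by N B $ k $ j = 0"
proof -
  have "\<not> invertible (mask I B)" using sing invertible_det_nz by blast
  then obtain x where x: "mask I B *v x = 0" "x \<noteq> 0"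
    unfolding invertible_left_inverse matrix_left_invertible_ker by blast
  have x0: "x $ i = 0" if "i \<notin> I" for i
  proof -
    have "(mask I B *v x) $ i = (\<Sum>j\<in>UNIV. mask I B $ i $ j * x $ j)"
      by (simp add: matrix_vector_mult_def)
    also have "\<dots> = mask I B $ i $ i * x $ i"
      using that by (intro sum_eq_single[where f="\<lambda>j. mask I B $ i $ j * x $ j"]) (auto simp: mask_def)
    finally show ?thesis using x that by (simp add: mask_def)
  qed
  have Bx: "(B *v x) $ i = 0" if "i \<in> I" for i
  proof -
    have "(B *v x) $ i = (mask I B *v x) $ i"
      unfolding matrix_vector_mult_def vec_lambda_beta
      using that x0 by (intro sum.cong refl) (auto simp: mask_def)
    then show ?thesis using x by simp
  qed
  obtain k where k: "x $ k \<noteq> 0" using x(2) by (auto simp: vec_eq_iff)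
  define N where "N = (\<chi> i j. if i = k then x $ j else if i = j then 1 else 0)"
  have "transpose N = (\<chi> i j. if j = k then x $ i else (mat 1 :: real^'n^'n) $ i $ j)"
    by (auto simp: vec_eq_iff N_def mat_def transpose_def)
  then have "det (transpose N) = x $ k"
    using cramer_lemma[of k "mat 1 :: real^'n^'n" x] by (simp only: matrix_vector_mul_lid det_I mult_1_right)
  then have det: "det N \<noteq> 0" using k by simp
  have kI: "k \<in> I" using k x0 by blast
  have supp: "identity_outside I N" using x0 kI by (auto simp: identity_outside_def N_def)
  have Nk: "N $ k = x" by (simp add: N_def vec_eq_iff)
  have "congr_by N B $ k $ j = 0" if "j \<in> I" for j
  proof -
    have "congr_by N B $ k $ j = (B *v x) \<bullet> N $ j"
      unfolding congr_by_nth Nk by (rule symmetric_matrix_inner[OF sym])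
    also have "\<dots> = 0"
      unfolding inner_vec_def inner_real_def
    proof (rule sum.neutral, intro ballI)
      fix i show "(B *v x) $ i * N $ j $ i = 0"
        using Bx[of i] supp that by (cases "i \<in> I") (auto simp: identity_outside_def)
    qed
    finally show ?thesis .
  qed
  then show thesis using that kI supp det by blast
qed

text \<open>The entry of \<open>A\<close> at \<open>(k, k)\<close> is the only possibly nonzero one within \<open>I\<close>, in either matrix, that involves \<open>k\<close>, so \<open>k\<close> can carry the weight
  \<open>1 / 2\<close>. This accounts for half of the loss of one in the order of vanishing.\<close>

lemma weighted_split_diagonal:
  fixes A B :: "real^'n^'n"
  assumes k: "k \<in> I" and A: "\<And>j. j \<in> I - {k} \<Longrightarrow> A $ k $ j = 0 \<and> A $ j $ k = 0"
    and B: "\<And>j. j \<in> I \<Longrightarrow> B $ k $ j = 0 \<and> B $ j $ k = 0"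
    and IH: "weighted (I - {k}) A B (m - 1)"
    and symA: "transpose A = A" and symB: "transpose B = B"
  shows "weighted I A B m"
proof -
  let ?J = "I - {k}"
  obtain M w where M: "det M \<noteq> 0" "identity_outside ?J M" "(m - 1) / 2 \<le> sum w ?J"
     "\<And>i j. i \<in> ?J \<Longrightarrow> j \<in> ?J \<Longrightarrow> (congr_by M A $ i $ j \<noteq> 0 \<longrightarrow> w i + w j \<le> 1) \<and>
                   (congr_by M B $ i $ j \<noteq> 0 \<longrightarrow> w i + w j \<le> 0)"
    using IH unfolding weighted_def by blast
  have symc: "congr_by M A $ i $ j = congr_by M A $ j $ i" "congr_by M B $ i $ j = congr_by M B $ j $ i" for i j
    by (rule symmetric_nth; simp add: transpose_congr_by symA symB)+
  have kj: "congr_by M A $ k $ j = 0" "congr_by M B $ k $ j = 0" if "j \<in> ?J" for j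
    using that A B by (auto intro!: congr_by_outside_inside[OF M(2)])
  have kk: "congr_by M B $ k $ k = 0"
    using B k congr_by_outside_outside[OF M(2), of k k B] by simp
  let ?w = "w(k := 1/2)"
  have "sum ?w I = 1/2 + sum ?w ?J"
    using k by (subst sum.remove[of I k]) auto
  also have "sum ?w ?J = sum w ?J" by (intro sum.cong) auto
  finally have "m / 2 \<le> sum ?w I" using M(3) by (simp add: field_simps)
  moreover have "(congr_by M A $ i $ j \<noteq> 0 \<longrightarrow> ?w i + ?w j \<le> 1) \<and> (congr_by M B $ i $ j \<noteq> 0 \<longrightarrow> ?w i + ?w j \<le> 0)"
    if "i \<in> I" "j \<in> I" for i j
    using that M(4)[of i j] kj[of i] kj[of j] kk symc[of i k]
    by (cases "i = k"; cases "j = k") auto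
  moreover have "identity_outside I M" using M(2) by (rule identity_outside_mono) auto
  ultimately show ?thesis
    unfolding weighted_def using M(1) by blast
qed

text \<open>Coordinate \<open>k\<close> only meets \<open>l\<close>, and only in \<open>A\<close>, so the weights of \<open>k\<close> and \<open>l\<close> may have sum 1, half of the loss of
  two in the order of vanishing. In \<open>B\<close>, however, \<open>l\<close> may meet any other coordinate; a very negative weight of \<open>l\<close>,
  compensated by \<open>k\<close>, takes care of that.\<close>

lemma weighted_split_hyperbolic:
  fixes A B :: "real^'n^'n"
  assumes kl: "k \<in> I" "l \<in> I" "k \<noteq> l"
    and A: "\<And>j. j \<in> I - {k, l} \<Longrightarrow> A $ k $ j = 0 \<and> A $ l $ j = 0" "A $ k $ k = 0" "A $ l $ l = 0"
    and B: "\<And>j. j \<in> I \<Longrightarrow> B $ k $ j = 0"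
    and IH: "weighted (I - {k, l}) A B (m - 2)"
    and symA: "transpose A = A" and symB: "transpose B = B"
  shows "weighted I A B m"
proof -
  let ?J = "I - {k, l}"
  obtain M w where M: "det M \<noteq> 0" "identity_outside ?J M" "(m - 2) / 2 \<le> sum w ?J"
     "\<And>i j. i \<in> ?J \<Longrightarrow> j \<in> ?J \<Longrightarrow> (congr_by M A $ i $ j \<noteq> 0 \<longrightarrow> w i + w j \<le> 1) \<and>
                   (congr_by M B $ i $ j \<noteq> 0 \<longrightarrow> w i + w j \<le> 0)"
    using IH unfolding weighted_def by blast
  have symc: "congr_by M A $ i $ j = congr_by M A $ j $ i" "congr_by M B $ i $ j = congr_by M B $ j $ i" for i j
    by (rule symmetric_nth; simp add: transpose_congr_by symA symB)+
  have kj: "congr_by M A $ k $ j = 0" "congr_by M B $ k $ j = 0" "congr_by M A $ l $ j = 0" if "j \<in> ?J" for j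
    using that A B by (auto intro!: congr_by_outside_inside[OF M(2)])
  have out: "congr_by M X $ k $ k = X $ k $ k" "congr_by M X $ k $ l = X $ k $ l" "congr_by M X $ l $ l = X $ l $ l" for X
    by (simp_all add: congr_by_outside_outside[OF M(2)])
  define L where "L = (\<Sum>i\<in>?J. \<bar>w i\<bar>)"
  have L: "L \<ge> 0" "i \<in> ?J \<Longrightarrow> w i \<le> L" for i
    unfolding L_def using member_le_sum[of i ?J "\<lambda>i. \<bar>w i\<bar>"] by (auto intro: sum_nonneg)
  (* L dominates all other weights, so l may meet every coordinate of ?J. *)
  let ?w = "\<lambda>i. if i = l then - L else if i = k then 1 + L else w i"
  have "sum ?w I = ?w k + (?w l + sum ?w (I - {k} - {l}))"
    using kl by (subst sum.remove[of I k], simp, simp) (subst sum.remove[of _ l], auto)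
  also have "I - {k} - {l} = ?J" by auto
  also have "sum ?w ?J = sum w ?J" by (intro sum.cong) auto
  finally have "sum ?w I = 1 + sum w ?J" using kl by simp
  then have "m / 2 \<le> sum ?w I" using M(3) by (simp add: field_simps)
  moreover have "(congr_by M A $ i $ j \<noteq> 0 \<longrightarrow> ?w i + ?w j \<le> 1) \<and> (congr_by M B $ i $ j \<noteq> 0 \<longrightarrow> ?w i + ?w j \<le> 0)"
    if ij: "i \<in> I" "j \<in> I" for i j
  proof -
    have l: "w i + - L \<le> 0" if "i \<in> ?J" for i using L(2)[OF that] by simp
    consider "i \<in> ?J" "j \<in> ?J" | "i \<in> ?J" "j = k" | "i \<in> ?J" "j = l" | "i = k" "j \<in> ?J" | "i = l" "j \<in> ?J"
      | "i = k" "j = k" | "i = k" "j = l" | "i = l" "j = k" | "i = l" "j = l"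
      using ij by blast
    then show ?thesis
    proof cases
      case 1 then show ?thesis using M(4)[of i j] by auto
    next
      case 2 then show ?thesis using kj[of i] symc[of i k] by auto
    next
      case 3 then show ?thesis using kj[of i] symc[of i l] l[of i] by auto
    next
      case 4 then show ?thesis using kj[of j] by auto
    next
      case 5 then show ?thesis using kj[of j] l[of j] by auto
    next
      case 6 then show ?thesis using out A B kl by auto
    next
      case 7 then show ?thesis using out B kl by auto
    next
      case 8 then show ?thesis using out B kl symc[of l k] by auto
    next
      case 9 then show ?thesis using out A kl L(1) by auto
    qed
  qed
  moreover have "identity_outside I M" using M(2) by (rule identity_outside_mono) auto
  ultimately show ?thesis
    unfolding weighted_def using M(1) by blast
qed

text \<open>This is the converse half of the dichotomy. If the order is positive, then \<open>B\<close> is singular on \<open>I\<close>, and after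
  a change of coordinates its row \<open>k\<close> is zero there. Now row \<open>k\<close> of \<open>A\<close> decides. If its diagonal entry is not zero,
  it is a pivot: clearing the row splits off one coordinate and one factor \<open>s\<close>. If the diagonal entry is zero but
  another one is not, the two coordinates form a hyperbolic plane, and splitting it off removes a factor \<open>s^2\<close>. If the
  whole row is zero, then \<open>k\<close> does not occur in either matrix and can carry any weight.\<close>

lemma vanishing_weighted:
  fixes A B :: "real^'n^'n"
  assumes "transpose A = A" "transpose B = B" "vanishing I A B m"
  shows "weighted I A B m"
  using assms
proof (induction "card I" arbitrary: I A B m rule: less_induct)
  case (less I A B m)
  have fin: "finite I" by simp
  have id: "congr_by (mat 1) X = X" for X :: "real^'n^'n"
    by (simp add: congr_by_def transpose_mat)
  have supp_id: "identity_outside I (mat 1)" by (simp add: identity_outside_def mat_def)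
  show ?case
  proof (cases "m \<le> 0")
    case True
    then show ?thesis
      unfolding weighted_def by (intro exI[of _ "mat 1"] exI[of _ "\<lambda>_. 0"]) (auto simp: supp_id)
  next
    case False
    then have "det (mask I B) = 0" using vanishing_singular[OF less.prems(3)] by simp
    then obtain N k where k: "k \<in> I" and N: "identity_outside I N" "det N \<noteq> 0" "\<And>j. j \<in> I \<Longrightarrow> congr_by N B $ k $ j = 0"
      using singular_pivot less.prems by metis
    define A1 B1 where "A1 = congr_by N A" and "B1 = congr_by N B"
    have sym1: "transpose A1 = A1" "transpose B1 = B1"
      using less.prems by (simp_all add: A1_def B1_def transpose_congr_by)
    have van1: "vanishing I A1 B1 m"
      unfolding A1_def B1_def using less.prems N(1) by (intro vanishing_congr_by)
    have B1: "\<And>j. j \<in> I \<Longrightarrow> B1 $ k $ j = 0" using N(3) by (simp add: B1_def)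
    have "weighted I A1 B1 m"
    proof (cases "A1 $ k $ k = 0")
      case False
      (* A pivot on the diagonal: clear row and column k of A1. Row k of B1 is zero and
         stays so. *)
      let ?a = "A1 $ k $ k" and ?J = "I - {k}"
      define v where "v i = (if i \<in> ?J then - A1 $ i $ k / ?a else 0)" for i
      let ?A = "congr_by (shear k v) A1" and ?B = "congr_by (shear k v) B1"
      have v: "v k = 0" by (simp add: v_def)
      have supp: "identity_outside I (shear k v)" using k by (intro identity_outside_shear) (auto simp: v_def)
      have sym: "transpose ?A = ?A" "transpose ?B = ?B" by (simp_all add: transpose_congr_by sym1)
      have A: "?A $ k $ j = 0 \<and> ?A $ j $ k = 0" if "j \<in> ?J" for j
        using that False symmetric_nth[OF sym1(1), of j k] by (simp add: congr_by_shear[of v k, OF v] v) (simp add: v_def)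
      have Akk: "?A $ k $ k = ?a" by (simp add: congr_by_shear[of v k, OF v] v)
      have B: "?B $ k $ j = 0 \<and> ?B $ j $ k = 0" if "j \<in> I" for j
        using that B1 k symmetric_nth[OF sym1(2), of j k] by (simp add: congr_by_shear[of v k, OF v] v)
      obtain C where C: "\<And>s. 0 < s \<Longrightarrow> s < 1 \<Longrightarrow> \<bar>det (mask I (?B + s *\<^sub>R ?A))\<bar> \<le> C * s powr m"
        using vanishing_congr_by[OF van1 supp] unfolding vanishing_def by blast
      have "\<bar>det (mask ?J (?B + s *\<^sub>R ?A))\<bar> \<le> C / \<bar>?a\<bar> * s powr (m - 1)" if s: "0 < s" "s < 1" for s
      proof -
        have "det (mask I (?B + s *\<^sub>R ?A)) = (?B + s *\<^sub>R ?A) $ k $ k * det (mask ?J (?B + s *\<^sub>R ?A))"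
          using A B k by (intro det_mask_split_diagonal) auto
        also have "(?B + s *\<^sub>R ?A) $ k $ k = s * ?a" using B k Akk by simp
        finally have "s * \<bar>?a\<bar> * \<bar>det (mask ?J (?B + s *\<^sub>R ?A))\<bar> \<le> C * s powr m"
          using C[OF s] s by (simp add: abs_mult)
        then show ?thesis using s False by (simp add: powr_diff field_simps)
      qed
      then have "vanishing ?J ?A ?B (m - 1)" unfolding vanishing_def by blast
      moreover have "card ?J < card I" using k fin by (intro psubset_card_mono) auto
      ultimately have "weighted ?J ?A ?B (m - 1)" using less.hyps sym by blast
      then have "weighted I ?A ?B m"
        using weighted_split_diagonal[of k I ?A ?B m] k A B sym by blast
      then show ?thesis using weighted_congr_by supp by (metis det_shear zero_neq_one)
    next
      case True
      show ?thesis
      proof (cases "\<forall>j\<in>I. A1 $ k $ j = 0")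
        (* Coordinate k occurs in neither matrix and carries all the weight. *)
        case allz: True
        have "sum (\<lambda>i. if i = k then m / 2 else 0) I = m / 2" using k fin by simp
        then show ?thesis
          unfolding weighted_def
          by (intro exI[of _ "mat 1"] exI[of _ "\<lambda>i. if i = k then m / 2 else 0"])
            (use allz B1 symmetric_nth[OF sym1(1), of _ k] symmetric_nth[OF sym1(2), of _ k] in \<open>auto simp: supp_id id\<close>)
      next
        case False
        then obtain l where l: "l \<in> I" "A1 $ k $ l \<noteq> 0" by blast
        then have kl: "k \<noteq> l" using True by blast
        (* A hyperbolic plane: first clear row k except at l, then use it to clear row l. *)
        let ?a = "A1 $ k $ l" and ?J = "I - {k, l}"
        define v where "v i = (if i \<in> ?J then - A1 $ i $ k / ?a else 0)" for i
        define A2 B2 where "A2 = congr_by (shear l v) A1" and "B2 = congr_by (shear l v) B1"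
        have v: "v k = 0" "v l = 0" by (simp_all add: v_def)
        have supp2: "identity_outside I (shear l v)" using l by (intro identity_outside_shear) (auto simp: v_def)
        have sym2: "transpose A2 = A2" "transpose B2 = B2" by (simp_all add: A2_def B2_def transpose_congr_by sym1)
        have A2: "A2 $ k $ j = 0" if "j \<in> ?J" for j
          using that l kl symmetric_nth[OF sym1(1), of j k]
          by (simp add: A2_def congr_by_shear[of v l, OF v(2)] v) (simp add: v_def)
        have A2k: "A2 $ k $ k = 0" "A2 $ k $ l = ?a"
          using True by (simp_all add: A2_def congr_by_shear[of v l, OF v(2)] v)
        have B2: "B2 $ k $ j = 0" if "j \<in> I" for j
          using that B1 l by (simp add: B2_def congr_by_shear[of v l, OF v(2)] v)
        define u where "u i = (if i \<in> ?J then - A2 $ i $ l / ?a else if i = l then - A2 $ l $ l / (2 * ?a) else 0)" for i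
        let ?A = "congr_by (shear k u) A2" and ?B = "congr_by (shear k u) B2"
        have u: "u k = 0" using kl by (simp add: u_def)
        have supp3: "identity_outside I (shear k u)" using k l by (intro identity_outside_shear) (auto simp: u_def)
        have sym3: "transpose ?A = ?A" "transpose ?B = ?B" by (simp_all add: transpose_congr_by sym2)
        have Ak: "?A $ k $ j = A2 $ k $ j" for j
          by (simp add: congr_by_shear[of u k, OF u] u A2k)
        have A: "?A $ k $ j = 0 \<and> ?A $ l $ j = 0" if "j \<in> ?J" for j
          using that A2[OF that] l kl A2k symmetric_nth[OF sym2(1), of l k] symmetric_nth[OF sym2(1), of l j] symmetric_nth[OF sym2(1), of j k]
          by (simp add: congr_by_shear[of u k, OF u] u) (simp add: u_def)
        have All: "?A $ l $ l = 0"
          using l kl A2k symmetric_nth[OF sym2(1), of l k] by (simp add: congr_by_shear[of u k, OF u]) (simp add: u_def)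
        have B: "?B $ k $ j = 0" if "j \<in> I" for j
          using B2[OF that] B2[OF k] by (simp add: congr_by_shear[of u k, OF u] u)
        obtain C where C: "\<And>s. 0 < s \<Longrightarrow> s < 1 \<Longrightarrow> \<bar>det (mask I (?B + s *\<^sub>R ?A))\<bar> \<le> C * s powr m"
          using vanishing_congr_by[OF vanishing_congr_by[OF van1 supp2] supp3]
          unfolding vanishing_def A2_def B2_def by blast
        have "\<bar>det (mask ?J (?B + s *\<^sub>R ?A))\<bar> \<le> C / ?a\<^sup>2 * s powr (m - 2)" if s: "0 < s" "s < 1" for s
        proof -
          have skl: "(?B + s *\<^sub>R ?A) $ k $ l = s * ?a" using B l Ak A2k by simp
          have "transpose (?B + s *\<^sub>R ?A) = ?B + s *\<^sub>R ?A"
            using symmetric_nth[OF sym3(1)] symmetric_nth[OF sym3(2)] by (simp add: vec_eq_iff transpose_def)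
          then have "det (mask I (?B + s *\<^sub>R ?A)) = - ((?B + s *\<^sub>R ?A) $ k $ l)\<^sup>2 * det (mask ?J (?B + s *\<^sub>R ?A))"
            using A B k l kl Ak A2k s skl by (intro det_mask_split_hyperbolic) auto
          then have "\<bar>det (mask I (?B + s *\<^sub>R ?A))\<bar> = s\<^sup>2 * ?a\<^sup>2 * \<bar>det (mask ?J (?B + s *\<^sub>R ?A))\<bar>"
            unfolding skl by (simp add: abs_mult power_mult_distrib)
          then have le: "s\<^sup>2 * ?a\<^sup>2 * \<bar>det (mask ?J (?B + s *\<^sub>R ?A))\<bar> \<le> C * s powr m"
            using C[OF s] by simp
          have "C * s powr m = s\<^sup>2 * (C * s powr (m - 2))"
            using s by (simp add: powr_diff)
          then have "s\<^sup>2 * (?a\<^sup>2 * \<bar>det (mask ?J (?B + s *\<^sub>R ?A))\<bar>) \<le> s\<^sup>2 * (C * s powr (m - 2))"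
            using le by (simp only: mult.assoc)
          then have "?a\<^sup>2 * \<bar>det (mask ?J (?B + s *\<^sub>R ?A))\<bar> \<le> C * s powr (m - 2)"
            by (rule mult_left_le_imp_le) (use s in simp)
          then show ?thesis using l(2) by (simp add: pos_le_divide_eq mult.commute)
        qed
        then have "vanishing ?J ?A ?B (m - 2)" unfolding vanishing_def by blast
        moreover have "card ?J < card I" using k fin by (intro psubset_card_mono) auto
        ultimately have "weighted ?J ?A ?B (m - 2)" using less.hyps sym3 by blast
        then have "weighted I ?A ?B m"
          using weighted_split_hyperbolic[of k I l ?A ?B m] k l kl A B sym3 All Ak A2k by simp
        then have "weighted I A2 B2 m" using weighted_congr_by supp3 by (metis det_shear zero_neq_one)
        then show ?thesis unfolding A2_def B2_def using weighted_congr_by supp2 by (metis det_shear zero_neq_one)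
      qed
    qed
    then show ?thesis unfolding A1_def B1_def using weighted_congr_by N by blast
  qed
qed

section \<open>Instability and multiple roots are equivalent\<close>

text \<open>The order of vanishing is at least \<open>d div 2 + 1\<close>, and half of this exceeds \<open>d / 4\<close>.\<close>

lemma deep_root_weights:
  fixes A B :: "real^'n^'n"
  assumes "transpose A = A" "transpose B = B" "deep_root A B"
  obtains M and w :: "'n \<Rightarrow> real" where "det M = 1" "real CARD('n) / 4 < sum w UNIV"
    "\<And>i j. congr_by M A $ i $ j \<noteq> 0 \<Longrightarrow> w i + w j \<le> 1"
    "\<And>i j. congr_by M B $ i $ j \<noteq> 0 \<Longrightarrow> w i + w j \<le> 0"
proof -
  have mask: "mask UNIV X = X" for X :: "real^'n^'n" by (simp add: mask_def vec_eq_iff)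
  have "vanishing UNIV A B (real (CARD('n) div 2 + 1))"
    using deep_root_det_bound[OF assms(3)] unfolding vanishing_def mask .
  then have "weighted UNIV A B (real (CARD('n) div 2 + 1))"
    by (intro vanishing_weighted assms)
  then obtain M :: "real^'n^'n" and w :: "'n \<Rightarrow> real" where M: "det M \<noteq> 0" "real (CARD('n) div 2 + 1) / 2 \<le> sum w UNIV"
     "\<And>i j. congr_by M A $ i $ j \<noteq> 0 \<Longrightarrow> w i + w j \<le> 1"
     "\<And>i j. congr_by M B $ i $ j \<noteq> 0 \<Longrightarrow> w i + w j \<le> 0"
    unfolding weighted_def by auto
  (* Rescaling a single row makes the determinant one and keeps the zero pattern. *)
  fix k :: 'n
  define c where "c i = (if i = k then 1 / det M else 1)" for i
  define N where "N = (\<chi> i. c i *s M $ i)"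
  have "N = (\<chi> i. if i = k then (1 / det M) *s M $ i else M $ i)"
    by (auto simp: N_def c_def vec_eq_iff)
  moreover have "M = (\<chi> i. if i = k then M $ i else M $ i)" by (simp add: vec_eq_iff)
  ultimately have "det N = 1 / det M * det M"
    using det_row_mul[of k "1 / det M" "\<lambda>i. M $ i" "\<lambda>i. M $ i"] by simp
  then have "det N = 1" using M(1) by simp
  moreover have "congr_by N X $ i $ j = c i * c j * congr_by M X $ i $ j" for X i j
    by (simp add: congr_by_nth N_def scalar_mult_eq_scaleR matrix_vector_mult_scaleR)
  moreover have "real CARD('n) / 4 < sum w UNIV"
  proof -
    have "n < 2 * (n div 2 + 1)" for n :: nat by presburger
    then have "real CARD('n) < real (2 * (CARD('n) div 2 + 1))" by (simp only: of_nat_less_iff)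
    then show ?thesis using M(2) by simp
  qed
  ultimately show thesis using that[of N w] M by auto
qed

text \<open>Scaling row \<open>i\<close> by a power of \<open>\<epsilon>\<close> with exponent \<open>W / d - w i\<close>, where \<open>W\<close> is the sum of the weights,
  preserves the determinant. It multiplies the product of the two matrices, and so the wedge before squaring, by at most
  \<open>\<epsilon>^(4 W / d - 1)\<close>; the exponent is positive because \<open>W > d / 4\<close>.\<close>

lemma unstable_pair_of_weights:
  fixes A B :: "real^'n^'n" and w :: "'n \<Rightarrow> real"
  assumes M: "det M = 1" and W: "real CARD('n) / 4 < sum w UNIV"
    and A: "\<And>i j. congr_by M A $ i $ j \<noteq> 0 \<Longrightarrow> w i + w j \<le> 1"
    and B: "\<And>i j. congr_by M B $ i $ j \<noteq> 0 \<Longrightarrow> w i + w j \<le> 0"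
  shows "unstable_pair A B"
proof -
  let ?d = "real CARD('n)" and ?W = "sum w UNIV"
  (* Subtracting the weights from their mean keeps the determinant equal to one. *)
  define N where "N \<epsilon> = (\<chi> i. (\<epsilon> powr (?W / ?d - w i)) *s M $ i)" for \<epsilon>
  define K where "K = norm (congr_by M A) + norm (congr_by M B)"
  define \<gamma> where "\<gamma> = 4 * ?W / ?d - 1"
  have \<gamma>: "\<gamma> > 0" using W by (simp add: \<gamma>_def field_simps)
  have nth: "\<bar>X $ i $ j\<bar> \<le> norm X" for X :: "real^'n^'n" and i j
    using order_trans[OF component_le_norm_cart Finite_Cartesian_Product.norm_nth_le] by blast
  have K: "\<bar>congr_by M A $ i $ j\<bar> \<le> K" "\<bar>congr_by M B $ i $ j\<bar> \<le> K" "K \<ge> 0" for i j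
    using order_trans[OF nth, of "congr_by M A" K i j] order_trans[OF nth, of "congr_by M B" K i j]
    by (simp_all add: K_def)
  have detN: "det (N \<epsilon>) = 1" if "\<epsilon> > 0" for \<epsilon>
  proof -
    have "det (N \<epsilon>) = (\<Prod>i\<in>UNIV. \<epsilon> powr (?W / ?d - w i)) * det M"
      unfolding N_def det_rows_mul by simp
    also have "(\<Prod>i\<in>UNIV. \<epsilon> powr (?W / ?d - w i)) = \<epsilon> powr (\<Sum>i\<in>UNIV. ?W / ?d - w i)"
      using that by (simp add: powr_sum)
    also have "(\<Sum>i\<in>UNIV. ?W / ?d - w i) = 0" by (simp add: sum_subtractf)
    finally show ?thesis using M that by simp
  qed
  have cN: "congr_by (N \<epsilon>) X $ i $ j = \<epsilon> powr (2 * ?W / ?d - (w i + w j)) * congr_by M X $ i $ j"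
    if "\<epsilon> > 0" for \<epsilon> X i j
  proof -
    have "\<epsilon> powr (?W / ?d - w j) * \<epsilon> powr (?W / ?d - w i) = \<epsilon> powr (2 * ?W / ?d - (w i + w j))"
      unfolding powr_add[symmetric] by (rule arg_cong[where f="\<lambda>x. \<epsilon> powr x"]) linarith
    then show ?thesis
      by (simp add: congr_by_nth N_def scalar_mult_eq_scaleR matrix_vector_mult_scaleR flip: mult.assoc)
  qed
  have bound: "\<bar>congr_by (N \<epsilon>) X $ i $ j\<bar> \<le> \<epsilon> powr (2 * ?W / ?d - b) * K"
    if "0 < \<epsilon>" "\<epsilon> < 1" and X: "\<And>i j. congr_by M X $ i $ j \<noteq> 0 \<Longrightarrow> w i + w j \<le> b"
      "\<And>i j. \<bar>congr_by M X $ i $ j\<bar> \<le> K" for \<epsilon> b X i j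
  proof (cases "congr_by M X $ i $ j = 0")
    case True then show ?thesis using K that by (simp add: cN)
  next
    case False
    have "\<epsilon> powr (2 * ?W / ?d - (w i + w j)) \<le> \<epsilon> powr (2 * ?W / ?d - b)"
    proof -
      have "2 * ?W / ?d - b \<le> 2 * ?W / ?d - (w i + w j)" using X(1)[OF False] by linarith
      then show ?thesis using that(1,2) by (intro powr_mono') auto
    qed
    then show ?thesis
      unfolding cN[OF that(1)] abs_mult using X(2)[of i j] by (intro mult_mono) auto
  qed
  have wedge: "pair_wedge (congr_by (N \<epsilon>) A) (congr_by (N \<epsilon>) B) \<le> (?d ^ 4 * (2 * K\<^sup>2)\<^sup>2) * \<epsilon> powr (2 * \<gamma>)"
    if \<epsilon>: "0 < \<epsilon>" "\<epsilon> < 1" for \<epsilon>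
  proof -
    let ?A = "congr_by (N \<epsilon>) A" and ?B = "congr_by (N \<epsilon>) B"
    have prod: "\<bar>?A $ i $ j * ?B $ k $ l\<bar> \<le> K\<^sup>2 * \<epsilon> powr \<gamma>" for i j k l
    proof -
      have "\<bar>?A $ i $ j\<bar> * \<bar>?B $ k $ l\<bar> \<le> (\<epsilon> powr (2 * ?W / ?d - 1) * K) * (\<epsilon> powr (2 * ?W / ?d - 0) * K)"
        using A B K \<epsilon> by (intro mult_mono bound) auto
      also have "\<dots> = K\<^sup>2 * \<epsilon> powr \<gamma>"
      proof -
        have "\<epsilon> powr (2 * ?W / ?d - 1) * \<epsilon> powr (2 * ?W / ?d - 0) = \<epsilon> powr \<gamma>"
          unfolding powr_add[symmetric] \<gamma>_def by (rule arg_cong[where f="\<lambda>x. \<epsilon> powr x"]) linarith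
        then show ?thesis by (metis (no_types) mult.assoc mult.commute power2_eq_square)
      qed
      finally show ?thesis by (simp add: abs_mult)
    qed
    have "(?A $ j1 $ j2 * ?B $ k1 $ k2 - ?A $ k1 $ k2 * ?B $ j1 $ j2)\<^sup>2 \<le> (2 * K\<^sup>2 * \<epsilon> powr \<gamma>)\<^sup>2" for j1 j2 k1 k2
      using prod[of j1 j2 k1 k2] prod[of k1 k2 j1 j2] by (intro abs_le_square_iff[THEN iffD1]) linarith
    then have "pair_wedge ?A ?B \<le> (\<Sum>j1\<in>(UNIV::'n set). \<Sum>j2\<in>(UNIV::'n set). \<Sum>k1\<in>(UNIV::'n set). \<Sum>k2\<in>(UNIV::'n set). (2 * K\<^sup>2 * \<epsilon> powr \<gamma>)\<^sup>2)"
      unfolding pair_wedge_def by (intro sum_mono)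
    also have "\<dots> = (?d ^ 4 * (2 * K\<^sup>2)\<^sup>2) * (\<epsilon> powr \<gamma>)\<^sup>2"
      by (simp add: power_mult_distrib power4_eq_xxxx)
    also have "(\<epsilon> powr \<gamma>)\<^sup>2 = \<epsilon> powr (2 * \<gamma>)"
      by (simp add: power2_eq_square powr_add[symmetric])
    finally show ?thesis .
  qed
  show ?thesis
    unfolding unstable_pair_def
  proof (intro allI impI)
    fix \<eta> :: real assume "\<eta> > 0"
    let ?c = "?d ^ 4 * (2 * K\<^sup>2)\<^sup>2"
    have "((\<lambda>\<epsilon>. ?c * \<epsilon> powr (2 * \<gamma>)) \<longlongrightarrow> ?c * 0 powr (2 * \<gamma>)) (at_right 0)"
      using \<gamma> by (intro tendsto_intros tendsto_powr') (auto simp: eventually_at_right intro!: exI[of _ 1])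
    then have "\<forall>\<^sub>F \<epsilon> in at_right 0. ?c * \<epsilon> powr (2 * \<gamma>) < \<eta>"
      using \<open>\<eta> > 0\<close> by (intro order_tendstoD(2)) auto
    moreover have "\<forall>\<^sub>F \<epsilon> in at_right 0. \<epsilon> > 0 \<and> \<epsilon> < (1::real)"
      by (intro eventually_at_rightI[of 0 1]) auto
    ultimately have "\<forall>\<^sub>F \<epsilon> in at_right 0. \<epsilon> > 0 \<and> \<epsilon> < 1 \<and> ?c * \<epsilon> powr (2 * \<gamma>) < \<eta>"
      by eventually_elim auto
    then obtain \<epsilon> where "\<epsilon> > 0" "\<epsilon> < 1" "?c * \<epsilon> powr (2 * \<gamma>) < \<eta>"
      using eventually_happens'[OF trivial_limit_at_right_real] by blast
    then show "\<exists>M. det M = 1 \<and> pair_wedge (congr_by M A) (congr_by M B) < \<eta>"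
      using detN wedge by (intro exI[of _ "N \<epsilon>"]) force
  qed
qed

lemma pair_wedge_add_scaleR: "pair_wedge A (B + c *\<^sub>R A) = pair_wedge A B"
  unfolding pair_wedge_def by (intro sum.cong refl arg_cong[where f="\<lambda>x. x\<^sup>2"]) (simp add: algebra_simps)

lemma unstable_pair_commute: "unstable_pair A B \<longleftrightarrow> unstable_pair B A"
  unfolding unstable_pair_def by (simp add: pair_wedge_commute)

lemma unstable_pair_add_scaleR: "unstable_pair A (B + c *\<^sub>R A) \<longleftrightarrow> unstable_pair A B"
  unfolding unstable_pair_def congr_by_add_scaleR pair_wedge_add_scaleR ..

lemma transpose_add_scaleR:
  "transpose A = A \<Longrightarrow> transpose B = B \<Longrightarrow> transpose (B + c *\<^sub>R A) = B + c *\<^sub>R (A :: real^'n^'n)"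
proof -
  have "transpose (B + c *\<^sub>R A) = transpose B + c *\<^sub>R transpose A"
    by (simp add: vec_eq_iff transpose_def)
  then show "transpose A = A \<Longrightarrow> transpose B = B \<Longrightarrow> ?thesis" by simp
qed

lemma deep_root_unstable_pair:
  assumes "transpose A = A" "transpose B = B" "deep_root A (B + c *\<^sub>R A)"
  shows "unstable_pair A B"
proof -
  obtain M and w :: "'a \<Rightarrow> real" where "det M = 1" "real CARD('a) / 4 < sum w UNIV"
    "\<And>i j. congr_by M A $ i $ j \<noteq> 0 \<Longrightarrow> w i + w j \<le> 1"
    "\<And>i j. congr_by M (B + c *\<^sub>R A) $ i $ j \<noteq> 0 \<Longrightarrow> w i + w j \<le> 0"
    using deep_root_weights[OF assms(1) transpose_add_scaleR[OF assms(1,2)] assms(3)] by blast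
  then have "unstable_pair A (B + c *\<^sub>R A)" by (rule unstable_pair_of_weights)
  then show ?thesis by (simp add: unstable_pair_add_scaleR)
qed

text \<open>Adding a multiple of one matrix to the other does not change the wedge but moves the roots of the pencil, so a
  multiple root anywhere may be moved to zero.\<close>

lemma unstable_pair_iff_deep_root:
  assumes "transpose A = A" "transpose B = B"
  shows "unstable_pair A B \<longleftrightarrow> (\<exists>c. deep_root A (B + c *\<^sub>R A)) \<or> (\<exists>c. deep_root B (A + c *\<^sub>R B))"
  using unstable_pair_deep_root[of A B] deep_root_unstable_pair[of A B] deep_root_unstable_pair[of B A] assms
    unstable_pair_commute[of A B] by blast

section \<open>Linear changes of variables in nonnegative integrals\<close>

lemma nn_integral_lborel_translate:
  fixes h :: "'a::euclidean_space \<Rightarrow> ennreal"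
  assumes [measurable]: "h \<in> borel_measurable borel"
  shows "(\<integral>\<^sup>+x. h (c + x) \<partial>lborel) = (\<integral>\<^sup>+x. h x \<partial>lborel)"
  by (subst (2) lborel_distr_plus[of c, symmetric]) (simp add: nn_integral_distr)

text \<open>Translation invariance is the only ingredient. Inserting the integral of a unit bump over an auxiliary real variable
  makes room to exchange a translation along the axis \<open>m\<close> with a translation of that variable; the space never has to
  be written as a product.\<close>

lemma nn_integral_lborel_shear:
  fixes h :: "real^'n \<Rightarrow> ennreal"
  assumes mn: "m \<noteq> n" and [measurable]: "h \<in> borel_measurable borel"
  shows "(\<integral>\<^sup>+x. h (x + (c * x $ n) *\<^sub>R axis m 1) \<partial>lborel) = (\<integral>\<^sup>+x. h x \<partial>lborel)"
proof -
  (* The bump over the auxiliary variable; its translates all have integral 1. *)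
  let ?k = "indicator {0..1::real} :: real \<Rightarrow> ennreal"
  have nth [measurable]: "(\<lambda>x::real^'n. x $ n) \<in> borel_measurable borel"
    by (intro borel_measurable_continuous_onI continuous_intros)
  have k: "(\<integral>\<^sup>+s. ?k (s + t) \<partial>lborel) = 1" for t
    using nn_integral_lborel_translate[of ?k t] by (simp add: add.commute)
  have "(\<integral>\<^sup>+x. h (x + (c * x $ n) *\<^sub>R axis m 1) \<partial>lborel)
      = (\<integral>\<^sup>+s. ?k s * (\<integral>\<^sup>+x. h (x + (c * x $ n) *\<^sub>R axis m 1) \<partial>lborel) \<partial>lborel)"
    by (subst nn_integral_multc) auto
  also have "\<dots> = (\<integral>\<^sup>+s. (\<integral>\<^sup>+x. ?k s * h (x + (s + c * x $ n) *\<^sub>R axis m 1) \<partial>lborel) \<partial>lborel)"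
  proof (rule nn_integral_cong)
    fix s :: real
    have "(\<integral>\<^sup>+x. h (x + (c * x $ n) *\<^sub>R axis m 1) \<partial>lborel)
       = (\<integral>\<^sup>+x. h ((s *\<^sub>R axis m 1 + x) + (c * (s *\<^sub>R axis m 1 + x) $ n) *\<^sub>R axis m 1) \<partial>lborel)"
      by (rule nn_integral_lborel_translate[symmetric]) measurable
    also have "\<dots> = (\<integral>\<^sup>+x. h (x + (s + c * x $ n) *\<^sub>R axis m 1) \<partial>lborel)"
      using mn by (intro nn_integral_cong arg_cong[where f=h]) (simp add: axis_def algebra_simps)
    finally show "?k s * (\<integral>\<^sup>+x. h (x + (c * x $ n) *\<^sub>R axis m 1) \<partial>lborel)
       = (\<integral>\<^sup>+x. ?k s * h (x + (s + c * x $ n) *\<^sub>R axis m 1) \<partial>lborel)"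
      by (simp add: nn_integral_cmult)
  qed
  also have "\<dots> = (\<integral>\<^sup>+x. (\<integral>\<^sup>+s. ?k s * h (x + (s + c * x $ n) *\<^sub>R axis m 1) \<partial>lborel) \<partial>lborel)"
    by (intro lborel_pair.Fubini') measurable
  also have "\<dots> = (\<integral>\<^sup>+x. (\<integral>\<^sup>+s. ?k (s - c * x $ n) * h (x + s *\<^sub>R axis m 1) \<partial>lborel) \<partial>lborel)"
  proof (rule nn_integral_cong)
    fix x :: "real^'n"
    show "(\<integral>\<^sup>+s. ?k s * h (x + (s + c * x $ n) *\<^sub>R axis m 1) \<partial>lborel)
       = (\<integral>\<^sup>+s. ?k (s - c * x $ n) * h (x + s *\<^sub>R axis m 1) \<partial>lborel)"
      using nn_integral_lborel_translate[of "\<lambda>s. ?k (s - c * x $ n) * h (x + s *\<^sub>R axis m 1)" "c * x $ n"]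
      by (simp add: add.commute)
  qed
  also have "\<dots> = (\<integral>\<^sup>+s. (\<integral>\<^sup>+x. ?k (s - c * x $ n) * h (x + s *\<^sub>R axis m 1) \<partial>lborel) \<partial>lborel)"
    by (intro lborel_pair.Fubini'[symmetric]) measurable
  also have "\<dots> = (\<integral>\<^sup>+s. (\<integral>\<^sup>+x. ?k (s - c * x $ n) * h x \<partial>lborel) \<partial>lborel)"
  proof (rule nn_integral_cong)
    fix s :: real
    show "(\<integral>\<^sup>+x. ?k (s - c * x $ n) * h (x + s *\<^sub>R axis m 1) \<partial>lborel)
       = (\<integral>\<^sup>+x. ?k (s - c * x $ n) * h x \<partial>lborel)"
      using nn_integral_lborel_translate[of "\<lambda>x. ?k (s - c * x $ n) * h x" "s *\<^sub>R axis m 1"] mn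
      by (simp add: add.commute axis_def)
  qed
  also have "\<dots> = (\<integral>\<^sup>+x. (\<integral>\<^sup>+s. ?k (s - c * x $ n) * h x \<partial>lborel) \<partial>lborel)"
    by (intro lborel_pair.Fubini') measurable
  also have "\<dots> = (\<integral>\<^sup>+x. h x \<partial>lborel)"
    using k[of "- _"] by (simp add: nn_integral_multc)
  finally show ?thesis .
qed

lemma nn_integral_lborel_diagonal:
  fixes h :: "real^'n \<Rightarrow> ennreal" and D :: "'n \<Rightarrow> real"
  assumes D: "\<And>i. D i \<noteq> 0" and [measurable]: "h \<in> borel_measurable borel"
  shows "ennreal (\<Prod>i\<in>UNIV. \<bar>D i\<bar>) * (\<integral>\<^sup>+x. h (\<chi> i. D i * x $ i) \<partial>lborel) = (\<integral>\<^sup>+x. h x \<partial>lborel)"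
proof -
  define c where "c j = (\<Sum>i\<in>UNIV. D i * (j $ i))" for j :: "real^'n"
  have cax: "c (axis i 1) = D i" for i
    by (simp add: c_def axis_def if_distrib[of "\<lambda>x. _ * x"] cong: if_cong)
  have B: "Basis = range (\<lambda>i. axis i 1 :: real^'n)" by (auto simp: Basis_vec_def)
  have inj: "inj (\<lambda>i. axis i 1 :: real^'n)" by (auto simp: inj_on_def axis_eq_axis)
  have T: "(\<Sum>j\<in>Basis. (c j * (x \<bullet> j)) *\<^sub>R j) = (\<chi> i. D i * x $ i)" for x :: "real^'n"
    unfolding B sum.reindex[OF inj] comp_def cax inner_axis
    by (simp add: vec_eq_iff axis_def if_distrib[of "\<lambda>x. _ * x"] cong: if_cong)
  have P: "(\<Prod>j\<in>Basis. \<bar>c j\<bar>) = (\<Prod>i\<in>UNIV. \<bar>D i\<bar>)"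
    unfolding B prod.reindex[OF inj] comp_def cax ..
  have [measurable]: "(\<lambda>x::real^'n. \<chi> i. D i * x $ i) \<in> borel_measurable borel"
    by (intro borel_measurable_continuous_onI continuous_intros)
  have "c j \<noteq> 0" if "j \<in> Basis" for j
    using that D unfolding B by (auto simp: cax)
  from lborel_affine_euclidean[of c 0, OF this]
  have eq: "lborel = density (distr lborel borel (\<lambda>x::real^'n. \<chi> i. D i * x $ i)) (\<lambda>_. ennreal (\<Prod>i\<in>UNIV. \<bar>D i\<bar>))"
    unfolding P T by simp
  have "(\<integral>\<^sup>+x. h x \<partial>lborel) = (\<integral>\<^sup>+x. h x \<partial>(density (distr lborel borel (\<lambda>x::real^'n. \<chi> i. D i * x $ i)) (\<lambda>_. ennreal (\<Prod>i\<in>UNIV. \<bar>D i\<bar>))))"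
    using eq by simp
  also have "\<dots> = ennreal (\<Prod>i\<in>UNIV. \<bar>D i\<bar>) * (\<integral>\<^sup>+x. h (\<chi> i. D i * x $ i) \<partial>lborel)"
    by (simp add: nn_integral_density nn_integral_distr nn_integral_cmult)
  finally show ?thesis ..
qed

text \<open>An exchange of two coordinates is a product of three shears and a reflection.\<close>

lemma nn_integral_lborel_swap:
  fixes h :: "real^'n \<Rightarrow> ennreal"
  assumes mn: "m \<noteq> n" and [measurable]: "h \<in> borel_measurable borel"
  shows "(\<integral>\<^sup>+x. h (\<chi> i. x $ Transposition.transpose m n i) \<partial>lborel) = (\<integral>\<^sup>+x. h x \<partial>lborel)"
proof -
  define sh where "sh m n c x = x + (c * x $ n) *\<^sub>R axis m 1" for m n :: 'n and c and x :: "real^'n"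
  define D where "D i = (if i = n then -1 else 1 :: real)" for i
  define N where "N x = (\<chi> i. D i * x $ i)" for x :: "real^'n"
  have [measurable]: "sh m n c \<in> borel_measurable borel" for m n c
    unfolding sh_def by (intro borel_measurable_continuous_onI continuous_intros)
  have [measurable]: "N \<in> borel_measurable borel"
    unfolding N_def by (intro borel_measurable_continuous_onI continuous_intros)
  have sw: "(\<chi> i. x $ Transposition.transpose m n i) = N (sh m n 1 (sh n m (-1) (sh m n 1 x)))" for x
    using mn by (auto simp: vec_eq_iff N_def D_def sh_def Transposition.transpose_def axis_def)
  have "(\<Prod>i\<in>UNIV. \<bar>D i\<bar>) = 1" by (intro prod.neutral) (auto simp: D_def)
  then have N: "(\<integral>\<^sup>+x. h (N x) \<partial>lborel) = (\<integral>\<^sup>+x. h x \<partial>lborel)"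
    using nn_integral_lborel_diagonal[of D h] by (simp add: N_def D_def)
  have "(\<integral>\<^sup>+x. h (N (sh m n 1 (sh n m (-1) (sh m n 1 x)))) \<partial>lborel)
      = (\<integral>\<^sup>+x. h (N (sh m n 1 (sh n m (-1) x))) \<partial>lborel)"
    using nn_integral_lborel_shear[OF mn, of "\<lambda>x. h (N (sh m n 1 (sh n m (-1) x)))" 1] by (simp add: sh_def)
  also have "\<dots> = (\<integral>\<^sup>+x. h (N (sh m n 1 x)) \<partial>lborel)"
    using nn_integral_lborel_shear[OF mn[symmetric], of "\<lambda>x. h (N (sh m n 1 x))" "-1"] by (simp add: sh_def)
  also have "\<dots> = (\<integral>\<^sup>+x. h (N x) \<partial>lborel)"
    using nn_integral_lborel_shear[OF mn, of "\<lambda>x. h (N x)" 1] by (simp add: sh_def)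
  finally show ?thesis unfolding sw N .
qed

lemma borel_measurable_matrix_vector_mult [measurable]:
  "(\<lambda>x. A *v x) \<in> borel_measurable (borel :: (real^'n) measure)"
  by (intro borel_measurable_continuous_onI matrix_vector_mult_linear_continuous_on)

text \<open>The formula is multiplicative in the matrix, so it is enough to prove it for elementary matrices.\<close>

lemma nn_integral_lborel_matrix:
  fixes h :: "real^'n \<Rightarrow> ennreal" and A :: "real^'n^'n"
  assumes "det A \<noteq> 0" and "h \<in> borel_measurable borel"
  shows "ennreal \<bar>det A\<bar> * (\<integral>\<^sup>+x. h (A *v x) \<partial>lborel) = (\<integral>\<^sup>+x. h x \<partial>lborel)"
proof -
  have "\<forall>h::real^'n \<Rightarrow> ennreal. h \<in> borel_measurable borel \<longrightarrow> det A \<noteq> 0 \<longrightarrow>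
      ennreal \<bar>det A\<bar> * (\<integral>\<^sup>+x. h (A *v x) \<partial>lborel) = (\<integral>\<^sup>+x. h x \<partial>lborel)" (is "?P A")
  proof (rule induct_matrix_elementary[where P="?P"])
    fix A B assume P: "?P A" "?P B"
    show "?P (A ** B)"
    proof (intro allI impI)
      fix h :: "real^'n \<Rightarrow> ennreal" assume [measurable]: "h \<in> borel_measurable borel" and "det (A ** B) \<noteq> 0"
      then have d: "det A \<noteq> 0" "det B \<noteq> 0" by (auto simp: det_mul)
      have "ennreal \<bar>det (A ** B)\<bar> * (\<integral>\<^sup>+x. h (A ** B *v x) \<partial>lborel)
        = ennreal \<bar>det A\<bar> * (ennreal \<bar>det B\<bar> * (\<integral>\<^sup>+x. h (A *v (B *v x)) \<partial>lborel))"
        by (simp add: det_mul abs_mult ennreal_mult matrix_vector_mul_assoc mult.assoc)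
      also have "ennreal \<bar>det B\<bar> * (\<integral>\<^sup>+x. h (A *v (B *v x)) \<partial>lborel) = (\<integral>\<^sup>+x. h (A *v x) \<partial>lborel)"
        using P(2)[rule_format, of "\<lambda>x. h (A *v x)"] d by simp
      also have "ennreal \<bar>det A\<bar> * (\<integral>\<^sup>+x. h (A *v x) \<partial>lborel) = (\<integral>\<^sup>+x. h x \<partial>lborel)"
        using P(1) d by simp
      finally show "ennreal \<bar>det (A ** B)\<bar> * (\<integral>\<^sup>+x. h (A ** B *v x) \<partial>lborel) = (\<integral>\<^sup>+x. h x \<partial>lborel)" .
    qed
  next
    fix A :: "real^'n^'n" and i assume "row i A = 0"
    then show "?P A" by (simp add: det_zero_row(1))
  next
    fix A :: "real^'n^'n" assume A: "\<And>i j. i \<noteq> j \<Longrightarrow> A $ i $ j = 0"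
    have Ax: "A *v x = (\<chi> i. A $ i $ i * x $ i)" for x
    proof (subst vec_eq_iff, intro allI)
      fix i
      have "(A *v x) $ i = (\<Sum>j\<in>UNIV. A $ i $ j * x $ j)" by (simp add: matrix_vector_mult_def)
      also have "\<dots> = A $ i $ i * x $ i"
        using A by (intro sum_eq_single[where f="\<lambda>j. A $ i $ j * x $ j"]) auto
      finally show "(A *v x) $ i = (\<chi> i. A $ i $ i * x $ i) $ i" by simp
    qed
    show "?P A"
    proof (intro allI impI)
      fix h :: "real^'n \<Rightarrow> ennreal" assume h: "h \<in> borel_measurable borel" and "det A \<noteq> 0"
      then have "A $ i $ i \<noteq> 0" for i using det_diagonal[OF A] by auto
      then show "ennreal \<bar>det A\<bar> * (\<integral>\<^sup>+x. h (A *v x) \<partial>lborel) = (\<integral>\<^sup>+x. h x \<partial>lborel)"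
        using nn_integral_lborel_diagonal[of "\<lambda>i. A $ i $ i" h] h
        by (simp add: Ax det_diagonal[OF A] abs_prod)
    qed
  next
    fix m n :: 'n assume mn: "m \<noteq> n"
    let ?A = "\<chi> i j. mat 1 $ i $ Transposition.transpose m n j :: real^'n^'n"
    have "det ?A = of_int (sign (Transposition.transpose m n)) * det (mat 1 :: real^'n^'n)"
      by (rule det_permute_columns) (simp add: permutes_swap_id)
    then have d: "\<bar>det ?A\<bar> = 1" using mn by (simp add: sign_swap_id)
    have Ax: "?A *v x = (\<chi> i. x $ Transposition.transpose m n i)" for x
    proof (subst vec_eq_iff, intro allI)
      fix i
      have "(?A *v x) $ i = (\<Sum>j\<in>UNIV. ?A $ i $ j * x $ j)" by (simp add: matrix_vector_mult_def)
      also have "\<dots> = ?A $ i $ (Transposition.transpose m n i) * x $ (Transposition.transpose m n i)"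
        by (intro sum_eq_single[where f="\<lambda>j. ?A $ i $ j * x $ j"]) (auto simp: mat_def)
      finally show "(?A *v x) $ i = (\<chi> i. x $ Transposition.transpose m n i) $ i" by (simp add: mat_def)
    qed
    show "?P ?A"
      unfolding d Ax using nn_integral_lborel_swap[OF mn] by simp
  next
    fix m n :: 'n and c :: real assume mn: "m \<noteq> n"
    let ?A = "\<chi> i j. if i = m \<and> j = n then c else of_bool (i = j) :: real^'n^'n"
    have "?A = shear n (\<lambda>i. if i = m then c else 0)"
      using mn by (auto simp: vec_eq_iff shear_def)
    then have d: "det ?A = 1" by (simp only: det_shear)
    have Ax: "?A *v x = x + (c * x $ n) *\<^sub>R axis m 1" for x
    proof (subst vec_eq_iff, intro allI)
      fix i
      have "(?A *v x) $ i = (\<Sum>j\<in>UNIV. (if j = i then x $ i else 0) + (if j = n then if i = m then c * x $ n else 0 else 0))"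
        unfolding matrix_vector_mult_def vec_lambda_beta using mn by (intro sum.cong) auto
      also have "\<dots> = x $ i + (if i = m then c * x $ n else 0)"
        by (simp add: sum.distrib)
      finally show "(?A *v x) $ i = (x + (c * x $ n) *\<^sub>R axis m 1) $ i" by (simp add: axis_def)
    qed
    show "?P ?A"
      unfolding d Ax using nn_integral_lborel_shear[OF mn] by simp
  qed
  then show ?thesis using assms by blast
qed

section \<open>Testing an estimate on sets\<close>

lemma emeasure_matrix_box:
  fixes M :: "real^'n^'n"
  assumes "det M = 1" and b: "\<And>i. 0 \<le> b i"
  shows "{x. \<forall>i. \<bar>(M *v x) $ i\<bar> \<le> b i} \<in> sets borel"
    and "emeasure lborel {x. \<forall>i. \<bar>(M *v x) $ i\<bar> \<le> b i} = ennreal (\<Prod>i\<in>UNIV. 2 * b i)"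
proof -
  let ?c = "cbox (\<chi> i. - b i) (\<chi> i. b i)"
  have eq: "{x. \<forall>i. \<bar>(M *v x) $ i\<bar> \<le> b i} = (\<lambda>x. M *v x) -` ?c"
    by (auto simp: mem_box_cart abs_le_iff) (metis minus_le_iff)+
  show meas: "{x. \<forall>i. \<bar>(M *v x) $ i\<bar> \<le> b i} \<in> sets borel"
    unfolding eq using measurable_sets[OF borel_measurable_matrix_vector_mult, of ?c M] by simp
  have "emeasure lborel {x. \<forall>i. \<bar>(M *v x) $ i\<bar> \<le> b i}
      = (\<integral>\<^sup>+x. indicator {x. \<forall>i. \<bar>(M *v x) $ i\<bar> \<le> b i} x \<partial>lborel)"
    using meas by simp
  also have "\<dots> = (\<integral>\<^sup>+x. indicator ?c (M *v x) \<partial>lborel)"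
    unfolding eq by (intro nn_integral_cong) (auto simp: indicator_def)
  also have "\<dots> = (\<integral>\<^sup>+x. indicator ?c x \<partial>lborel)"
    using nn_integral_lborel_matrix[of M "indicator ?c"] assms(1) by simp
  also have "\<dots> = emeasure lborel ?c" by simp
  also have "\<dots> = ennreal (measure lborel ?c)"
    by (rule emeasure_eq_ennreal_measure) (use emeasure_lborel_cbox_finite in \<open>auto simp: less_top\<close>)
  also have "measure lborel ?c = (\<Prod>i\<in>UNIV. 2 * b i)"
    using b by (subst content_cbox_cart) (auto simp: interval_ne_empty_cart le_minus_iff intro!: prod.cong order_trans[OF _ b])
  finally show "emeasure lborel {x. \<forall>i. \<bar>(M *v x) $ i\<bar> \<le> b i} = ennreal (\<Prod>i\<in>UNIV. 2 * b i)" .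
qed

lemma emeasure_lborel_Times:
  assumes "A \<in> sets borel" "B \<in> sets borel"
  shows "A \<times> B \<in> sets borel" "emeasure lborel (A \<times> B) = emeasure lborel A * emeasure lborel B"
proof -
  show "A \<times> B \<in> sets borel"
    unfolding borel_prod[symmetric] using assms by auto
  show "emeasure lborel (A \<times> B) = emeasure lborel A * emeasure lborel B"
    unfolding lborel_prod[symmetric] using assms by (intro lborel.emeasure_pair_measure_Times) auto
qed

lemma plane_transform_indicator:
  assumes P: "P \<in> sets borel" "P \<subseteq> {-1..1} \<times> {-1..1}" "emeasure lborel P = ennreal a" "a \<ge> 0"
    and E: "\<And>s t. s \<in> {-1..1} \<Longrightarrow> t \<in> {-1..1} \<Longrightarrow>
       (x - s *\<^sub>R grad Q1 \<xi> - t *\<^sub>R grad Q2 \<xi>, s, t) \<in> E \<longleftrightarrow> (s, t) \<in> P"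
  shows "plane_transform Q1 Q2 (indicator E) (x, \<xi>) = complex_of_real a"
proof -
  have "plane_transform Q1 Q2 (indicator E) (x, \<xi>) = (LINT z|lebesgue. indicator P z *\<^sub>R (1::complex))"
    unfolding plane_transform_def set_lebesgue_integral_def prod.case
  proof (rule Bochner_Integration.integral_cong[OF refl])
    fix z :: "real \<times> real"
    show "indicator ({-1..1} \<times> {-1..1}) z *\<^sub>R
         (case z of (s, t) \<Rightarrow> indicator E (x - s *\<^sub>R grad Q1 \<xi> - t *\<^sub>R grad Q2 \<xi>, s, t)) = indicator P z *\<^sub>R (1::complex)"
      using E[of "fst z" "snd z"] P(2) by (cases z) (auto simp: indicator_def)
  qed
  also have "\<dots> = (LINT z|lebesgue. indicator P z) *\<^sub>R (1::complex)"
    using P by (intro integral_scaleR_left) (auto simp: fmeasurable_def)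
  also have "(LINT z|lebesgue. indicator P z) = measure lebesgue P"
    by simp
  also have "measure lebesgue P = a"
    using P by (simp add: measure_def)
  finally show ?thesis by (simp add: scaleR_conv_of_real)
qed

lemma plane_transform_estimate_on_sets:
  fixes Q1 Q2 :: "real^'n \<Rightarrow> real"
  assumes est: "plane_transform_estimate Q1 Q2 C (ennreal p) (ennreal q) K" and pq: "0 < p" "0 < q" and K: "K \<ge> 0"
    and E: "E \<in> sets borel" "E \<subseteq> ball 0 C \<times> {-1..1} \<times> {-1..1}" "emeasure lborel E = ennreal e" "0 \<le> e"
    and F: "F \<in> sets borel" "F \<subseteq> UNIV \<times> unit_cube" "emeasure lborel F = ennreal \<phi>" "0 \<le> \<phi>"
    and a: "0 \<le> a" "\<And>z. z \<in> F \<Longrightarrow> plane_transform Q1 Q2 (indicator E) z = complex_of_real a"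
  shows "a * \<phi> powr (1 / q) \<le> K * e powr (1 / p)"
proof -
  let ?f = "indicator E :: (real^'n) \<times> real \<times> real \<Rightarrow> complex"
  let ?T = "plane_transform Q1 Q2 ?f" and ?L = "lebesgue_on (UNIV \<times> unit_cube) :: ((real^'n) \<times> (real^'n)) measure"
  have Ip: "(\<integral>\<^sup>+x. ennreal (norm (?f x) powr p) \<partial>lebesgue) = ennreal e"
  proof -
    have "(\<integral>\<^sup>+x. ennreal (norm (?f x) powr p) \<partial>lebesgue) = (\<integral>\<^sup>+x. indicator E x \<partial>lebesgue)"
      using pq by (intro nn_integral_cong) (auto simp: indicator_def)
    also have "\<dots> = emeasure lborel E" using E by simp
    finally show ?thesis using E by simp
  qed
  have Lp: "Lp_norm (ennreal p) lebesgue ?f = ennreal (e powr (1 / p))"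
    unfolding Lp_norm_def using Ip pq E by (simp add: Let_def)
  have cube: "(UNIV \<times> unit_cube :: ((real^'n) \<times> (real^'n)) set) \<in> sets lebesgue"
  proof -
    have "closed (UNIV \<times> cbox (-1) 1 :: ((real^'n) \<times> (real^'n)) set)"
      by (intro closed_Times) auto
    moreover have "(unit_cube :: (real^'n) set) = cbox (-1) 1"
      by (auto simp: unit_cube_def mem_box_cart)
    ultimately show ?thesis by (simp add: lebesgue_closedin)
  qed
  have "ennreal (a powr q * \<phi>) \<le> (\<integral>\<^sup>+x. ennreal (norm (?T x) powr q) \<partial>?L)"
  proof -
    have "ennreal (a powr q * \<phi>) = ennreal (a powr q) * emeasure ?L F"
      using F cube by (simp add: emeasure_restrict_space ennreal_mult)
    also have "\<dots> = (\<integral>\<^sup>+x. ennreal (a powr q) * indicator F x \<partial>?L)"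
      using F cube by (subst nn_integral_cmult_indicator) (auto simp: sets_restrict_space_iff)
    also have "\<dots> \<le> (\<integral>\<^sup>+x. ennreal (norm (?T x) powr q) \<partial>?L)"
      using a by (intro nn_integral_mono) (auto simp: indicator_def)
    finally show ?thesis .
  qed
  then have "ennreal (a * \<phi> powr (1 / q)) \<le> Lp_norm (ennreal q) ?L ?T"
  proof (cases "(\<integral>\<^sup>+x. ennreal (norm (?T x) powr q) \<partial>?L) = \<infinity>")
    case True
    then show ?thesis unfolding Lp_norm_def using pq by (simp add: Let_def)
  next
    case False
    then obtain r where r: "0 \<le> r" "(\<integral>\<^sup>+x. ennreal (norm (?T x) powr q) \<partial>?L) = ennreal r"
      by (cases "(\<integral>\<^sup>+x. ennreal (norm (?T x) powr q) \<partial>?L)") auto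
    assume "ennreal (a powr q * \<phi>) \<le> (\<integral>\<^sup>+x. ennreal (norm (?T x) powr q) \<partial>?L)"
    then have "a powr q * \<phi> \<le> r" using r by (simp add: ennreal_le_iff)
    then have "(a powr q * \<phi>) powr (1 / q) \<le> r powr (1 / q)"
      using F a pq by (intro powr_mono2) auto
    moreover have "(a powr q * \<phi>) powr (1 / q) = a * \<phi> powr (1 / q)"
      using F a pq by (simp add: powr_mult powr_powr)
    ultimately show ?thesis unfolding Lp_norm_def using pq r by (simp add: Let_def ennreal_leI)
  qed
  also have "\<dots> \<le> ennreal K * Lp_norm (ennreal p) lebesgue ?f"
  proof -
    have "E \<in> sets lebesgue" using E by simp
    then have "?f \<in> borel_measurable lebesgue" by (rule borel_measurable_indicator)
    moreover have "Lp_norm (ennreal p) lebesgue ?f < \<infinity>" by (simp add: Lp)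
    moreover have "\<forall>z. z \<notin> ball 0 C \<times> {-1..1} \<times> {-1..1} \<longrightarrow> ?f z = 0"
      using E(2) by (auto simp: indicator_def)
    ultimately show ?thesis using est unfolding plane_transform_estimate_def by blast
  qed
  also have "\<dots> = ennreal (K * e powr (1 / p))" using K by (simp add: Lp ennreal_mult)
  finally show ?thesis using K by (simp add: ennreal_le_iff)
qed

lemma powr_scaling_contradiction:
  fixes a b :: real
  assumes "a < b" "0 < c1" and le: "\<And>\<epsilon>. 0 < \<epsilon> \<Longrightarrow> \<epsilon> < 1 \<Longrightarrow> c1 * \<epsilon> powr a \<le> c2 * \<epsilon> powr b"
  shows False
proof -
  have "((\<lambda>\<epsilon>. c2 * \<epsilon> powr (b - a)) \<longlongrightarrow> c2 * 0 powr (b - a)) (at_right 0)"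
    using assms(1) eventually_mono[OF eventually_at_right_less[of "0::real"], of "\<lambda>x. 0 \<le> x"]
    by (intro tendsto_intros tendsto_powr') auto
  moreover have "\<forall>\<^sub>F \<epsilon> in at_right 0. c1 \<le> c2 * \<epsilon> powr (b - a)"
  proof (rule eventually_at_rightI[of 0 1])
    fix \<epsilon> :: real assume "\<epsilon> \<in> {0<..<1}"
    then have \<epsilon>: "0 < \<epsilon>" "\<epsilon> < 1" by auto
    have "c1 * \<epsilon> powr a \<le> (c2 * \<epsilon> powr (b - a)) * \<epsilon> powr a"
      using le[OF \<epsilon>] by (simp add: mult.assoc powr_add[symmetric])
    then show "c1 \<le> c2 * \<epsilon> powr (b - a)"
      by (rule mult_right_le_imp_le) (use \<epsilon> in simp)
  qed simp
  ultimately have "c1 \<le> c2 * 0 powr (b - a)"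
    using tendsto_lowerbound by (metis trivial_limit_at_right_real)
  then show False using assms(1,2) by simp
qed

section \<open>Failure of the estimates for unstable pairs\<close>

lemma norm_le_matrix_norm:
  fixes M :: "real^'n^'n"
  assumes "det M \<noteq> 0"
  obtains \<beta> where "\<beta> > 0" "\<And>z c. 0 \<le> c \<Longrightarrow> (\<And>i. \<bar>(M *v z) $ i\<bar> \<le> c) \<Longrightarrow> norm z \<le> \<beta> * c"
proof -
  obtain N where N: "N ** M = mat 1"
    using assms invertible_det_nz unfolding invertible_def by blast
  obtain K where K: "K > 0" "\<And>z. norm (N *v z) \<le> norm z * K"
    using bounded_linear.pos_bounded[OF matrix_vector_mul_bounded_linear[of N]] by blast
  have "norm z \<le> (K * CARD('n)) * c" if c: "0 \<le> c" "\<And>i. \<bar>(M *v z) $ i\<bar> \<le> c" for z c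
  proof -
    have "z = N *v (M *v z)" by (simp add: matrix_vector_mul_assoc N)
    then have "norm z \<le> norm (M *v z) * K" using K(2) by metis
    also have "norm (M *v z) \<le> (\<Sum>i\<in>UNIV. \<bar>(M *v z) $ i\<bar>)" by (rule norm_le_l1_cart)
    also have "\<dots> \<le> (\<Sum>i\<in>(UNIV::'n set). c)" by (intro sum_mono c)
    finally show ?thesis using K(1) by (simp add: mult_ac)
  qed
  moreover have "K * CARD('n) > 0" using K(1) by simp
  ultimately show thesis using that by blast
qed

text \<open>This is what the weights are made for: in the coordinates given by \<open>M\<close>, every matrix \<open>u A + v B\<close> with
  \<open>\<bar>u\<bar>\<close> at most a small multiple of \<open>\<epsilon>\<close> and \<open>\<bar>v\<bar>\<close> at most a small constant maps the box with sides \<open>\<epsilon>^(- w j)\<close> into the one with sides \<open>\<epsilon>^(w i)\<close>.\<close>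

lemma pencil_row_bound:
  fixes A B M :: "real^'n^'n" and w :: "'n \<Rightarrow> real"
  assumes A: "\<And>i j. congr_by M A $ i $ j \<noteq> 0 \<Longrightarrow> w i + w j \<le> 1"
    and B: "\<And>i j. congr_by M B $ i $ j \<noteq> 0 \<Longrightarrow> w i + w j \<le> 0"
    and \<epsilon>: "0 < \<epsilon>" "\<epsilon> < 1" and \<rho>: "0 \<le> \<rho>" and \<delta>: "0 \<le> \<delta>"
      "\<delta> * (\<Sum>i\<in>UNIV. \<Sum>j\<in>UNIV. \<bar>congr_by M A $ i $ j\<bar> + \<bar>congr_by M B $ i $ j\<bar>) \<le> 1"
    and \<zeta>: "\<And>j. \<bar>\<zeta> $ j\<bar> \<le> \<rho> * \<epsilon> powr (- w j)" and uv: "\<bar>u\<bar> \<le> \<delta> * \<epsilon>" "\<bar>v\<bar> \<le> \<delta>"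
  shows "\<bar>(M *v ((u *\<^sub>R A + v *\<^sub>R B) *v (transpose M *v \<zeta>))) $ i\<bar> \<le> \<rho> * \<epsilon> powr w i"
proof -
  let ?A = "congr_by M A" and ?B = "congr_by M B"
  have "M *v ((u *\<^sub>R A + v *\<^sub>R B) *v (transpose M *v \<zeta>)) = congr_by M (u *\<^sub>R A + v *\<^sub>R B) *v \<zeta>"
    by (simp only: congr_by_def matrix_vector_mul_assoc matrix_mul_assoc)
  also have "congr_by M (u *\<^sub>R A + v *\<^sub>R B) = v *\<^sub>R ?B + u *\<^sub>R ?A"
    by (simp add: vec_eq_iff congr_by_nth matrix_vector_mult_add_rdistrib inner_right_distrib
        scaleR_matrix_vector_assoc[symmetric])
  finally have "(M *v ((u *\<^sub>R A + v *\<^sub>R B) *v (transpose M *v \<zeta>))) $ i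
     = (\<Sum>j\<in>UNIV. (v * ?B $ i $ j + u * ?A $ i $ j) * \<zeta> $ j)"
    by (simp add: matrix_vector_mult_def)
  also have "\<bar>\<dots>\<bar> \<le> (\<Sum>j\<in>UNIV. \<bar>(v * ?B $ i $ j + u * ?A $ i $ j) * \<zeta> $ j\<bar>)"
    by (rule sum_abs)
  also have "\<dots> \<le> (\<Sum>j\<in>UNIV. (\<delta> * \<rho> * \<epsilon> powr w i) * (\<bar>?A $ i $ j\<bar> + \<bar>?B $ i $ j\<bar>))"
  proof (rule sum_mono)
    fix j
    have a: "\<bar>u * ?A $ i $ j * \<zeta> $ j\<bar> \<le> (\<delta> * \<rho> * \<epsilon> powr w i) * \<bar>?A $ i $ j\<bar>"
    proof (cases "?A $ i $ j = 0")
      case False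
      have "\<bar>u\<bar> * \<bar>\<zeta> $ j\<bar> \<le> (\<delta> * \<epsilon>) * (\<rho> * \<epsilon> powr (- w j))"
        using uv \<zeta> \<delta> \<epsilon> by (intro mult_mono) auto
      also have "\<dots> = \<delta> * \<rho> * \<epsilon> powr (1 - w j)"
        using \<epsilon> by (simp add: powr_diff powr_minus field_simps)
      also have "\<dots> \<le> \<delta> * \<rho> * \<epsilon> powr w i"
        using A[OF False] \<epsilon> \<delta> \<rho> by (intro mult_left_mono powr_mono') auto
      finally have "\<bar>?A $ i $ j\<bar> * (\<bar>u\<bar> * \<bar>\<zeta> $ j\<bar>) \<le> \<bar>?A $ i $ j\<bar> * (\<delta> * \<rho> * \<epsilon> powr w i)"
        by (rule mult_left_mono) simp
      then show ?thesis by (simp add: abs_mult mult_ac)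
    qed simp
    have b: "\<bar>v * ?B $ i $ j * \<zeta> $ j\<bar> \<le> (\<delta> * \<rho> * \<epsilon> powr w i) * \<bar>?B $ i $ j\<bar>"
    proof (cases "?B $ i $ j = 0")
      case False
      have "\<bar>v\<bar> * \<bar>\<zeta> $ j\<bar> \<le> \<delta> * (\<rho> * \<epsilon> powr (- w j))"
        using uv \<zeta> \<delta> \<epsilon> by (intro mult_mono) auto
      also have "\<dots> \<le> \<delta> * (\<rho> * \<epsilon> powr w i)"
        using B[OF False] \<epsilon> \<delta> \<rho> by (intro mult_left_mono powr_mono') auto
      finally have "\<bar>?B $ i $ j\<bar> * (\<bar>v\<bar> * \<bar>\<zeta> $ j\<bar>) \<le> \<bar>?B $ i $ j\<bar> * (\<delta> * (\<rho> * \<epsilon> powr w i))"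
        by (rule mult_left_mono) simp
      then show ?thesis by (simp add: abs_mult mult_ac)
    qed simp
    have "\<bar>(v * ?B $ i $ j + u * ?A $ i $ j) * \<zeta> $ j\<bar> \<le> \<bar>v * ?B $ i $ j * \<zeta> $ j\<bar> + \<bar>u * ?A $ i $ j * \<zeta> $ j\<bar>"
      unfolding distrib_right by (rule abs_triangle_ineq)
    then show "\<bar>(v * ?B $ i $ j + u * ?A $ i $ j) * \<zeta> $ j\<bar> \<le> (\<delta> * \<rho> * \<epsilon> powr w i) * (\<bar>?A $ i $ j\<bar> + \<bar>?B $ i $ j\<bar>)"
      using a b by (simp add: distrib_left)
  qed
  also have "\<dots> = (\<rho> * \<epsilon> powr w i) * (\<delta> * (\<Sum>j\<in>UNIV. \<bar>?A $ i $ j\<bar> + \<bar>?B $ i $ j\<bar>))"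
    by (simp add: sum_distrib_left mult_ac)
  also have "\<dots> \<le> (\<rho> * \<epsilon> powr w i) * 1"
  proof (rule mult_left_mono)
    have "(\<Sum>j\<in>UNIV. \<bar>?A $ i $ j\<bar> + \<bar>?B $ i $ j\<bar>) \<le> (\<Sum>i\<in>UNIV. \<Sum>j\<in>UNIV. \<bar>?A $ i $ j\<bar> + \<bar>?B $ i $ j\<bar>)"
      by (rule member_le_sum) (auto intro: sum_nonneg)
    then show "\<delta> * (\<Sum>j\<in>UNIV. \<bar>?A $ i $ j\<bar> + \<bar>?B $ i $ j\<bar>) \<le> 1"
      using \<delta> mult_left_mono order_trans by blast
  qed (use \<rho> in auto)
  finally show ?thesis by simp
qed

text \<open>The Knapp example. Let \<open>E\<close> be the product of a box in \<open>x\<close> with sides \<open>\<epsilon>^(w i)\<close> and the parameter set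
  \<open>P\<close>, and let \<open>F\<close> consist of the planes with \<open>x\<close> in half that box and \<open>\<xi>\<close> in the dual box with sides
  \<open>\<epsilon>^(- w i)\<close>. Planes in \<open>F\<close> stay in \<open>E\<close> as long as their parameter is in \<open>P\<close>, so the transform equals the measure of
  \<open>P\<close>, which is comparable to \<open>\<epsilon>\<close>. All boxes are shrunk by \<open>\<epsilon>^R\<close> with \<open>R\<close> the sum of the absolute values of the
  weights, since otherwise negative powers of \<open>\<epsilon>\<close> would leave the ball and the cube; this enters both sides of
  the exponent condition.
  
  The pair \<open>A1, B1\<close> for which the weights are given is another basis of the pencil of \<open>A, B\<close>; \<open>P\<close> is the set of
  parameters that are small with respect to it.\<close>

lemma weights_imp_no_estimate:
  fixes A B A1 B1 M :: "real^'n^'n" and w :: "'n \<Rightarrow> real" and P :: "real \<Rightarrow> real \<Rightarrow> (real \<times> real) set"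
  assumes grad: "\<And>\<xi>. grad Q1 \<xi> = A *v \<xi>" "\<And>\<xi>. grad Q2 \<xi> = B *v \<xi>"
    and C: "C > 0" and M: "det M = 1"
    and wA: "\<And>i j. congr_by M A1 $ i $ j \<noteq> 0 \<Longrightarrow> w i + w j \<le> 1"
    and wB: "\<And>i j. congr_by M B1 $ i $ j \<noteq> 0 \<Longrightarrow> w i + w j \<le> 0"
    and \<delta>0: "\<delta>0 > 0"
    and P: "\<And>\<delta> \<epsilon>. 0 < \<delta> \<Longrightarrow> \<delta> \<le> \<delta>0 \<Longrightarrow> 0 < \<epsilon> \<Longrightarrow> \<epsilon> < 1 \<Longrightarrow>
       P \<delta> \<epsilon> \<in> sets borel \<and> P \<delta> \<epsilon> \<subseteq> {-1..1} \<times> {-1..1} \<and> emeasure lborel (P \<delta> \<epsilon>) = ennreal (4 * \<delta>\<^sup>2 * \<epsilon>)"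
    and Puv: "\<And>\<delta> \<epsilon> s t. (s, t) \<in> P \<delta> \<epsilon> \<Longrightarrow>
       \<exists>u v. \<bar>u\<bar> \<le> \<delta> * \<epsilon> \<and> \<bar>v\<bar> \<le> \<delta> \<and> s *\<^sub>R A + t *\<^sub>R B = u *\<^sub>R A1 + v *\<^sub>R B1"
    and pq: "0 < p" "0 < q"
    and exponents: "1 + 2 * real CARD('n) * (\<Sum>i\<in>UNIV. \<bar>w i\<bar>) / q
       < (real CARD('n) * (\<Sum>i\<in>UNIV. \<bar>w i\<bar>) + sum w UNIV + 1) / p"
    and K: "K \<ge> 0"
  shows "\<not> plane_transform_estimate Q1 Q2 C (ennreal p) (ennreal q) K"
proof
  assume est: "plane_transform_estimate Q1 Q2 C (ennreal p) (ennreal q) K"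
  let ?d = "real CARD('n)" and ?W = "sum w UNIV"
  define R where "R = (\<Sum>i\<in>UNIV. \<bar>w i\<bar>)"
  have R: "\<bar>w i\<bar> \<le> R" for i unfolding R_def by (rule member_le_sum) auto
  define S where "S = (\<Sum>i\<in>UNIV. \<Sum>j\<in>UNIV. \<bar>congr_by M A1 $ i $ j\<bar> + \<bar>congr_by M B1 $ i $ j\<bar>)"
  have S: "S \<ge> 0" unfolding S_def by (intro sum_nonneg) auto
  (* Small enough for the parameters in P \<delta> \<epsilon> to displace planes by no more than
     the size of the box. *)
  define \<delta> where "\<delta> = min \<delta>0 (1 / (1 + S))"
  have \<delta>: "0 < \<delta>" "\<delta> \<le> \<delta>0" using \<delta>0 S by (auto simp: \<delta>_def)
  have "\<delta> * S \<le> 1 / (1 + S) * S" using S by (intro mult_right_mono) (auto simp: \<delta>_def)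
  also have "\<dots> \<le> 1" using S by (simp add: field_simps)
  finally have \<delta>S: "\<delta> * S \<le> 1" .
  obtain N where N: "N ** transpose M = mat 1" "transpose M ** N = mat 1"
    using M invertible_det_nz[of "transpose M"] unfolding invertible_def by auto
  have "det (N ** transpose M) = 1" using N by simp
  then have detN: "det N = 1" using M by (simp add: det_mul)
  obtain \<beta>1 where \<beta>1: "\<beta>1 > 0" "\<And>z c. 0 \<le> c \<Longrightarrow> (\<And>i. \<bar>(M *v z) $ i\<bar> \<le> c) \<Longrightarrow> norm z \<le> \<beta>1 * c"
    using norm_le_matrix_norm[of M] M by auto
  obtain \<beta>2 where \<beta>2: "\<beta>2 > 0" "\<And>z c. 0 \<le> c \<Longrightarrow> (\<And>i. \<bar>(N *v z) $ i\<bar> \<le> c) \<Longrightarrow> norm z \<le> \<beta>2 * c"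
    using norm_le_matrix_norm[of N] detN by auto
  (* Small enough for the boxes to fit into the ball and into the cube. *)
  define \<kappa> where "\<kappa> = min (C / (4 * \<beta>1)) (1 / \<beta>2)"
  have \<kappa>: "\<kappa> > 0" "\<beta>1 * (2 * \<kappa>) < C" "\<beta>2 * \<kappa> \<le> 1"
  proof -
    show "\<kappa> > 0" using C \<beta>1 \<beta>2 by (simp add: \<kappa>_def)
    have "\<kappa> \<le> C / (4 * \<beta>1)" "\<kappa> \<le> 1 / \<beta>2" by (simp_all add: \<kappa>_def)
    then have "\<beta>1 * (2 * \<kappa>) \<le> C / 2" and "\<beta>2 * \<kappa> \<le> 1" using \<beta>1 \<beta>2 by (simp_all add: field_simps)
    then show "\<beta>1 * (2 * \<kappa>) < C" "\<beta>2 * \<kappa> \<le> 1" using C by auto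
  qed
  have main: "(4 * \<delta>\<^sup>2 * (2 * \<kappa>) powr (2 * ?d / q)) * \<epsilon> powr (1 + 2 * ?d * R / q)
      \<le> (K * ((4 * \<kappa>) ^ CARD('n) * (4 * \<delta>\<^sup>2)) powr (1 / p)) * \<epsilon> powr ((?d * R + ?W + 1) / p)"
    if \<epsilon>: "0 < \<epsilon>" "\<epsilon> < 1" for \<epsilon>
  proof -
    (* The common shrinking factor keeps all sides of all boxes bounded by \<kappa>. *)
    define \<rho> where "\<rho> = \<kappa> * \<epsilon> powr R"
    have \<rho>: "\<rho> > 0" using \<kappa> \<epsilon> by (simp add: \<rho>_def)
    have \<rho>w: "\<rho> * \<epsilon> powr w i \<le> \<kappa>" "\<rho> * \<epsilon> powr (- w i) \<le> \<kappa>" for i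
    proof -
      have "\<epsilon> powr (R + w i) \<le> 1" "\<epsilon> powr (R + - w i) \<le> 1"
        using R[of i] \<epsilon> by (auto intro!: powr_le1 simp: abs_le_iff)
      then have "\<kappa> * \<epsilon> powr (R + w i) \<le> \<kappa>" "\<kappa> * \<epsilon> powr (R + - w i) \<le> \<kappa>" using \<kappa> by simp_all
      then show "\<rho> * \<epsilon> powr w i \<le> \<kappa>" "\<rho> * \<epsilon> powr (- w i) \<le> \<kappa>"
        by (simp_all only: \<rho>_def powr_add mult.assoc)
    qed
    let ?X = "{x. \<forall>i. \<bar>(M *v x) $ i\<bar> \<le> \<rho> * \<epsilon> powr w i}"
    let ?Y = "{x. \<forall>i. \<bar>(M *v x) $ i\<bar> \<le> 2 * \<rho> * \<epsilon> powr w i}"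
    let ?Z = "{x. \<forall>i. \<bar>(N *v x) $ i\<bar> \<le> \<rho> * \<epsilon> powr (- w i)}"
    let ?P = "P \<delta> \<epsilon>"
    have P': "?P \<in> sets borel" "?P \<subseteq> {-1..1} \<times> {-1..1}" "emeasure lborel ?P = ennreal (4 * \<delta>\<^sup>2 * \<epsilon>)"
      using P[OF \<delta> \<epsilon>] by blast+
    have nn: "0 \<le> \<rho> * \<epsilon> powr w i" "0 \<le> 2 * \<rho> * \<epsilon> powr w i" "0 \<le> \<rho> * \<epsilon> powr - w i" for i
      using \<rho> by auto
    have X: "?X \<in> sets borel" "emeasure lborel ?X = ennreal (\<Prod>i\<in>UNIV. 2 * (\<rho> * \<epsilon> powr w i))"
      by (rule emeasure_matrix_box[OF M nn(1)])+
    have Y: "?Y \<in> sets borel" "emeasure lborel ?Y = ennreal (\<Prod>i\<in>UNIV. 2 * (2 * \<rho> * \<epsilon> powr w i))"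
      by (rule emeasure_matrix_box[OF M nn(2)])+
    have Z: "?Z \<in> sets borel" "emeasure lborel ?Z = ennreal (\<Prod>i\<in>UNIV. 2 * (\<rho> * \<epsilon> powr - w i))"
      by (rule emeasure_matrix_box[OF detN nn(3)])+
    have prodw: "(\<Prod>i\<in>UNIV. c * \<epsilon> powr v i) = c ^ CARD('n) * \<epsilon> powr (sum v UNIV)" for c and v :: "'n \<Rightarrow> real"
      using \<epsilon> by (simp add: prod.distrib powr_sum)
    have EY: "emeasure lborel (?Y \<times> ?P) = ennreal ((4 * \<rho>) ^ CARD('n) * \<epsilon> powr ?W * (4 * \<delta>\<^sup>2 * \<epsilon>))"
    proof -
      have "emeasure lborel (?Y \<times> ?P) = emeasure lborel ?Y * emeasure lborel ?P"
        by (rule emeasure_lborel_Times(2)[OF Y(1) P'(1)])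
      also have "\<dots> = ennreal ((\<Prod>i\<in>UNIV. 2 * (2 * \<rho> * \<epsilon> powr w i)) * (4 * \<delta>\<^sup>2 * \<epsilon>))"
        unfolding Y(2) P'(3) using \<rho> \<epsilon> by (intro ennreal_mult[symmetric] prod_nonneg) auto
      also have "(\<Prod>i\<in>UNIV. 2 * (2 * \<rho> * \<epsilon> powr w i)) = (\<Prod>i\<in>UNIV. (4 * \<rho>) * \<epsilon> powr w i)"
        by (intro prod.cong) auto
      finally show ?thesis unfolding prodw .
    qed
    have EF: "emeasure lborel (?X \<times> ?Z) = ennreal ((2 * \<rho>) ^ (2 * CARD('n)))"
    proof -
      have "emeasure lborel (?X \<times> ?Z) = emeasure lborel ?X * emeasure lborel ?Z"
        by (rule emeasure_lborel_Times(2)[OF X(1) Z(1)])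
      also have "\<dots> = ennreal ((\<Prod>i\<in>UNIV. (2 * \<rho>) * \<epsilon> powr w i) * (\<Prod>i\<in>UNIV. (2 * \<rho>) * \<epsilon> powr - w i))"
        unfolding X(2) Z(2) mult.assoc using \<rho> by (intro ennreal_mult[symmetric] prod_nonneg) auto
      also have "(\<Prod>i\<in>UNIV. (2 * \<rho>) * \<epsilon> powr w i) * (\<Prod>i\<in>UNIV. (2 * \<rho>) * \<epsilon> powr - w i) = (2 * \<rho>) ^ (2 * CARD('n))"
      proof -
        have cancel: "a * x * (a * y) = a * a" if "x * y = 1" for a x y :: real
        proof -
          have "a * x * (a * y) = a * a * (x * y)" by algebra
          then show ?thesis using that by simp
        qed
        have "\<epsilon> powr ?W * \<epsilon> powr (\<Sum>i\<in>UNIV. - w i) = 1"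
          unfolding powr_add[symmetric] using \<epsilon> by (simp add: sum_negf)
        then show ?thesis unfolding prodw mult_2[of "CARD('n)"] power_add by (rule cancel)
      qed
      finally show ?thesis .
    qed
    have "(4 * \<delta>\<^sup>2 * \<epsilon>) * ((2 * \<rho>) ^ (2 * CARD('n))) powr (1 / q)
       \<le> K * ((4 * \<rho>) ^ CARD('n) * \<epsilon> powr ?W * (4 * \<delta>\<^sup>2 * \<epsilon>)) powr (1 / p)"
    proof (rule plane_transform_estimate_on_sets[OF est pq K, of "?Y \<times> ?P" _ "?X \<times> ?Z"])
      show "?Y \<times> ?P \<in> sets borel"
        by (rule emeasure_lborel_Times(1)[OF Y(1) P'(1)])
      show "?X \<times> ?Z \<in> sets borel"
        by (rule emeasure_lborel_Times(1)[OF X(1) Z(1)])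
      have "norm y < C" if "y \<in> ?Y" for y
      proof -
        have "\<bar>(M *v y) $ i\<bar> \<le> 2 * \<kappa>" for i
        proof -
          have "\<bar>(M *v y) $ i\<bar> \<le> 2 * \<rho> * \<epsilon> powr w i" using that by blast
          then show ?thesis using \<rho>w(1)[of i] by linarith
        qed
        then have "norm y \<le> \<beta>1 * (2 * \<kappa>)" using \<beta>1(2)[of "2 * \<kappa>" y] \<kappa> by simp
        then show ?thesis using \<kappa> by linarith
      qed
      then show "?Y \<times> ?P \<subseteq> ball 0 C \<times> {-1..1} \<times> {-1..1}" using P'(2) by (auto simp: dist_norm)
      have "\<xi> \<in> unit_cube" if "\<xi> \<in> ?Z" for \<xi>
      proof -
        have "\<bar>(N *v \<xi>) $ i\<bar> \<le> \<kappa>" for i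
          using that \<rho>w(2)[of i] by (auto intro: order_trans)
        then have "norm \<xi> \<le> \<beta>2 * \<kappa>" using \<beta>2(2)[of "\<kappa>" \<xi>] \<kappa> by simp
        then have "\<bar>\<xi> $ k\<bar> \<le> 1" for k using \<kappa> component_le_norm_cart[of \<xi> k] by linarith
        then show ?thesis by (simp add: unit_cube_def abs_le_iff)
      qed
      then show "?X \<times> ?Z \<subseteq> UNIV \<times> unit_cube" by blast
      show "plane_transform Q1 Q2 (indicator (?Y \<times> ?P)) z = complex_of_real (4 * \<delta>\<^sup>2 * \<epsilon>)" if "z \<in> ?X \<times> ?Z" for z
      proof -
        obtain x \<xi> where zx: "z = (x, \<xi>)" by (cases z)
        have "x \<in> ?X \<and> \<xi> \<in> ?Z" using that unfolding zx by (simp only: mem_Times_iff fst_conv snd_conv)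
        with zx have z: "z = (x, \<xi>)" "x \<in> ?X" "\<xi> \<in> ?Z" by blast+
        have \<xi>: "\<xi> = transpose M *v (N *v \<xi>)" by (simp add: matrix_vector_mul_assoc N)
        have "x - s *\<^sub>R grad Q1 \<xi> - t *\<^sub>R grad Q2 \<xi> \<in> ?Y" if "(s, t) \<in> ?P" for s t
        proof -
          obtain u v where uv: "\<bar>u\<bar> \<le> \<delta> * \<epsilon>" "\<bar>v\<bar> \<le> \<delta>" "s *\<^sub>R A + t *\<^sub>R B = u *\<^sub>R A1 + v *\<^sub>R B1"
            using Puv[OF \<open>(s, t) \<in> ?P\<close>] by blast
          have "s *\<^sub>R grad Q1 \<xi> + t *\<^sub>R grad Q2 \<xi> = (u *\<^sub>R A1 + v *\<^sub>R B1) *v \<xi>"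
            unfolding grad uv(3)[symmetric] by (simp add: matrix_vector_mult_add_rdistrib scaleR_matrix_vector_assoc)
          then have eq: "x - s *\<^sub>R grad Q1 \<xi> - t *\<^sub>R grad Q2 \<xi> = x - (u *\<^sub>R A1 + v *\<^sub>R B1) *v \<xi>"
            by (simp add: diff_diff_eq)
          have "\<bar>(M *v (x - (u *\<^sub>R A1 + v *\<^sub>R B1) *v \<xi>)) $ i\<bar> \<le> 2 * \<rho> * \<epsilon> powr w i" for i
          proof -
            have "\<bar>(M *v ((u *\<^sub>R A1 + v *\<^sub>R B1) *v (transpose M *v (N *v \<xi>)))) $ i\<bar> \<le> \<rho> * \<epsilon> powr w i"
              using wA wB \<epsilon> \<rho> \<delta> \<delta>S z(3) uv unfolding S_def by (intro pencil_row_bound[where \<delta>=\<delta>]) auto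
            then have "\<bar>(M *v ((u *\<^sub>R A1 + v *\<^sub>R B1) *v \<xi>)) $ i\<bar> \<le> \<rho> * \<epsilon> powr w i"
              using \<xi> by simp
            moreover have "\<bar>(M *v x) $ i\<bar> \<le> \<rho> * \<epsilon> powr w i" using z(2) by blast
            ultimately show ?thesis by (simp add: matrix_vector_mult_diff_distrib)
          qed
          then show ?thesis unfolding eq by blast
        qed
        then show ?thesis
          unfolding z(1) using \<delta> \<epsilon>
          by (intro plane_transform_indicator[OF P'(1,2,3)]) (auto simp del: mem_Collect_eq)
      qed
      show "0 \<le> (4 * \<rho>) ^ CARD('n) * \<epsilon> powr ?W * (4 * \<delta>\<^sup>2 * \<epsilon>)" "0 \<le> (2 * \<rho>) ^ (2 * CARD('n))"
        "0 \<le> 4 * \<delta>\<^sup>2 * \<epsilon>"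
        using \<rho> \<epsilon> by simp_all
    qed (fact EY EF)+
    moreover have "((2 * \<rho>) ^ (2 * CARD('n))) powr (1 / q) = (2 * \<kappa>) powr (2 * ?d / q) * \<epsilon> powr (2 * ?d * R / q)"
    proof -
      have "(2 * \<rho>) ^ (2 * CARD('n)) = (2 * \<rho>) powr (2 * ?d)"
        using \<rho> by (subst powr_realpow[symmetric]) auto
      then show ?thesis using \<rho> \<kappa> \<epsilon> by (simp add: powr_powr \<rho>_def powr_mult mult.commute mult.assoc)
    qed
    moreover have "((4 * \<rho>) ^ CARD('n) * \<epsilon> powr ?W * (4 * \<delta>\<^sup>2 * \<epsilon>)) powr (1 / p)
        = ((4 * \<kappa>) ^ CARD('n) * (4 * \<delta>\<^sup>2)) powr (1 / p) * \<epsilon> powr ((?d * R + ?W + 1) / p)"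
    proof -
      have "(\<epsilon> powr R) ^ CARD('n) = \<epsilon> powr (?d * R)"
        using \<epsilon> by (simp add: powr_realpow[symmetric] powr_powr mult.commute)
      then have "(4 * \<rho>) ^ CARD('n) * \<epsilon> powr ?W * (4 * \<delta>\<^sup>2 * \<epsilon>)
         = ((4 * \<kappa>) ^ CARD('n) * (4 * \<delta>\<^sup>2)) * (\<epsilon> powr (?d * R) * \<epsilon> powr ?W * \<epsilon> powr 1)"
        using \<epsilon> by (simp add: \<rho>_def power_mult_distrib mult_ac)
      also have "\<epsilon> powr (?d * R) * \<epsilon> powr ?W * \<epsilon> powr 1 = \<epsilon> powr (?d * R + ?W + 1)"
        by (simp only: powr_add)
      finally have eq: "(4 * \<rho>) ^ CARD('n) * \<epsilon> powr ?W * (4 * \<delta>\<^sup>2 * \<epsilon>)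
         = ((4 * \<kappa>) ^ CARD('n) * (4 * \<delta>\<^sup>2)) * \<epsilon> powr (?d * R + ?W + 1)" .
      show ?thesis
        unfolding eq using \<kappa> by (subst powr_mult) (simp_all add: powr_powr)
    qed
    moreover have "\<epsilon> powr (1 + 2 * ?d * R / q) = \<epsilon> * \<epsilon> powr (2 * ?d * R / q)"
      using \<epsilon> by (simp add: powr_add)
    ultimately show ?thesis by (simp only: mult_ac)
  qed
  have "0 < 4 * \<delta>\<^sup>2 * (2 * \<kappa>) powr (2 * ?d / q)" using \<delta> \<kappa> by simp
  from powr_scaling_contradiction[OF _ this main] exponents show False
    by (simp add: R_def)
qed

lemma emeasure_sheared_rectangle:
  fixes c \<delta> \<eta> :: real
  assumes "0 \<le> \<delta>" "0 \<le> \<eta>"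
  shows "{(s, t). \<bar>t\<bar> \<le> \<delta> \<and> \<bar>s - c * t\<bar> \<le> \<eta>} \<in> sets borel"
    and "emeasure lborel {(s, t). \<bar>t\<bar> \<le> \<delta> \<and> \<bar>s - c * t\<bar> \<le> \<eta>} = ennreal (4 * \<delta> * \<eta>)"
    and "{(s, t). \<bar>s\<bar> \<le> \<delta> \<and> \<bar>t - c * s\<bar> \<le> \<eta>} \<in> sets borel"
    and "emeasure lborel {(s, t). \<bar>s\<bar> \<le> \<delta> \<and> \<bar>t - c * s\<bar> \<le> \<eta>} = ennreal (4 * \<delta> * \<eta>)"
proof -
  let ?S = "{(s, t). \<bar>t\<bar> \<le> \<delta> \<and> \<bar>s - c * t\<bar> \<le> \<eta>}" and ?S' = "{(s, t). \<bar>s\<bar> \<le> \<delta> \<and> \<bar>t - c * s\<bar> \<le> \<eta>}"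
  have "closed ?S" "closed ?S'"
    unfolding case_prod_beta' by (intro closed_Collect_conj closed_Collect_le continuous_intros)+
  then show S: "?S \<in> sets borel" "?S' \<in> sets borel" by auto
  have ss: "sets (lborel \<Otimes>\<^sub>M lborel) = sets (borel :: (real \<times> real) measure)"
    unfolding lborel_prod by simp
  have sec: "{s. \<bar>s - c * t\<bar> \<le> \<eta>} = {c * t - \<eta> .. c * t + \<eta>}" for t by auto
  have int: "(\<integral>\<^sup>+t. ennreal (2 * \<eta>) * indicator {-\<delta>..\<delta>} t \<partial>lborel) = ennreal (4 * \<delta> * \<eta>)"
    using assms by (simp add: nn_integral_cmult_indicator ennreal_mult[symmetric] mult_ac)
  have "emeasure lborel ?S = (\<integral>\<^sup>+t. emeasure lborel ((\<lambda>s. (s, t)) -` ?S) \<partial>lborel)"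
    unfolding lborel_prod[symmetric] 
    by (rule lborel_pair.emeasure_pair_measure_alt2) (unfold ss, rule S(1))
  also have "\<dots> = (\<integral>\<^sup>+t. ennreal (2 * \<eta>) * indicator {-\<delta>..\<delta>} t \<partial>lborel)"
  proof (rule nn_integral_cong)
    fix t
    have "(\<lambda>s. (s, t)) -` ?S = (if \<bar>t\<bar> \<le> \<delta> then {c * t - \<eta> .. c * t + \<eta>} else {})"
      using sec[of t] by auto
    then show "emeasure lborel ((\<lambda>s. (s, t)) -` ?S) = ennreal (2 * \<eta>) * indicator {-\<delta>..\<delta>} t"
      using assms by (auto simp: indicator_def abs_le_iff)
  qed
  finally show "emeasure lborel ?S = ennreal (4 * \<delta> * \<eta>)" unfolding int .
  have "emeasure lborel ?S' = (\<integral>\<^sup>+s. emeasure lborel (Pair s -` ?S') \<partial>lborel)"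
    unfolding lborel_prod[symmetric] 
    by (rule lborel.emeasure_pair_measure_alt) (unfold ss, rule S(2))
  also have "\<dots> = (\<integral>\<^sup>+t. ennreal (2 * \<eta>) * indicator {-\<delta>..\<delta>} t \<partial>lborel)"
  proof (rule nn_integral_cong)
    fix t
    have "Pair t -` ?S' = (if \<bar>t\<bar> \<le> \<delta> then {c * t - \<eta> .. c * t + \<eta>} else {})"
      using sec[of t] by auto
    then show "emeasure lborel (Pair t -` ?S') = ennreal (2 * \<eta>) * indicator {-\<delta>..\<delta>} t"
      using assms by (auto simp: indicator_def abs_le_iff)
  qed
  finally show "emeasure lborel ?S' = ennreal (4 * \<delta> * \<eta>)" unfolding int .
qed

text \<open>At the critical pair \<open>q\<close> is twice \<open>p\<close>, so that the terms with \<open>R\<close> cancel and the inequality says that \<open>W\<close> exceeds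
  \<open>d / 4\<close>. It is strict, so it persists nearby.\<close>

lemma exponents_near_critical:
  fixes d R W :: real
  assumes "d > 0" "d / 4 < W"
  obtains \<eta> where "\<eta> > 0" "\<eta> < (d + 4) / 4"
    "\<And>p q. \<bar>p - (d + 4) / 4\<bar> < \<eta> \<Longrightarrow> \<bar>q - (d + 4) / 2\<bar> < \<eta> \<Longrightarrow> 1 + 2 * d * R / q < (d * R + W + 1) / p"
proof -
  define pc where "pc = (d + 4) / 4"
  have pc: "pc > 0" using assms by (simp add: pc_def)
  (* g is continuous at the critical pair, and positive there. *)
  define g where "g z = (d * R + W + 1) / fst z - (1 + 2 * d * R / snd z)" for z :: "real \<times> real"
  have "g (pc, 2 * pc) = (W + 1) / pc - 1" using pc by (simp add: g_def add_divide_distrib)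
  also have "\<dots> > 0" using assms pc by (simp add: pc_def field_simps)
  finally have g0: "g (pc, 2 * pc) > 0" .
  have "isCont g (pc, 2 * pc)"
    unfolding g_def using pc by (intro continuous_intros) auto
  then obtain e where e: "e > 0" "\<And>z. dist z (pc, 2 * pc) < e \<Longrightarrow> dist (g z) (g (pc, 2 * pc)) < g (pc, 2 * pc)"
    unfolding continuous_at_eps_delta using g0 by blast
  define \<eta> where "\<eta> = min (e / 2) (pc / 2)"
  have "1 + 2 * d * R / q < (d * R + W + 1) / p" if "\<bar>p - pc\<bar> < \<eta>" "\<bar>q - 2 * pc\<bar> < \<eta>" for p q
  proof -
    have "dist (p, q) (pc, 2 * pc) \<le> \<bar>p - pc\<bar> + \<bar>q - 2 * pc\<bar>"
      unfolding dist_Pair_Pair dist_real_def by (rule order_trans[OF sqrt_sum_squares_le_sum_abs]) simp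
    also have "\<dots> < e" using that by (simp add: \<eta>_def)
    finally have "dist (g (p, q)) (g (pc, 2 * pc)) < g (pc, 2 * pc)" by (rule e(2))
    then have "g (p, q) > 0" by (simp add: dist_real_def abs_less_iff)
    then show ?thesis by (simp add: g_def)
  qed
  moreover have "\<eta> > 0" "\<eta> < pc" using e pc by (auto simp: \<eta>_def min_def)
  moreover have "2 * pc = (d + 4) / 2" by (simp add: pc_def)
  ultimately show thesis using that[of \<eta>] unfolding pc_def by presburger
qed

text \<open>In both cases of the dichotomy the parameters are restricted to a thin parallelogram along the line on
  which the determinant vanishes to high order: \<open>s A + t B = (s - c t) A + t (B + c A)\<close>, where \<open>s - c t\<close> has size
  \<open>\<epsilon>\<close>.\<close>

lemma unstable_pair_no_estimate:
  fixes A B :: "real^'n^'n"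
  assumes grad: "\<And>\<xi>. grad Q1 \<xi> = A *v \<xi>" "\<And>\<xi>. grad Q2 \<xi> = B *v \<xi>"
    and sym: "transpose A = A" "transpose B = B" and C: "C > 0" and "unstable_pair A B"
  shows "\<exists>U :: (ennreal \<times> ennreal) set. open U \<and>
               (ennreal ((real CARD('n) + 4) / 4), ennreal ((real CARD('n) + 4) / 2)) \<in> U \<and>
               (\<forall>(p, q)\<in>U. 1 \<le> p \<longrightarrow> 1 \<le> q \<longrightarrow>
                  \<not> (\<exists>K\<ge>0. plane_transform_estimate Q1 Q2 C p q K))"
proof -
  let ?d = "real CARD('n)"
  have "\<exists>w :: 'n \<Rightarrow> real. ?d / 4 < sum w UNIV \<and> (\<forall>p q K. 0 < p \<longrightarrow> 0 < q \<longrightarrow> 0 \<le> K \<longrightarrow>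
       1 + 2 * ?d * (\<Sum>i\<in>UNIV. \<bar>w i\<bar>) / q < (?d * (\<Sum>i\<in>UNIV. \<bar>w i\<bar>) + sum w UNIV + 1) / p \<longrightarrow>
       \<not> plane_transform_estimate Q1 Q2 C (ennreal p) (ennreal q) K)"
  proof -
    consider c where "deep_root A (B + c *\<^sub>R A)" | c where "deep_root B (A + c *\<^sub>R B)"
      using assms unstable_pair_iff_deep_root[OF sym] by blast
    then show ?thesis
    proof cases
      case 1
      obtain M w where Mw: "det M = 1" "?d / 4 < sum w UNIV"
        "\<And>i j. congr_by M A $ i $ j \<noteq> 0 \<Longrightarrow> w i + w j \<le> 1"
        "\<And>i j. congr_by M (B + c *\<^sub>R A) $ i $ j \<noteq> 0 \<Longrightarrow> w i + w j \<le> 0"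
        using deep_root_weights[OF sym(1) transpose_add_scaleR[OF sym] 1] by blast
      let ?P = "\<lambda>\<delta> \<epsilon>. {(s, t). \<bar>t\<bar> \<le> \<delta> \<and> \<bar>s - c * t\<bar> \<le> \<delta> * \<epsilon>}"
      have P: "?P \<delta> \<epsilon> \<in> sets borel \<and> ?P \<delta> \<epsilon> \<subseteq> {-1..1} \<times> {-1..1} \<and> emeasure lborel (?P \<delta> \<epsilon>) = ennreal (4 * \<delta>\<^sup>2 * \<epsilon>)"
        if h: "0 < \<delta>" "\<delta> \<le> 1 / (1 + \<bar>c\<bar>)" "0 < \<epsilon>" "\<epsilon> < 1" for \<delta> \<epsilon>
      proof (intro conjI subsetI)
        fix z assume "z \<in> ?P \<delta> \<epsilon>"
        then obtain s t where z: "z = (s, t)" "\<bar>t\<bar> \<le> \<delta>" "\<bar>s - c * t\<bar> \<le> \<delta> * \<epsilon>" by auto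
        have "\<bar>c * t\<bar> \<le> \<bar>c\<bar> * \<delta>" using z by (simp add: abs_mult mult_left_mono)
        moreover have "\<delta> * \<epsilon> \<le> \<delta>" using h by simp
        moreover have "\<delta> + \<bar>c\<bar> * \<delta> \<le> 1" using h by (simp add: field_simps)
        moreover have "0 \<le> \<bar>c\<bar> * \<delta>" using h by simp
        ultimately have "\<bar>s\<bar> \<le> 1" "\<bar>t\<bar> \<le> 1" using z by linarith+
        then show "z \<in> {-1..1} \<times> {-1..1}" by (auto simp: z abs_le_iff)
      qed (use h emeasure_sheared_rectangle(1,2)[of \<delta> "\<delta> * \<epsilon>" c] in \<open>auto simp: power2_eq_square mult_ac\<close>)
      have Puv: "\<exists>u v. \<bar>u\<bar> \<le> \<delta> * \<epsilon> \<and> \<bar>v\<bar> \<le> \<delta> \<and> s *\<^sub>R A + t *\<^sub>R B = u *\<^sub>R A + v *\<^sub>R (B + c *\<^sub>R A)"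
        if "(s, t) \<in> ?P \<delta> \<epsilon>" for \<delta> \<epsilon> s t
        using that by (intro exI[of _ "s - c * t"] exI[of _ t]) (auto simp: algebra_simps)
      have c: "1 / (1 + \<bar>c\<bar>) > 0" by (simp add: add_pos_nonneg)
      show ?thesis
        using weights_imp_no_estimate[where A=A and B=B and M=M and w=w and P="?P", OF grad C Mw(1,3,4) c P Puv] Mw(2) by blast
    next
      case 2
      obtain M w where Mw: "det M = 1" "?d / 4 < sum w UNIV"
        "\<And>i j. congr_by M B $ i $ j \<noteq> 0 \<Longrightarrow> w i + w j \<le> 1"
        "\<And>i j. congr_by M (A + c *\<^sub>R B) $ i $ j \<noteq> 0 \<Longrightarrow> w i + w j \<le> 0"
        using deep_root_weights[OF sym(2) transpose_add_scaleR[OF sym(2,1)] 2] by blast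
      let ?P = "\<lambda>\<delta> \<epsilon>. {(s, t). \<bar>s\<bar> \<le> \<delta> \<and> \<bar>t - c * s\<bar> \<le> \<delta> * \<epsilon>}"
      have P: "?P \<delta> \<epsilon> \<in> sets borel \<and> ?P \<delta> \<epsilon> \<subseteq> {-1..1} \<times> {-1..1} \<and> emeasure lborel (?P \<delta> \<epsilon>) = ennreal (4 * \<delta>\<^sup>2 * \<epsilon>)"
        if h: "0 < \<delta>" "\<delta> \<le> 1 / (1 + \<bar>c\<bar>)" "0 < \<epsilon>" "\<epsilon> < 1" for \<delta> \<epsilon>
      proof (intro conjI subsetI)
        fix z assume "z \<in> ?P \<delta> \<epsilon>"
        then obtain s t where z: "z = (s, t)" "\<bar>s\<bar> \<le> \<delta>" "\<bar>t - c * s\<bar> \<le> \<delta> * \<epsilon>" by auto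
        have "\<bar>c * s\<bar> \<le> \<bar>c\<bar> * \<delta>" using z by (simp add: abs_mult mult_left_mono)
        moreover have "\<delta> * \<epsilon> \<le> \<delta>" using h by simp
        moreover have "\<delta> + \<bar>c\<bar> * \<delta> \<le> 1" using h by (simp add: field_simps)
        moreover have "0 \<le> \<bar>c\<bar> * \<delta>" using h by simp
        ultimately have "\<bar>s\<bar> \<le> 1" "\<bar>t\<bar> \<le> 1" using z by linarith+
        then show "z \<in> {-1..1} \<times> {-1..1}" by (auto simp: z abs_le_iff)
      qed (use h emeasure_sheared_rectangle(3,4)[of \<delta> "\<delta> * \<epsilon>" c] in \<open>auto simp: power2_eq_square mult_ac\<close>)
      have Puv: "\<exists>u v. \<bar>u\<bar> \<le> \<delta> * \<epsilon> \<and> \<bar>v\<bar> \<le> \<delta> \<and> s *\<^sub>R A + t *\<^sub>R B = u *\<^sub>R B + v *\<^sub>R (A + c *\<^sub>R B)"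
        if "(s, t) \<in> ?P \<delta> \<epsilon>" for \<delta> \<epsilon> s t
        using that by (intro exI[of _ "t - c * s"] exI[of _ s]) (auto simp: algebra_simps)
      have c: "1 / (1 + \<bar>c\<bar>) > 0" by (simp add: add_pos_nonneg)
      show ?thesis
        using weights_imp_no_estimate[where A=A and B=B and M=M and w=w and P="?P", OF grad C Mw(1,3,4) c P Puv] Mw(2) by blast
    qed
  qed
  then obtain w :: "'n \<Rightarrow> real" where w: "?d / 4 < sum w UNIV"
    "\<And>p q K. 0 < p \<Longrightarrow> 0 < q \<Longrightarrow> 0 \<le> K \<Longrightarrow>
       1 + 2 * ?d * (\<Sum>i\<in>UNIV. \<bar>w i\<bar>) / q < (?d * (\<Sum>i\<in>UNIV. \<bar>w i\<bar>) + sum w UNIV + 1) / p \<Longrightarrow>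
       \<not> plane_transform_estimate Q1 Q2 C (ennreal p) (ennreal q) K" by blast
  have d: "?d > 0" by simp
  obtain \<eta> where \<eta>: "\<eta> > 0" "\<eta> < (?d + 4) / 4"
    "\<And>p q. \<bar>p - (?d + 4) / 4\<bar> < \<eta> \<Longrightarrow> \<bar>q - (?d + 4) / 2\<bar> < \<eta> \<Longrightarrow>
       1 + 2 * ?d * (\<Sum>i\<in>UNIV. \<bar>w i\<bar>) / q < (?d * (\<Sum>i\<in>UNIV. \<bar>w i\<bar>) + sum w UNIV + 1) / p"
    using exponents_near_critical[OF d w(1)] by blast
  let ?I = "\<lambda>x. {ennreal (x - \<eta>) <..< ennreal (x + \<eta>)}"
  let ?p = "(?d + 4) / 4" and ?q = "(?d + 4) / 2"
  have pq: "?p - \<eta> > 0" "?q - \<eta> > 0" using \<eta> by auto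
  have self: "ennreal x \<in> ?I x" if "x - \<eta> > 0" for x
  proof -
    have "ennreal (x - \<eta>) < ennreal x" "ennreal x < ennreal (x + \<eta>)"
      using that \<eta>(1) by (subst ennreal_less_iff; simp)+
    then show ?thesis by simp
  qed
  have mem: "\<exists>y. x = ennreal y \<and> 0 < y \<and> \<bar>y - c\<bar> < \<eta>" if "x \<in> ?I c" "c - \<eta> > 0" for x c
  proof (cases x)
    case (real r)
    then have "c - \<eta> < r" "r < c + \<eta>" using that by (auto simp: ennreal_less_iff)
    then show ?thesis using real that by (intro exI[of _ r]) auto
  next
    case top then show ?thesis using that by auto
  qed
  show ?thesis
  proof (intro exI[of _ "?I ?p \<times> ?I ?q"] conjI ballI)
    show "open (?I ?p \<times> ?I ?q)" by (intro open_Times open_greaterThanLessThan)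
    show "(ennreal ?p, ennreal ?q) \<in> ?I ?p \<times> ?I ?q" using self[OF pq(1)] self[OF pq(2)] by blast
    fix z assume "z \<in> ?I ?p \<times> ?I ?q"
    then have "fst z \<in> ?I ?p" "snd z \<in> ?I ?q" by (simp_all only: mem_Times_iff)
    from mem[OF this(1) pq(1)] mem[OF this(2) pq(2)]
    obtain p q where "fst z = ennreal p" "snd z = ennreal q"
      and pq': "0 < p" "0 < q" "\<bar>p - ?p\<bar> < \<eta>" "\<bar>q - ?q\<bar> < \<eta>" by blast
    then have z: "z = (ennreal p, ennreal q)" by (simp add: prod_eq_iff)
    show "case z of (p, q) \<Rightarrow> 1 \<le> p \<longrightarrow> 1 \<le> q \<longrightarrow> \<not> (\<exists>K\<ge>0. plane_transform_estimate Q1 Q2 C p q K)"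
      using w(2)[OF pq'(1,2) _ \<eta>(3)[OF pq'(3,4)]] unfolding z by blast
  qed
qed

section \<open>Integrability of negative powers of the determinant\<close>

lemma measurable_borel_compose_continuous:
  fixes f :: "'b::topological_space \<Rightarrow> 'c::topological_space"
  assumes "f \<in> borel_measurable borel" "continuous_on UNIV h"
  shows "(\<lambda>x. f (h x)) \<in> borel_measurable borel"
  by (rule measurable_compose[OF borel_measurable_continuous_onI[OF assms(2)] assms(1)])

text \<open>A nonzero coefficient of order \<open>k\<close> at \<open>c\<close> bounds the multiplicity of the root \<open>c\<close> by \<open>k\<close>.\<close>

lemma poly_lower_bound_near:
  fixes p :: "real poly"
  assumes "coeff (pcompose p [:c, 1:]) k \<noteq> 0"
  obtains n m r where "n \<le> k" "m > 0" "r > 0" "\<And>u. \<bar>u - c\<bar> < r \<Longrightarrow> m * \<bar>u - c\<bar> ^ n \<le> \<bar>poly p u\<bar>"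
proof -
  have p0: "p \<noteq> 0" using assms by auto
  define n where "n = order c p"
  obtain q where q: "p = [:- c, 1:] ^ n * q" "\<not> [:- c, 1:] dvd q"
    unfolding n_def using order_decomp[OF p0, of c] by blast
  have "n \<le> k"
  proof (rule ccontr)
    assume "\<not> n \<le> k"
    have "pcompose p [:c, 1:] = monom 1 n * pcompose q [:c, 1:]"
      by (simp add: poly_eq_poly_eq_iff[symmetric] fun_eq_iff poly_pcompose poly_monom q(1))
    then show False using assms \<open>\<not> n \<le> k\<close> by (simp add: coeff_monom_mult)
  qed
  have qc: "poly q c \<noteq> 0" using q(2) by (simp add: poly_eq_0_iff_dvd)
  have "isCont (poly q) c" by simp
  then obtain r where r: "r > 0" "\<And>u. dist u c < r \<Longrightarrow> dist (poly q u) (poly q c) < \<bar>poly q c\<bar> / 2"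
    unfolding continuous_at_eps_delta using qc by (metis half_gt_zero zero_less_abs_iff)
  have "(\<bar>poly q c\<bar> / 2) * \<bar>u - c\<bar> ^ n \<le> \<bar>poly p u\<bar>" if "\<bar>u - c\<bar> < r" for u
  proof -
    have "\<bar>poly q u - poly q c\<bar> < \<bar>poly q c\<bar> / 2" using r(2)[of u] that by (simp add: dist_real_def)
    then have "\<bar>poly q c\<bar> / 2 \<le> \<bar>poly q u\<bar>" by linarith
    then have "(\<bar>poly q c\<bar> / 2) * \<bar>u - c\<bar> ^ n \<le> \<bar>poly q u\<bar> * \<bar>u - c\<bar> ^ n"
      by (rule mult_right_mono) simp
    also have "\<dots> = \<bar>poly p u\<bar>" unfolding q(1) by (simp add: abs_mult power_abs mult.commute)
    finally show ?thesis .
  qed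
  then show thesis using that[of n "\<bar>poly q c\<bar> / 2" r] \<open>n \<le> k\<close> qc r(1) by simp
qed

text \<open>The inverse of zero is \<open>\<infinity>\<close> in the extended nonnegative reals, so the singularity counts in the integral; it
  is harmless since a point is a null set.\<close>

lemma nn_integral_inverse_powr_finite:
  fixes e :: real
  assumes "e < 1"
  shows "(\<integral>\<^sup>+u. indicator {-R..R} u * inverse (ennreal (\<bar>u - c\<bar> powr e)) \<partial>lborel) < \<infinity>"
proof -
  define T where "T = \<bar>R\<bar> + \<bar>c\<bar>"
  have "((\<lambda>x. x powr - e) has_integral T powr (- e + 1) / (- e + 1)) {0..T}"
    using assms by (intro has_integral_powr_from_0) (auto simp: T_def)
  from nn_integral_has_integral_lebesgue'[OF _ this]
  have I: "(\<integral>\<^sup>+u. indicator {0..T} u * ennreal (u powr (- e)) \<partial>lborel) = ennreal (T powr (- e + 1) / (- e + 1))"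
    by (simp add: mult.commute)
  have ae: "AE u in lborel. u \<noteq> (0::real)"
    by (rule AE_lborel_singleton)
  have h: "(\<integral>\<^sup>+u. indicator {0..T} u * inverse (ennreal (\<bar>u\<bar> powr e)) \<partial>lborel) = ennreal (T powr (- e + 1) / (- e + 1))"
    unfolding I[symmetric]
    by (rule nn_integral_cong_AE)
      (use ae in \<open>auto elim!: eventually_mono simp: indicator_def powr_minus inverse_ennreal\<close>)
  have neg: "(\<integral>\<^sup>+u. indicator {-T..0} u * inverse (ennreal (\<bar>u\<bar> powr e)) \<partial>lborel)
      = (\<integral>\<^sup>+u. indicator {0..T} u * inverse (ennreal (\<bar>u\<bar> powr e)) \<partial>lborel)"
    by (subst nn_integral_real_affine[where c="-1" and t=0]) (auto intro!: nn_integral_cong simp: indicator_def)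
  have "(\<integral>\<^sup>+u. indicator {-R..R} u * inverse (ennreal (\<bar>u - c\<bar> powr e)) \<partial>lborel)
      = (\<integral>\<^sup>+u. indicator {-R..R} (c + u) * inverse (ennreal (\<bar>u\<bar> powr e)) \<partial>lborel)"
    using nn_integral_lborel_translate[of "\<lambda>u. indicator {-R..R} u * inverse (ennreal (\<bar>u - c\<bar> powr e))" c] by simp
  also have "\<dots> \<le> (\<integral>\<^sup>+u. indicator {-T..0} u * inverse (ennreal (\<bar>u\<bar> powr e))
       + indicator {0..T} u * inverse (ennreal (\<bar>u\<bar> powr e)) \<partial>lborel)"
    by (intro nn_integral_mono) (auto simp: indicator_def T_def)
  also have "\<dots> = (\<integral>\<^sup>+u. indicator {-T..0} u * inverse (ennreal (\<bar>u\<bar> powr e)) \<partial>lborel)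
       + (\<integral>\<^sup>+u. indicator {0..T} u * inverse (ennreal (\<bar>u\<bar> powr e)) \<partial>lborel)"
    by (rule nn_integral_add) measurable
  also have "\<dots> < \<infinity>" unfolding neg h by simp
  finally show ?thesis .
qed

lemma inverse_ennreal_antimono:
  assumes ab: "(a::ennreal) \<le> b"
  shows "inverse b \<le> inverse a"
proof (cases "a = 0 \<or> b = top")
  case False
  then obtain x y where xy: "a = ennreal x" "b = ennreal y" "0 < x" "0 \<le> y"
    using ab by (cases a; cases b) (auto simp: less_le top_unique)
  then show ?thesis using ab by (simp add: inverse_ennreal ennreal_le_iff le_imp_inverse_le ennreal_leI)
qed auto

text \<open>Near each point of the compact interval the polynomial is bounded below by a power of the distance to that
  point whose negative power \<open>b\<close> is still integrable; finitely many such neighbourhoods suffice.\<close>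

lemma nn_integral_inverse_poly_finite:
  fixes p :: "real poly"
  assumes ord: "\<And>c. c \<in> {-1..1} \<Longrightarrow> \<exists>k. real k * b < 1 \<and> coeff (pcompose p [:c, 1:]) k \<noteq> 0" and b: "b > 0"
  shows "(\<integral>\<^sup>+u. indicator {-1..1} u * inverse (ennreal (\<bar>poly p u\<bar> powr b)) \<partial>lborel) < \<infinity>"
proof -
  let ?f = "\<lambda>u. inverse (ennreal (\<bar>poly p u\<bar> powr b))"
  have [measurable]: "poly p \<in> borel_measurable borel"
    by (intro borel_measurable_continuous_onI continuous_intros)
  have "\<exists>r>0. (\<integral>\<^sup>+u. indicator (ball c r \<inter> {-1..1}) u * ?f u \<partial>lborel) < \<infinity>" if c: "c \<in> {-1..1}" for c
  proof -
    obtain k where k: "real k * b < 1" "coeff (pcompose p [:c, 1:]) k \<noteq> 0" using ord[OF c] by blast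
    obtain n m r where n: "n \<le> k" "m > 0" "r > 0" "\<And>u. \<bar>u - c\<bar> < r \<Longrightarrow> m * \<bar>u - c\<bar> ^ n \<le> \<bar>poly p u\<bar>"
      using poly_lower_bound_near[OF k(2)] by blast
    have "real n * b \<le> real k * b" using n b by (intro mult_right_mono) auto
    then have nb: "real n * b < 1" using k by linarith
    have ptw: "indicator (ball c r \<inter> {-1..1}) u * ?f u
       \<le> inverse (ennreal (m powr b)) * (indicator {-1..1} u * inverse (ennreal (\<bar>u - c\<bar> powr (real n * b))))" if "u \<noteq> c" for u
    proof (cases "u \<in> ball c r \<inter> {-1..1}")
      case True
      have pos: "\<bar>u - c\<bar> > 0" using that by simp
      have "(m * \<bar>u - c\<bar> ^ n) powr b \<le> \<bar>poly p u\<bar> powr b"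
        using n(2) n(4)[of u] True b by (intro powr_mono2) (auto simp: dist_real_def abs_minus_commute)
      also have "(m * \<bar>u - c\<bar> ^ n) powr b = m powr b * \<bar>u - c\<bar> powr (real n * b)"
        using pos n by (simp add: powr_mult powr_realpow[symmetric] powr_powr)
      finally have "?f u \<le> inverse (ennreal (m powr b * \<bar>u - c\<bar> powr (real n * b)))"
        by (intro inverse_ennreal_antimono ennreal_leI)
      also have "\<dots> = inverse (ennreal (m powr b)) * inverse (ennreal (\<bar>u - c\<bar> powr (real n * b)))"
        using n pos by (simp add: inverse_ennreal ennreal_mult[symmetric])
      finally show ?thesis using True by (simp add: indicator_def)
    qed (auto simp: indicator_def)
    have "(\<integral>\<^sup>+u. indicator (ball c r \<inter> {-1..1}) u * ?f u \<partial>lborel)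
      \<le> (\<integral>\<^sup>+u. inverse (ennreal (m powr b)) * (indicator {-1..1} u * inverse (ennreal (\<bar>u - c\<bar> powr (real n * b)))) \<partial>lborel)"
      using AE_lborel_singleton[of c] by (intro nn_integral_mono_AE) (auto elim!: eventually_mono intro: ptw)
    also have "\<dots> = inverse (ennreal (m powr b)) * (\<integral>\<^sup>+u. indicator {-1..1} u * inverse (ennreal (\<bar>u - c\<bar> powr (real n * b))) \<partial>lborel)"
      by (rule nn_integral_cmult) measurable
    also have "\<dots> < \<infinity>"
      using nn_integral_inverse_powr_finite[OF nb, of 1 c] n by (simp add: ennreal_mult_less_top inverse_ennreal)
    finally show ?thesis using n by blast
  qed
  then obtain r where r: "\<And>c. c \<in> {-1..1} \<Longrightarrow> r c > 0"
    "\<And>c. c \<in> {-1..1} \<Longrightarrow> (\<integral>\<^sup>+u. indicator (ball c (r c) \<inter> {-1..1}) u * ?f u \<partial>lborel) < \<infinity>"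
    by metis
  have "compact {-1..1::real}" by simp
  then obtain F where F: "F \<subseteq> {-1..1}" "finite F" "{-1..1} \<subseteq> (\<Union>c\<in>F. ball c (r c))"
    by (rule compactE_image[of _ "{-1..1}" "\<lambda>c. ball c (r c)"]) (use r(1) in \<open>force+\<close>)
  have "(\<integral>\<^sup>+u. indicator {-1..1} u * ?f u \<partial>lborel)
     \<le> (\<integral>\<^sup>+u. (\<Sum>c\<in>F. indicator (ball c (r c) \<inter> {-1..1}) u * ?f u) \<partial>lborel)"
  proof (rule nn_integral_mono)
    fix u :: real
    show "indicator {-1..1} u * ?f u \<le> (\<Sum>c\<in>F. indicator (ball c (r c) \<inter> {-1..1}) u * ?f u)"
    proof (cases "u \<in> {-1..1}")
      case True
      then obtain c where c: "c \<in> F" "u \<in> ball c (r c)" using F by blast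
      have "indicator (ball c (r c) \<inter> {-1..1}) u * ?f u \<le> (\<Sum>c\<in>F. indicator (ball c (r c) \<inter> {-1..1}) u * ?f u)"
        using F c by (intro member_le_sum) auto
      then show ?thesis using True c by (simp add: indicator_def)
    qed simp
  qed
  also have "\<dots> = (\<Sum>c\<in>F. \<integral>\<^sup>+u. indicator (ball c (r c) \<inter> {-1..1}) u * ?f u \<partial>lborel)"
  proof (rule nn_integral_sum)
    fix c
    have [measurable]: "ball c (r c) \<inter> {-1..1} \<in> sets borel" by auto
    show "(\<lambda>u. indicator (ball c (r c) \<inter> {-1..1}) u * ?f u) \<in> borel_measurable lborel" by measurable
  qed
  also have "\<dots> < \<infinity>" using F r by (auto simp: less_top[symmetric] ennreal_sum_less_top)
  finally show ?thesis .
qed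

lemma inverse_ennreal_mult_pos:
  assumes "0 < a" "0 \<le> x"
  shows "inverse (ennreal (a * x)) = inverse (ennreal a) * inverse (ennreal x)"
proof (cases "x = 0")
  case True
  then show ?thesis using assms by (simp add: inverse_ennreal ennreal_mult_top)
next
  case False
  then show ?thesis using assms by (simp add: inverse_ennreal ennreal_mult[symmetric])
qed

lemma det_scaleR_matrix: "det (c *\<^sub>R (X :: real^'n^'n)) = c ^ CARD('n) * det X"
proof -
  have "c *\<^sub>R X = (\<chi> i. c *s X $ i)" by (simp add: vec_eq_iff)
  then have "det (c *\<^sub>R X) = (\<Prod>i\<in>(UNIV::'n set). c) * det (\<chi> i. X $ i)"
    by (simp only: det_rows_mul)
  then show ?thesis by simp
qed

lemma continuous_on_det_pencil:
  fixes A B :: "real^'n^'n"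
  shows "continuous_on S (\<lambda>z. det (fst z *\<^sub>R A + snd z *\<^sub>R B))"
  unfolding det_def by (intro continuous_intros)

lemma det_pencil_measurable [measurable]:
  fixes A B :: "real^'n^'n"
  shows "(\<lambda>z. det (fst z *\<^sub>R A + snd z *\<^sub>R B)) \<in> borel_measurable borel"
  by (intro borel_measurable_continuous_onI continuous_on_det_pencil)

text \<open>On the cone \<open>\<bar>s\<bar> \<le> \<bar>t\<bar>\<close>, the substitution \<open>s = t u\<close> and the homogeneity of the determinant separate the variables:
  the integral in \<open>u\<close> is finite by the bound on the multiplicities, and the one in \<open>t\<close> because the total degree
  \<open>d\<close> satisfies \<open>d b < 2\<close>.\<close>

lemma half_cone_integral_finite:
  fixes A B :: "real^'n^'n"
  assumes ord: "\<And>c. c \<in> {-1..1} \<Longrightarrow> \<exists>k. real k * b < 1 \<and> coeff (pencil_poly A (B + c *\<^sub>R A)) k \<noteq> 0"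
    and b: "b > 0" "real CARD('n) * b < 2"
  shows "(\<integral>\<^sup>+t. \<integral>\<^sup>+s. indicator {-2..2} t * (indicator {-\<bar>t\<bar>..\<bar>t\<bar>} s *
           inverse (ennreal (\<bar>det (s *\<^sub>R A + t *\<^sub>R B)\<bar> powr b))) \<partial>lborel \<partial>lborel) < \<infinity>"
proof -
  let ?p = "pencil_poly A B" and ?d = "real CARD('n)"
  define J where "J = (\<integral>\<^sup>+u. indicator {-1..1} u * inverse (ennreal (\<bar>poly ?p u\<bar> powr b)) \<partial>lborel)"
  have J: "J < \<infinity>"
    unfolding J_def using ord b(1) by (intro nn_integral_inverse_poly_finite) (auto simp: pencil_poly_shift)
  have [measurable]: "poly ?p \<in> borel_measurable borel"
    by (intro borel_measurable_continuous_onI continuous_intros)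
  have inner: "(\<integral>\<^sup>+s. indicator {-2..2} t * (indicator {-\<bar>t\<bar>..\<bar>t\<bar>} s *
           inverse (ennreal (\<bar>det (s *\<^sub>R A + t *\<^sub>R B)\<bar> powr b))) \<partial>lborel)
      = (indicator {-2..2} t * inverse (ennreal (\<bar>t - 0\<bar> powr (?d * b - 1)))) * J" if t: "t \<noteq> 0" for t
  proof -
    have [measurable]: "(\<lambda>s. det (s *\<^sub>R A + t *\<^sub>R B)) \<in> borel_measurable borel"
      unfolding det_def by (intro borel_measurable_continuous_onI continuous_intros)
    have "(\<integral>\<^sup>+s. indicator {-\<bar>t\<bar>..\<bar>t\<bar>} s * inverse (ennreal (\<bar>det (s *\<^sub>R A + t *\<^sub>R B)\<bar> powr b)) \<partial>lborel)
      = \<bar>t\<bar> * (\<integral>\<^sup>+u. indicator {-\<bar>t\<bar>..\<bar>t\<bar>} (0 + t * u) * inverse (ennreal (\<bar>det ((0 + t * u) *\<^sub>R A + t *\<^sub>R B)\<bar> powr b)) \<partial>lborel)"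
      using t by (intro nn_integral_real_affine) auto
    also have "(\<integral>\<^sup>+u. indicator {-\<bar>t\<bar>..\<bar>t\<bar>} (0 + t * u) * inverse (ennreal (\<bar>det ((0 + t * u) *\<^sub>R A + t *\<^sub>R B)\<bar> powr b)) \<partial>lborel)
      = (\<integral>\<^sup>+u. inverse (ennreal (\<bar>t\<bar> powr (?d * b))) * (indicator {-1..1} u * inverse (ennreal (\<bar>poly ?p u\<bar> powr b))) \<partial>lborel)"
    proof (rule nn_integral_cong)
      fix u :: real
      have "t * u \<in> {-\<bar>t\<bar>..\<bar>t\<bar>} \<longleftrightarrow> \<bar>t * u\<bar> \<le> \<bar>t\<bar>" by auto
      also have "\<dots> \<longleftrightarrow> \<bar>t\<bar> * \<bar>u\<bar> \<le> \<bar>t\<bar> * 1" by (simp add: abs_mult)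
      also have "\<dots> \<longleftrightarrow> \<bar>u\<bar> \<le> 1" using t by (subst mult_le_cancel_left_pos) auto
      finally have ind: "indicator {-\<bar>t\<bar>..\<bar>t\<bar>} (0 + t * u) = (indicator {-1..1} u :: ennreal)"
        by (auto simp: indicator_def)
      have "(0 + t * u) *\<^sub>R A + t *\<^sub>R B = t *\<^sub>R (B + u *\<^sub>R A)" by (simp add: algebra_simps)
      then have "\<bar>det ((0 + t * u) *\<^sub>R A + t *\<^sub>R B)\<bar> powr b = (\<bar>t\<bar> ^ CARD('n) * \<bar>poly ?p u\<bar>) powr b"
        by (simp add: det_scaleR_matrix poly_pencil_poly abs_mult power_abs)
      also have "\<dots> = \<bar>t\<bar> powr (?d * b) * \<bar>poly ?p u\<bar> powr b"
        using t by (simp add: powr_mult powr_realpow[symmetric] powr_powr)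
      finally show "indicator {-\<bar>t\<bar>..\<bar>t\<bar>} (0 + t * u) * inverse (ennreal (\<bar>det ((0 + t * u) *\<^sub>R A + t *\<^sub>R B)\<bar> powr b))
        = inverse (ennreal (\<bar>t\<bar> powr (?d * b))) * (indicator {-1..1} u * inverse (ennreal (\<bar>poly ?p u\<bar> powr b)))"
        using t unfolding ind by (simp add: inverse_ennreal_mult_pos mult_ac)
    qed
    also have "\<dots> = inverse (ennreal (\<bar>t\<bar> powr (?d * b))) * J"
      unfolding J_def by (rule nn_integral_cmult) measurable
    finally have "(\<integral>\<^sup>+s. indicator {-\<bar>t\<bar>..\<bar>t\<bar>} s * inverse (ennreal (\<bar>det (s *\<^sub>R A + t *\<^sub>R B)\<bar> powr b)) \<partial>lborel)
      = (\<bar>t\<bar> * inverse (ennreal (\<bar>t\<bar> powr (?d * b)))) * J" by (simp add: mult.assoc)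
    also have "\<bar>t\<bar> * inverse (ennreal (\<bar>t\<bar> powr (?d * b))) = inverse (ennreal (\<bar>t - 0\<bar> powr (?d * b - 1)))"
      using t by (simp add: inverse_ennreal ennreal_mult[symmetric] powr_diff divide_inverse)
    finally show ?thesis
      by (subst nn_integral_cmult) (auto simp: mult.assoc)
  qed
  have "(\<integral>\<^sup>+t. \<integral>\<^sup>+s. indicator {-2..2} t * (indicator {-\<bar>t\<bar>..\<bar>t\<bar>} s *
           inverse (ennreal (\<bar>det (s *\<^sub>R A + t *\<^sub>R B)\<bar> powr b))) \<partial>lborel \<partial>lborel)
     = (\<integral>\<^sup>+t. (indicator {-2..2} t * inverse (ennreal (\<bar>t - 0\<bar> powr (?d * b - 1)))) * J \<partial>lborel)"
    using AE_lborel_singleton[of "0::real"] by (intro nn_integral_cong_AE) (auto elim!: eventually_mono simp: inner)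
  also have "\<dots> = (\<integral>\<^sup>+t. indicator {-2..2} t * inverse (ennreal (\<bar>t - 0\<bar> powr (?d * b - 1))) \<partial>lborel) * J"
    by (rule nn_integral_multc) measurable
  also have "\<dots> < \<infinity>"
    using nn_integral_inverse_powr_finite[of "?d * b - 1" 2 0] J b by (simp add: ennreal_mult_less_top)
  finally show ?thesis .
qed

text \<open>The plane is the union of the cones \<open>\<bar>s\<bar> \<le> \<bar>t\<bar>\<close> and \<open>\<bar>t\<bar> \<le> \<bar>s\<bar>\<close>, on which the determinant is described by the
  pencils \<open>B + u A\<close> and \<open>A + u B\<close>. Stability bounds all multiplicities by \<open>d / 2 < 1 / b\<close>. The bound is uniform in
  \<open>\<sigma>\<close> since every difference of two points of the square lies in the square of twice the size.\<close>

lemma inverse_det_pencil_integrable: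
  fixes A B :: "real^'n^'n"
  assumes st: "\<not> unstable_pair A B" and sym: "transpose A = A" "transpose B = B"
    and b: "b > 0" "real CARD('n) * b < 2"
  shows "\<exists>C>0. \<forall>\<sigma>\<in>{-1..1} \<times> {-1..1}.
     (\<integral>\<^sup>+\<tau>. indicator ({-1..1} \<times> {-1..1}) \<tau> *
        inverse (ennreal (\<bar>det (fst (\<sigma> - \<tau>) *\<^sub>R A + snd (\<sigma> - \<tau>) *\<^sub>R B)\<bar> powr b)) \<partial>lborel) \<le> ennreal C"
proof -
  let ?D = "\<lambda>z. det (fst z *\<^sub>R A + snd z *\<^sub>R B)"
  define k where "k z = inverse (ennreal (\<bar>?D z\<bar> powr b))" for z
  have [measurable]: "k \<in> borel_measurable borel" unfolding k_def by measurable
  have ord: "\<exists>k. real k * b < 1 \<and> coeff (pencil_poly X (Y + c *\<^sub>R X)) k \<noteq> 0"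
    if ndr: "\<not> deep_root X (Y + c *\<^sub>R X)" for X Y :: "real^'n^'n" and c
  proof -
    obtain k where k: "2 * k \<le> CARD('n)" "coeff (pencil_poly X (Y + c *\<^sub>R X)) k \<noteq> 0"
      using ndr unfolding deep_root_def by blast
    have "2 * real k \<le> real CARD('n)" using k(1) by linarith
    then have "2 * real k * b \<le> real CARD('n) * b" using b by (intro mult_right_mono) auto
    then have "real k * b < 1" using b by linarith
    then show ?thesis using k(2) by blast
  qed
  have nd: "\<not> deep_root A (B + c *\<^sub>R A)" "\<not> deep_root B (A + c *\<^sub>R B)" for c
    using st unstable_pair_iff_deep_root[OF sym] by blast+
  (* The singular integrand on the two cones, cut off to the square of side 4. *)
  define f1 where "f1 z = indicator {-2..2} (snd z) * (indicator {-\<bar>snd z\<bar>..\<bar>snd z\<bar>} (fst z) * k z)" for z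
  define f2 where "f2 z = indicator {-2..2} (fst z) * (indicator {-\<bar>fst z\<bar>..\<bar>fst z\<bar>} (snd z) * k z)" for z
  have cone: "{z :: real \<times> real. fst z \<in> {-\<bar>snd z\<bar>..\<bar>snd z\<bar>}} \<in> sets borel"
    "{z :: real \<times> real. snd z \<in> {-\<bar>fst z\<bar>..\<bar>fst z\<bar>}} \<in> sets borel"
    by (auto intro!: borel_closed closed_Collect_conj closed_Collect_le continuous_intros simp: atLeastAtMost_iff)
  have i1: "(\<lambda>z :: real \<times> real. indicator {-\<bar>snd z\<bar>..\<bar>snd z\<bar>} (fst z) :: ennreal) = indicator {z. fst z \<in> {-\<bar>snd z\<bar>..\<bar>snd z\<bar>}}"
    and i2: "(\<lambda>z :: real \<times> real. indicator {-\<bar>fst z\<bar>..\<bar>fst z\<bar>} (snd z) :: ennreal) = indicator {z. snd z \<in> {-\<bar>fst z\<bar>..\<bar>fst z\<bar>}}"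
    by (auto simp: fun_eq_iff indicator_def)
  have m1: "(\<lambda>z :: real \<times> real. indicator {-\<bar>snd z\<bar>..\<bar>snd z\<bar>} (fst z) :: ennreal) \<in> borel_measurable borel"
    "(\<lambda>z :: real \<times> real. indicator {-\<bar>fst z\<bar>..\<bar>fst z\<bar>} (snd z) :: ennreal) \<in> borel_measurable borel"
    unfolding i1 i2 by (intro borel_measurable_indicator cone)+
  have I: "indicator {-2..2::real} \<in> (borel_measurable borel :: (real \<Rightarrow> ennreal) set)"
    by (rule borel_measurable_indicator) simp
  have m2: "(\<lambda>z :: real \<times> real. indicator {-2..2::real} (fst z) :: ennreal) \<in> borel_measurable borel"
    "(\<lambda>z :: real \<times> real. indicator {-2..2::real} (snd z) :: ennreal) \<in> borel_measurable borel"
    by (rule measurable_borel_compose_continuous[OF I], intro continuous_intros)+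
  have k: "k \<in> borel_measurable borel" by measurable
  have meas: "f1 \<in> borel_measurable borel" "f2 \<in> borel_measurable borel"
    unfolding f1_def f2_def by (intro borel_measurable_times_ennreal m1 m2 k)+
  have meas': "f \<in> borel_measurable (lborel \<Otimes>\<^sub>M lborel)" if "f \<in> borel_measurable borel" for f :: "real \<times> real \<Rightarrow> ennreal"
    using that unfolding lborel_prod by simp
  have "(\<integral>\<^sup>+z. f1 z \<partial>lborel) = (\<integral>\<^sup>+t. \<integral>\<^sup>+s. f1 (s, t) \<partial>lborel \<partial>lborel)"
    unfolding lborel_prod[symmetric] by (rule lborel_pair.nn_integral_snd[symmetric]) (rule meas'[OF meas(1)])
  also have "\<dots> < \<infinity>"
    using half_cone_integral_finite[of b A B] ord nd b unfolding f1_def k_def by simp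
  finally have F1: "(\<integral>\<^sup>+z. f1 z \<partial>lborel) < \<infinity>" .
  have "(\<integral>\<^sup>+z. f2 z \<partial>lborel) = (\<integral>\<^sup>+s. \<integral>\<^sup>+t. f2 (s, t) \<partial>lborel \<partial>lborel)"
    unfolding lborel_prod[symmetric] by (rule lborel.nn_integral_fst[symmetric]) (rule meas'[OF meas(2)])
  also have "\<dots> < \<infinity>"
    using half_cone_integral_finite[of b B A] ord nd b unfolding f2_def k_def by (simp add: add.commute)
  finally have F2: "(\<integral>\<^sup>+z. f2 z \<partial>lborel) < \<infinity>" .
  define C where "C = enn2real ((\<integral>\<^sup>+z. f1 z \<partial>lborel) + (\<integral>\<^sup>+z. f2 z \<partial>lborel)) + 1"
  have C: "C > 0" "(\<integral>\<^sup>+z. f1 z \<partial>lborel) + (\<integral>\<^sup>+z. f2 z \<partial>lborel) \<le> ennreal C"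
  proof -
    have fin: "(\<integral>\<^sup>+z. f1 z \<partial>lborel) + (\<integral>\<^sup>+z. f2 z \<partial>lborel) < top" using F1 F2 by simp
    show "C > 0" by (simp add: C_def add_nonneg_pos)
    have "(\<integral>\<^sup>+z. f1 z \<partial>lborel) + (\<integral>\<^sup>+z. f2 z \<partial>lborel) = ennreal (enn2real ((\<integral>\<^sup>+z. f1 z \<partial>lborel) + (\<integral>\<^sup>+z. f2 z \<partial>lborel)))"
      by (rule ennreal_enn2real[OF fin, symmetric])
    also have "\<dots> \<le> ennreal C" unfolding C_def by (intro ennreal_leI) simp
    finally show "(\<integral>\<^sup>+z. f1 z \<partial>lborel) + (\<integral>\<^sup>+z. f2 z \<partial>lborel) \<le> ennreal C" .
  qed
  have "(\<integral>\<^sup>+\<tau>. indicator ({-1..1} \<times> {-1..1}) \<tau> * k (\<sigma> - \<tau>) \<partial>lborel) \<le> ennreal C"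
    if \<sigma>: "\<sigma> \<in> {-1..1} \<times> {-1..1}" for \<sigma>
  proof -
    have k_even: "k (- z) = k z" for z
    proof -
      have "fst (- z) *\<^sub>R A + snd (- z) *\<^sub>R B = (-1) *\<^sub>R (fst z *\<^sub>R A + snd z *\<^sub>R B)" by (simp add: algebra_simps)
      then have "?D (- z) = (-1) ^ CARD('n) * ?D z" by (simp only: det_scaleR_matrix)
      then show ?thesis by (simp add: k_def abs_mult)
    qed
    have "(\<integral>\<^sup>+\<tau>. indicator ({-1..1} \<times> {-1..1}) \<tau> * k (\<sigma> - \<tau>) \<partial>lborel)
       = (\<integral>\<^sup>+\<tau>. indicator ({-1..1} \<times> {-1..1}) (\<sigma> + \<tau>) * k (\<sigma> - (\<sigma> + \<tau>)) \<partial>lborel)"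
    proof (rule nn_integral_lborel_translate[symmetric])
      have "{-1..1} \<times> {-1..1} \<in> sets (borel :: (real \<times> real) measure)"
        by (intro borel_closed closed_Times) auto
      then show "(\<lambda>\<tau>. indicator ({-1..1} \<times> {-1..1}) \<tau> * k (\<sigma> - \<tau>)) \<in> borel_measurable borel"
        by (intro borel_measurable_times_ennreal borel_measurable_indicator
            measurable_borel_compose_continuous[OF k] continuous_intros)
    qed
    also have "\<dots> = (\<integral>\<^sup>+\<tau>. indicator ({-1..1} \<times> {-1..1}) (\<sigma> + \<tau>) * k \<tau> \<partial>lborel)"
      using k_even by simp
    also have "\<dots> \<le> (\<integral>\<^sup>+\<tau>. f1 \<tau> + f2 \<tau> \<partial>lborel)"
    proof (rule nn_integral_mono)
      fix \<tau> :: "real \<times> real"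
      show "indicator ({-1..1} \<times> {-1..1}) (\<sigma> + \<tau>) * k \<tau> \<le> f1 \<tau> + f2 \<tau>"
      proof (cases "\<sigma> + \<tau> \<in> {-1..1} \<times> {-1..1}")
        case True
        then have "\<bar>fst \<tau>\<bar> \<le> 2" "\<bar>snd \<tau>\<bar> \<le> 2" using \<sigma> by (auto simp: mem_Times_iff abs_le_iff)
        then have two: "fst \<tau> \<in> {-2..2}" "snd \<tau> \<in> {-2..2}" unfolding atLeastAtMost_iff by linarith+
        have "fst \<tau> \<in> {-\<bar>snd \<tau>\<bar>..\<bar>snd \<tau>\<bar>} \<or> snd \<tau> \<in> {-\<bar>fst \<tau>\<bar>..\<bar>fst \<tau>\<bar>}"
          unfolding atLeastAtMost_iff by linarith
        then have "f1 \<tau> = k \<tau> \<or> f2 \<tau> = k \<tau>"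
          using two unfolding f1_def f2_def by (elim disjE) (simp_all only: indicator_simps mult_1_left simp_thms)
        then show ?thesis using True by (auto simp: add_increasing add_increasing2)
      qed simp
    qed
    also have "\<dots> = (\<integral>\<^sup>+z. f1 z \<partial>lborel) + (\<integral>\<^sup>+z. f2 z \<partial>lborel)"
      using meas by (intro nn_integral_add) simp_all
    also have "\<dots> \<le> ennreal C" by (rule C(2))
    finally show ?thesis .
  qed
  then show ?thesis using C(1) unfolding k_def by blast
qed

section \<open>Averages of nonnegative functions over the planes\<close>

abbreviation param_square :: "(real \<times> real) set" where
  "param_square \<equiv> {-1..1} \<times> {-1..1}"

text \<open>The point over the parameter \<open>\<sigma>\<close> of the plane with parameters \<open>z = (x, \<xi>)\<close>.\<close>

definition plane_point :: "real^'n^'n \<Rightarrow> real^'n^'n \<Rightarrow> (real^'n) \<times> (real^'n) \<Rightarrow> real \<times> real \<Rightarrow> (real^'n) \<times> real \<times> real" where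
  "plane_point A B z \<sigma> = (fst z - fst \<sigma> *\<^sub>R (A *v snd z) - snd \<sigma> *\<^sub>R (B *v snd z), \<sigma>)"

text \<open>The plane transform of a nonnegative function. Values in the extended nonnegative reals make it defined everywhere
  and monotone.\<close>

definition plane_average :: "real^'n^'n \<Rightarrow> real^'n^'n \<Rightarrow> ((real^'n) \<times> real \<times> real \<Rightarrow> ennreal) \<Rightarrow> (real^'n) \<times> (real^'n) \<Rightarrow> ennreal" where
  "plane_average A B g z = (\<integral>\<^sup>+\<sigma>. indicator param_square \<sigma> * g (plane_point A B z \<sigma>) \<partial>lborel)"

lemma borel_measurable_lborel_pair:
  fixes f :: "'a::euclidean_space \<times> 'b::euclidean_space \<Rightarrow> ennreal"
  assumes "f \<in> borel_measurable borel"
  shows "f \<in> borel_measurable (lborel \<Otimes>\<^sub>M lborel)"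
  using assms unfolding lborel_prod by simp

lemma nn_integral_lborel_Times:
  fixes f :: "'a::euclidean_space \<times> 'b::euclidean_space \<Rightarrow> ennreal"
  assumes "f \<in> borel_measurable borel"
  shows "(\<integral>\<^sup>+z. f z \<partial>lborel) = (\<integral>\<^sup>+x. \<integral>\<^sup>+y. f (x, y) \<partial>lborel \<partial>lborel)"
    and "(\<integral>\<^sup>+z. f z \<partial>lborel) = (\<integral>\<^sup>+y. \<integral>\<^sup>+x. f (x, y) \<partial>lborel \<partial>lborel)"
proof -
  note f = borel_measurable_lborel_pair[OF assms]
  show "(\<integral>\<^sup>+z. f z \<partial>lborel) = (\<integral>\<^sup>+x. \<integral>\<^sup>+y. f (x, y) \<partial>lborel \<partial>lborel)"
    unfolding lborel_prod[symmetric] by (rule lborel.nn_integral_fst[OF f, symmetric])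
  show "(\<integral>\<^sup>+z. f z \<partial>lborel) = (\<integral>\<^sup>+y. \<integral>\<^sup>+x. f (x, y) \<partial>lborel \<partial>lborel)"
    unfolding lborel_prod[symmetric] by (rule lborel_pair.nn_integral_snd[OF f, symmetric])
qed

lemma nn_integral_lborel_swap_order:
  fixes f :: "'a::euclidean_space \<times> 'b::euclidean_space \<Rightarrow> ennreal"
  assumes "f \<in> borel_measurable borel"
  shows "(\<integral>\<^sup>+y. \<integral>\<^sup>+x. f (x, y) \<partial>lborel \<partial>lborel) = (\<integral>\<^sup>+x. \<integral>\<^sup>+y. f (x, y) \<partial>lborel \<partial>lborel)"
  using nn_integral_lborel_Times[OF assms] by simp

lemma borel_measurable_section_integral:
  fixes f :: "'a::euclidean_space \<times> 'b::euclidean_space \<Rightarrow> ennreal"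
  assumes "f \<in> borel_measurable borel"
  shows "(\<lambda>x. \<integral>\<^sup>+y. f (x, y) \<partial>lborel) \<in> borel_measurable borel"
    and "(\<lambda>y. \<integral>\<^sup>+x. f (x, y) \<partial>lborel) \<in> borel_measurable borel"
proof -
  note f = borel_measurable_lborel_pair[OF assms]
  show "(\<lambda>x. \<integral>\<^sup>+y. f (x, y) \<partial>lborel) \<in> borel_measurable borel"
    using lborel.borel_measurable_nn_integral_fst[OF f] by simp
  have "(\<lambda>w. f (snd w, fst w)) \<in> borel_measurable borel"
    by (rule measurable_compose[OF _ assms]) (intro borel_measurable_continuous_onI continuous_intros)
  from lborel.borel_measurable_nn_integral_fst[OF borel_measurable_lborel_pair[OF this]]
  show "(\<lambda>y. \<integral>\<^sup>+x. f (x, y) \<partial>lborel) \<in> borel_measurable borel" by simp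
qed

lemma continuous_on_plane_point:
  "continuous_on S (\<lambda>w. plane_point A B (fst w) (snd w))"
  unfolding plane_point_def
  by (intro continuous_intros bounded_linear.continuous_on[OF matrix_vector_mul_bounded_linear])

lemma measurable_plane_point:
  assumes "g \<in> borel_measurable borel"
  shows "(\<lambda>w. g (plane_point A B (fst w) (snd w))) \<in> borel_measurable borel"
  by (rule measurable_compose[OF _ assms]) (intro borel_measurable_continuous_onI continuous_on_plane_point)

lemma param_square_borel [measurable]: "param_square \<in> sets borel"
  by (intro borel_closed closed_Times) auto

lemma plane_integrand_measurable:
  assumes "g \<in> borel_measurable borel"
  shows "(\<lambda>w. indicator param_square (snd w) * g (plane_point A B (fst w) (snd w)) :: ennreal) \<in> borel_measurable borel"
proof -
  have "(\<lambda>w :: ((real^'a) \<times> (real^'a)) \<times> (real \<times> real). indicator param_square (snd w) :: ennreal) \<in> borel_measurable borel"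
    by (rule measurable_borel_compose_continuous[OF borel_measurable_indicator[OF param_square_borel]])
      (intro continuous_intros)
  then show ?thesis using measurable_plane_point[OF assms] by (rule borel_measurable_times_ennreal)
qed

lemma plane_average_measurable:
  assumes "g \<in> borel_measurable borel"
  shows "plane_average A B g \<in> borel_measurable borel"
  using borel_measurable_section_integral(1)[OF plane_integrand_measurable[OF assms, of A B]]
  unfolding plane_average_def by simp

text \<open>For fixed \<open>\<sigma>\<close> and \<open>\<tau>\<close>, the substitution from \<open>(x, \<xi>)\<close> to the two points of the plane over \<open>\<sigma>\<close> and \<open>\<tau>\<close> is a shear
  in \<open>x\<close> followed by the linear map \<open>(\<sigma> - \<tau>) \<cdot> (A, B)\<close> in \<open>\<xi>\<close>. Its Jacobian is the determinant on the left; if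
  it is zero there is nothing to prove.\<close>

lemma two_parameter_bound:
  fixes A B :: "real^'n^'n" and g1 g2 :: "real^'n \<Rightarrow> ennreal"
  assumes g: "g1 \<in> borel_measurable borel" "g2 \<in> borel_measurable borel"
  shows "ennreal \<bar>det (fst (\<sigma> - \<tau>) *\<^sub>R A + snd (\<sigma> - \<tau>) *\<^sub>R B)\<bar> *
      (\<integral>\<^sup>+z. g1 (fst (plane_point A B z \<sigma>)) * g2 (fst (plane_point A B z \<tau>)) \<partial>lborel)
    \<le> (\<integral>\<^sup>+x. g1 x \<partial>lborel) * (\<integral>\<^sup>+x. g2 x \<partial>lborel)"
proof (cases "det (fst (\<sigma> - \<tau>) *\<^sub>R A + snd (\<sigma> - \<tau>) *\<^sub>R B) = 0")
  case True
  then show ?thesis by simp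
next
  case False
  let ?N = "fst (\<sigma> - \<tau>) *\<^sub>R A + snd (\<sigma> - \<tau>) *\<^sub>R B"
  have c: "continuous_on UNIV (\<lambda>z. fst (plane_point A B z \<rho>))" for \<rho>
    unfolding plane_point_def
    by (simp, intro continuous_intros bounded_linear.continuous_on[OF matrix_vector_mul_bounded_linear])
  have N: "?N *v \<xi> = (fst \<sigma> *\<^sub>R (A *v \<xi>) + snd \<sigma> *\<^sub>R (B *v \<xi>)) - (fst \<tau> *\<^sub>R (A *v \<xi>) + snd \<tau> *\<^sub>R (B *v \<xi>))" for \<xi>
    by (simp add: matrix_vector_mult_add_rdistrib scaleR_matrix_vector_assoc[symmetric] algebra_simps)
  have "(\<integral>\<^sup>+z. g1 (fst (plane_point A B z \<sigma>)) * g2 (fst (plane_point A B z \<tau>)) \<partial>lborel)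
    = (\<integral>\<^sup>+\<xi>. \<integral>\<^sup>+x. g1 (fst (plane_point A B (x, \<xi>) \<sigma>)) * g2 (fst (plane_point A B (x, \<xi>) \<tau>)) \<partial>lborel \<partial>lborel)"
    by (intro nn_integral_lborel_Times(2) borel_measurable_times_ennreal measurable_borel_compose_continuous[OF g(1) c]
        measurable_borel_compose_continuous[OF g(2) c])
  also have "\<dots> = (\<integral>\<^sup>+\<xi>. \<integral>\<^sup>+x. g1 x * g2 (x + ?N *v \<xi>) \<partial>lborel \<partial>lborel)"
  proof (rule nn_integral_cong)
    fix \<xi> :: "real^'n"
    let ?a = "fst \<sigma> *\<^sub>R (A *v \<xi>) + snd \<sigma> *\<^sub>R (B *v \<xi>)"
    let ?h = "\<lambda>x. g1 (fst (plane_point A B (x, \<xi>) \<sigma>)) * g2 (fst (plane_point A B (x, \<xi>) \<tau>))"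
    have "?h \<in> borel_measurable borel"
      unfolding plane_point_def
      by (intro borel_measurable_times_ennreal measurable_borel_compose_continuous[OF g(1)]
          measurable_borel_compose_continuous[OF g(2)]) (simp_all, (intro continuous_intros)+)
    then have "(\<integral>\<^sup>+x. ?h x \<partial>lborel) = (\<integral>\<^sup>+x. ?h (?a + x) \<partial>lborel)"
      by (rule nn_integral_lborel_translate[symmetric])
    also have "\<dots> = (\<integral>\<^sup>+x. g1 x * g2 (x + ?N *v \<xi>) \<partial>lborel)"
      unfolding N by (intro nn_integral_cong) (simp add: plane_point_def algebra_simps)
    finally show "(\<integral>\<^sup>+x. ?h x \<partial>lborel) = (\<integral>\<^sup>+x. g1 x * g2 (x + ?N *v \<xi>) \<partial>lborel)" .
  qed
  also have "\<dots> = (\<integral>\<^sup>+x. \<integral>\<^sup>+\<xi>. g1 x * g2 (x + ?N *v \<xi>) \<partial>lborel \<partial>lborel)"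
  proof -
    have "(\<lambda>w. g1 (fst w) * g2 (fst w + ?N *v snd w)) \<in> borel_measurable borel"
      by (intro borel_measurable_times_ennreal measurable_borel_compose_continuous[OF g(1)]
          measurable_borel_compose_continuous[OF g(2)] continuous_intros
          bounded_linear.continuous_on[OF matrix_vector_mul_bounded_linear])
    from nn_integral_lborel_swap_order[OF this] show ?thesis by simp
  qed
  also have "\<dots> = (\<integral>\<^sup>+x. g1 x * (\<integral>\<^sup>+\<xi>. g2 (x + ?N *v \<xi>) \<partial>lborel) \<partial>lborel)"
    by (intro nn_integral_cong nn_integral_cmult measurable_compose[OF _ g(2)]) (auto intro!: borel_measurable_continuous_onI continuous_intros bounded_linear.continuous_on[OF matrix_vector_mul_bounded_linear])
  finally have eq: "(\<integral>\<^sup>+z. g1 (fst (plane_point A B z \<sigma>)) * g2 (fst (plane_point A B z \<tau>)) \<partial>lborel)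
    = (\<integral>\<^sup>+x. g1 x * (\<integral>\<^sup>+\<xi>. g2 (x + ?N *v \<xi>) \<partial>lborel) \<partial>lborel)" .
  have cov: "ennreal \<bar>det ?N\<bar> * (\<integral>\<^sup>+\<xi>. g2 (x + ?N *v \<xi>) \<partial>lborel) = (\<integral>\<^sup>+x. g2 x \<partial>lborel)" for x
  proof -
    have "ennreal \<bar>det ?N\<bar> * (\<integral>\<^sup>+\<xi>. g2 (x + ?N *v \<xi>) \<partial>lborel) = (\<integral>\<^sup>+\<xi>. g2 (x + \<xi>) \<partial>lborel)"
      by (rule nn_integral_lborel_matrix[OF False, of "\<lambda>y. g2 (x + y)"])
        (rule measurable_borel_compose_continuous[OF g(2)], intro continuous_intros)
    then show ?thesis using nn_integral_lborel_translate[OF g(2)] by simp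
  qed
  have m: "(\<lambda>x. g1 x * (\<integral>\<^sup>+\<xi>. g2 (x + ?N *v \<xi>) \<partial>lborel)) \<in> borel_measurable lborel"
  proof -
    have "(\<lambda>w. g2 (fst w + ?N *v snd w)) \<in> borel_measurable borel"
      by (intro measurable_borel_compose_continuous[OF g(2)] continuous_intros
          bounded_linear.continuous_on[OF matrix_vector_mul_bounded_linear])
    from borel_measurable_section_integral(1)[OF this] g(1) show ?thesis by simp
  qed
  have "ennreal \<bar>det ?N\<bar> * (\<integral>\<^sup>+x. g1 x * (\<integral>\<^sup>+\<xi>. g2 (x + ?N *v \<xi>) \<partial>lborel) \<partial>lborel)
     = (\<integral>\<^sup>+x. ennreal \<bar>det ?N\<bar> * (g1 x * (\<integral>\<^sup>+\<xi>. g2 (x + ?N *v \<xi>) \<partial>lborel)) \<partial>lborel)"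
    by (rule nn_integral_cmult[symmetric]) (rule m)
  also have "\<dots> = (\<integral>\<^sup>+x. g1 x * (\<integral>\<^sup>+x. g2 x \<partial>lborel) \<partial>lborel)"
  proof (rule nn_integral_cong)
    fix x
    show "ennreal \<bar>det ?N\<bar> * (g1 x * (\<integral>\<^sup>+\<xi>. g2 (x + ?N *v \<xi>) \<partial>lborel)) = g1 x * (\<integral>\<^sup>+x. g2 x \<partial>lborel)"
      unfolding cov[of x, symmetric] by (rule mult.left_commute)
  qed
  also have "\<dots> = (\<integral>\<^sup>+x. g1 x \<partial>lborel) * (\<integral>\<^sup>+x. g2 x \<partial>lborel)"
    by (rule nn_integral_multc) (use g in simp)
  finally show ?thesis unfolding eq by simp
qed

text \<open>For fixed \<open>\<xi>\<close> and \<open>\<sigma>\<close>, integration in \<open>x\<close> sees a mere translation of the slice of \<open>g\<close> over \<open>\<sigma>\<close>.\<close>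

lemma nn_integral_plane_average_le:
  fixes A B :: "real^'n^'n"
  assumes g: "g \<in> borel_measurable borel" and X: "X \<in> sets borel"
  shows "(\<integral>\<^sup>+z. indicator X (snd z) * plane_average A B g z \<partial>lborel) \<le> emeasure lborel X * (\<integral>\<^sup>+w. g w \<partial>lborel)"
proof -
  let ?f = "\<lambda>w. indicator X (snd (fst w)) * (indicator param_square (snd w) * g (plane_point A B (fst w) (snd w)))"
  have indX: "(\<lambda>w :: ((real^'n) \<times> (real^'n)) \<times> (real \<times> real). indicator X (snd (fst w)) :: ennreal) \<in> borel_measurable borel"
    by (rule measurable_borel_compose_continuous[OF borel_measurable_indicator[OF X]]) (intro continuous_intros)
  have f: "?f \<in> borel_measurable borel"
    by (intro borel_measurable_times_ennreal[OF indX] plane_integrand_measurable g)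
  have gs: "(\<lambda>x. g (x, \<sigma>)) \<in> borel_measurable borel" for \<sigma>
    by (rule measurable_borel_compose_continuous[OF g]) (intro continuous_intros)
  have "(\<integral>\<^sup>+z. indicator X (snd z) * plane_average A B g z \<partial>lborel) = (\<integral>\<^sup>+z. \<integral>\<^sup>+\<sigma>. ?f (z, \<sigma>) \<partial>lborel \<partial>lborel)"
  proof (rule nn_integral_cong)
    fix z
    have "(\<lambda>\<sigma>. indicator param_square \<sigma> * g (plane_point A B z \<sigma>)) \<in> borel_measurable lborel"
      using measurable_borel_compose_continuous[OF plane_integrand_measurable[OF g, of A B], of "\<lambda>\<sigma>. (z, \<sigma>)"]
      by (simp add: continuous_intros)
    then show "indicator X (snd z) * plane_average A B g z = (\<integral>\<^sup>+\<sigma>. ?f (z, \<sigma>) \<partial>lborel)"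
      unfolding plane_average_def by (simp add: nn_integral_cmult)
  qed
  also have "\<dots> = (\<integral>\<^sup>+\<sigma>. \<integral>\<^sup>+z. ?f (z, \<sigma>) \<partial>lborel \<partial>lborel)"
    using nn_integral_lborel_swap_order[OF f] by simp
  also have "\<dots> \<le> (\<integral>\<^sup>+\<sigma>. emeasure lborel X * (\<integral>\<^sup>+x. g (x, \<sigma>) \<partial>lborel) \<partial>lborel)"
  proof (rule nn_integral_mono)
    fix \<sigma> :: "real \<times> real"
    have fs: "(\<lambda>z. ?f (z, \<sigma>)) \<in> borel_measurable borel"
      by (rule measurable_borel_compose_continuous[OF f]) (intro continuous_intros)
    have "(\<integral>\<^sup>+z. ?f (z, \<sigma>) \<partial>lborel) = (\<integral>\<^sup>+\<xi>. \<integral>\<^sup>+x. ?f ((x, \<xi>), \<sigma>) \<partial>lborel \<partial>lborel)"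
      by (rule nn_integral_lborel_Times(2)[OF fs])
    also have "\<dots> \<le> (\<integral>\<^sup>+\<xi>. (\<integral>\<^sup>+x. g (x, \<sigma>) \<partial>lborel) * indicator X \<xi> \<partial>lborel)"
    proof (rule nn_integral_mono)
      fix \<xi> :: "real^'n"
      let ?a = "fst \<sigma> *\<^sub>R (A *v \<xi>) + snd \<sigma> *\<^sub>R (B *v \<xi>)"
      have "(\<integral>\<^sup>+x. ?f ((x, \<xi>), \<sigma>) \<partial>lborel) \<le> (\<integral>\<^sup>+x. g (- ?a + x, \<sigma>) * indicator X \<xi> \<partial>lborel)"
        by (intro nn_integral_mono) (auto simp: plane_point_def indicator_def algebra_simps)
      also have "\<dots> = (\<integral>\<^sup>+x. g (- ?a + x, \<sigma>) \<partial>lborel) * indicator X \<xi>"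
        by (rule nn_integral_multc) (simp, rule measurable_borel_compose_continuous[OF g], intro continuous_intros)
      also have "(\<integral>\<^sup>+x. g (- ?a + x, \<sigma>) \<partial>lborel) = (\<integral>\<^sup>+x. g (x, \<sigma>) \<partial>lborel)"
        by (rule nn_integral_lborel_translate[OF gs])
      finally show "(\<integral>\<^sup>+x. ?f ((x, \<xi>), \<sigma>) \<partial>lborel) \<le> (\<integral>\<^sup>+x. g (x, \<sigma>) \<partial>lborel) * indicator X \<xi>" .
    qed
    also have "\<dots> = emeasure lborel X * (\<integral>\<^sup>+x. g (x, \<sigma>) \<partial>lborel)"
      using X by (subst nn_integral_cmult_indicator) (auto intro: mult.commute)
    finally show "(\<integral>\<^sup>+z. ?f (z, \<sigma>) \<partial>lborel) \<le> emeasure lborel X * (\<integral>\<^sup>+x. g (x, \<sigma>) \<partial>lborel)" .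
  qed
  also have "\<dots> = emeasure lborel X * (\<integral>\<^sup>+\<sigma>. \<integral>\<^sup>+x. g (x, \<sigma>) \<partial>lborel \<partial>lborel)"
    by (rule nn_integral_cmult) (use borel_measurable_section_integral(2)[OF g] in simp)
  also have "(\<integral>\<^sup>+\<sigma>. \<integral>\<^sup>+x. g (x, \<sigma>) \<partial>lborel \<partial>lborel) = (\<integral>\<^sup>+w. g w \<partial>lborel)"
    by (rule nn_integral_lborel_Times(2)[OF g, symmetric])
  finally show ?thesis .
qed

section \<open>The restricted estimate\<close>

lemma plane_section_measurable:
  assumes g: "g \<in> borel_measurable borel"
  shows "(\<lambda>\<sigma>. indicator param_square \<sigma> * g (plane_point A B z \<sigma>) :: ennreal) \<in> borel_measurable borel"
  using measurable_borel_compose_continuous[OF plane_integrand_measurable[OF g, of A B], of "\<lambda>\<sigma>. (z, \<sigma>)"]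
  by (simp add: continuous_intros)

definition pencil_det :: "real^'n^'n \<Rightarrow> real^'n^'n \<Rightarrow> real \<times> real \<Rightarrow> real" where
  "pencil_det A B \<rho> = det (fst \<rho> *\<^sub>R A + snd \<rho> *\<^sub>R B)"

lemma continuous_on_pencil_det:
  assumes "continuous_on S h"
  shows "continuous_on S (\<lambda>x. pencil_det A B (h x))"
  using continuous_on_compose2[OF continuous_on_det_pencil[of UNIV A B] assms]
  by (simp add: pencil_det_def)

text \<open>The two-parameter bound, integrated over both parameters.\<close>

lemma bilinear_plane_bound:
  fixes A B :: "real^'n^'n"
  assumes g: "g \<in> borel_measurable borel"
  shows "(\<integral>\<^sup>+z. (\<integral>\<^sup>+\<sigma>. indicator param_square \<sigma> * g (plane_point A B z \<sigma>) *
            (\<integral>\<^sup>+\<tau>. indicator param_square \<tau> * g (plane_point A B z \<tau>) * ennreal \<bar>pencil_det A B (\<sigma> - \<tau>)\<bar> \<partial>lborel) \<partial>lborel) \<partial>lborel)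
     \<le> (\<integral>\<^sup>+w. g w \<partial>lborel) * (\<integral>\<^sup>+w. g w \<partial>lborel)"
proof -
  let ?h = "\<lambda>z \<sigma>. indicator param_square \<sigma> * g (plane_point A B z \<sigma>)"
  let ?k = "\<lambda>\<sigma> \<tau>. ennreal \<bar>pencil_det A B (\<sigma> - \<tau>)\<bar>"
  define e where "e \<sigma> = (\<integral>\<^sup>+x. g (x, \<sigma>) \<partial>lborel)" for \<sigma>
  have e: "e \<in> borel_measurable borel"
    unfolding e_def[abs_def] by (rule borel_measurable_section_integral(2)[OF g])
  have eint: "(\<integral>\<^sup>+\<sigma>. e \<sigma> \<partial>lborel) = (\<integral>\<^sup>+w. g w \<partial>lborel)"
    unfolding e_def by (rule nn_integral_lborel_Times(2)[OF g, symmetric])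
  have hm: "(\<lambda>w. ?h (fst w) (snd w)) \<in> borel_measurable borel"
    by (rule plane_integrand_measurable[OF g])
  have kr: "(\<lambda>x. ennreal \<bar>x\<bar>) \<in> borel_measurable (borel :: real measure)" by measurable
  have km: "(\<lambda>x. ?k (a x) (b x)) \<in> borel_measurable borel" if "continuous_on UNIV a" "continuous_on UNIV b"
    for a b :: "'c::euclidean_space \<Rightarrow> real \<times> real"
    by (rule measurable_borel_compose_continuous[OF kr]) (intro continuous_on_pencil_det continuous_intros that)
  have h1: "(\<lambda>w :: ((((real^'n) \<times> (real^'n)) \<times> real \<times> real) \<times> real \<times> real). ?h (fst (fst w)) (snd (fst w))) \<in> borel_measurable borel"
    using measurable_borel_compose_continuous[OF hm, of fst] by (simp add: continuous_intros continuous_on_fst)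
  have h2: "(\<lambda>w :: ((((real^'n) \<times> (real^'n)) \<times> real \<times> real) \<times> real \<times> real). ?h (fst (fst w)) (snd w)) \<in> borel_measurable borel"
    using measurable_borel_compose_continuous[OF hm, of "\<lambda>w. (fst (fst w), snd w)"] by (simp add: continuous_intros)
  have k1: "(\<lambda>w :: ((((real^'n) \<times> (real^'n)) \<times> real \<times> real) \<times> real \<times> real). ?k (snd (fst w)) (snd w)) \<in> borel_measurable borel"
    by (intro km continuous_intros)
  note F = borel_measurable_times_ennreal[OF h1 borel_measurable_times_ennreal[OF h2 k1]]
  have "(\<integral>\<^sup>+z. (\<integral>\<^sup>+\<sigma>. ?h z \<sigma> * (\<integral>\<^sup>+\<tau>. ?h z \<tau> * ?k \<sigma> \<tau> \<partial>lborel) \<partial>lborel) \<partial>lborel)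
     = (\<integral>\<^sup>+z. (\<integral>\<^sup>+\<sigma>. (\<integral>\<^sup>+\<tau>. ?h z \<sigma> * (?h z \<tau> * ?k \<sigma> \<tau>) \<partial>lborel) \<partial>lborel) \<partial>lborel)"
  proof (intro nn_integral_cong)
    fix z \<sigma>
    have "(\<lambda>\<tau>. ?h z \<tau> * ?k \<sigma> \<tau>) \<in> borel_measurable borel"
      by (intro borel_measurable_times_ennreal[OF plane_section_measurable[OF g] km] continuous_intros)
    then show "?h z \<sigma> * (\<integral>\<^sup>+\<tau>. ?h z \<tau> * ?k \<sigma> \<tau> \<partial>lborel) = (\<integral>\<^sup>+\<tau>. ?h z \<sigma> * (?h z \<tau> * ?k \<sigma> \<tau>) \<partial>lborel)"
      by (subst nn_integral_cmult) auto
  qed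
  also have "\<dots> = (\<integral>\<^sup>+\<sigma>. (\<integral>\<^sup>+z. (\<integral>\<^sup>+\<tau>. ?h z \<sigma> * (?h z \<tau> * ?k \<sigma> \<tau>) \<partial>lborel) \<partial>lborel) \<partial>lborel)"
    using nn_integral_lborel_swap_order[OF borel_measurable_section_integral(1)[OF F]] by simp
  also have "\<dots> = (\<integral>\<^sup>+\<sigma>. (\<integral>\<^sup>+\<tau>. (\<integral>\<^sup>+z. ?h z \<sigma> * (?h z \<tau> * ?k \<sigma> \<tau>) \<partial>lborel) \<partial>lborel) \<partial>lborel)"
  proof (rule nn_integral_cong)
    fix \<sigma> :: "real \<times> real"
    have "(\<lambda>w :: ((real^'n) \<times> (real^'n)) \<times> (real \<times> real). ?h (fst w) \<sigma> * (?h (fst w) (snd w) * ?k \<sigma> (snd w))) \<in> borel_measurable borel"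
      using measurable_borel_compose_continuous[OF F, of "\<lambda>w. ((fst w, \<sigma>), snd w)"] by (simp add: continuous_intros)
    from nn_integral_lborel_swap_order[OF this]
    show "(\<integral>\<^sup>+z. (\<integral>\<^sup>+\<tau>. ?h z \<sigma> * (?h z \<tau> * ?k \<sigma> \<tau>) \<partial>lborel) \<partial>lborel)
      = (\<integral>\<^sup>+\<tau>. (\<integral>\<^sup>+z. ?h z \<sigma> * (?h z \<tau> * ?k \<sigma> \<tau>) \<partial>lborel) \<partial>lborel)" by simp
  qed
  also have "\<dots> \<le> (\<integral>\<^sup>+\<sigma>. (\<integral>\<^sup>+\<tau>. e \<sigma> * e \<tau> \<partial>lborel) \<partial>lborel)"
  proof (intro nn_integral_mono)
    fix \<sigma> \<tau> :: "real \<times> real"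
    have gs: "(\<lambda>x. g (x, \<rho>)) \<in> borel_measurable borel" for \<rho>
      by (rule measurable_borel_compose_continuous[OF g]) (intro continuous_intros)
    have pt: "(fst (plane_point A B z \<rho>), \<rho>) = plane_point A B z \<rho>" for z \<rho> by (simp add: plane_point_def)
    have m: "(\<lambda>z. g (plane_point A B z \<rho>)) \<in> borel_measurable borel" for \<rho>
      using measurable_borel_compose_continuous[OF measurable_plane_point[OF g, of A B], of "\<lambda>z. (z, \<rho>)"]
      by (simp add: continuous_intros)
    have "(\<integral>\<^sup>+z. ?h z \<sigma> * (?h z \<tau> * ?k \<sigma> \<tau>) \<partial>lborel)
      \<le> (\<integral>\<^sup>+z. ?k \<sigma> \<tau> * (g (plane_point A B z \<sigma>) * g (plane_point A B z \<tau>)) \<partial>lborel)"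
      by (intro nn_integral_mono) (auto simp: indicator_def mult_ac)
    also have "\<dots> = ?k \<sigma> \<tau> * (\<integral>\<^sup>+z. g (plane_point A B z \<sigma>) * g (plane_point A B z \<tau>) \<partial>lborel)"
      by (rule nn_integral_cmult) (simp, intro borel_measurable_times_ennreal m)
    also have "\<dots> \<le> e \<sigma> * e \<tau>"
      using two_parameter_bound[OF gs[of \<sigma>] gs[of \<tau>], of \<sigma> \<tau> A B] unfolding pt e_def pencil_det_def by simp
    finally show "(\<integral>\<^sup>+z. ?h z \<sigma> * (?h z \<tau> * ?k \<sigma> \<tau>) \<partial>lborel) \<le> e \<sigma> * e \<tau>" .
  qed
  also have "\<dots> = (\<integral>\<^sup>+w. g w \<partial>lborel) * (\<integral>\<^sup>+w. g w \<partial>lborel)"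
    using e by (simp add: nn_integral_cmult nn_integral_multc eint)
  finally show ?thesis .
qed

lemma plane_average_indicator_le:
  "plane_average A B (indicator E) z \<le> 4"
proof -
  have "plane_average A B (indicator E) z \<le> (\<integral>\<^sup>+\<sigma>. indicator param_square \<sigma> \<partial>lborel)"
    unfolding plane_average_def by (intro nn_integral_mono) (auto simp: indicator_def)
  also have "\<dots> = emeasure lborel param_square" by (rule nn_integral_indicator) simp
  also have "\<dots> = emeasure lborel {-1..1::real} * emeasure lborel {-1..1::real}"
    unfolding lborel_prod[symmetric] by (rule lborel.emeasure_pair_measure_Times) auto
  also have "\<dots> = 4" by (simp add: ennreal_mult[symmetric])
  finally show ?thesis .
qed

text \<open>The hypothesis balances the loss from parameters with determinant at most \<open>\<kappa>\<close> against the gain from the others; a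
  suitable \<open>\<kappa>\<close> makes the loss half of \<open>m\<close>.\<close>

lemma sublevel_optimisation:
  fixes m x C0 b :: real
  assumes "0 < m" "0 \<le> x" "0 < C0" "0 < b"
    and le: "\<And>\<kappa>. 0 < \<kappa> \<Longrightarrow> m \<le> \<kappa> powr b * C0 + x / \<kappa>"
  shows "m powr (1 + 1 / b) \<le> 2 * (2 * C0) powr (1 / b) * x"
proof -
  define \<kappa> where "\<kappa> = (m / (2 * C0)) powr (1 / b)"
  have \<kappa>: "\<kappa> > 0" using assms by (simp add: \<kappa>_def)
  have "\<kappa> powr b = m / (2 * C0)" using assms by (simp add: \<kappa>_def powr_powr)
  then have "m \<le> m / 2 + x / \<kappa>" using le[OF \<kappa>] assms by simp
  then have "m * \<kappa> \<le> 2 * x" using \<kappa> by (simp add: field_simps)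
  moreover have "m powr (1 / b) = (2 * C0) powr (1 / b) * \<kappa>"
    using assms unfolding \<kappa>_def by (subst powr_mult[symmetric]) auto
  ultimately have "(2 * C0) powr (1 / b) * (m * \<kappa>) \<le> (2 * C0) powr (1 / b) * (2 * x)"
    by (intro mult_left_mono) auto
  moreover have "m powr (1 + 1 / b) = m * m powr (1 / b)" using assms by (simp add: powr_add)
  ultimately show ?thesis using \<open>m powr (1 / b) = (2 * C0) powr (1 / b) * \<kappa>\<close> by (simp add: mult_ac)
qed

text \<open>Removing the weight. Of the parameters \<open>\<tau>\<close> for which the point of the plane lies in \<open>E\<close>, those with
  determinant at most \<open>\<kappa>\<close> have measure at most \<open>\<kappa>^b C0\<close> by the integrability hypothesis, and on the others the weight is
  at least \<open>\<kappa>\<close>. Optimising in \<open>\<kappa>\<close> bounds a power of the average by the weighted integral.\<close>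

lemma plane_average_power_le:
  fixes A B :: "real^'n^'n"
  assumes E: "E \<in> sets borel" and b: "0 < b" and C0: "0 < C0" and \<sigma>: "\<sigma> \<in> param_square"
    and int: "(\<integral>\<^sup>+\<tau>. indicator param_square \<tau> * inverse (ennreal (\<bar>pencil_det A B (\<sigma> - \<tau>)\<bar> powr b)) \<partial>lborel) \<le> ennreal C0"
  shows "ennreal (enn2real (plane_average A B (indicator E) z) powr (1 + 1 / b))
     \<le> ennreal (2 * (2 * C0) powr (1 / b)) *
        (\<integral>\<^sup>+\<tau>. indicator param_square \<tau> * indicator E (plane_point A B z \<tau>) * ennreal \<bar>pencil_det A B (\<sigma> - \<tau>)\<bar> \<partial>lborel)"
    (is "_ \<le> ennreal ?c * ?X")
proof -
  let ?G = "plane_average A B (indicator E) z"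
  let ?D = "\<lambda>\<tau>. \<bar>pencil_det A B (\<sigma> - \<tau>)\<bar>"
  have Dm [measurable]: "(\<lambda>\<tau>. pencil_det A B (\<sigma> - \<tau>)) \<in> borel_measurable borel"
    by (intro borel_measurable_continuous_onI continuous_on_pencil_det continuous_intros)
  have Em: "(indicator E :: _ \<Rightarrow> ennreal) \<in> borel_measurable borel" using E by (rule borel_measurable_indicator)
  note hm [measurable] = plane_section_measurable[OF Em, of A B z]
  have sqm: "(indicator param_square :: _ \<Rightarrow> ennreal) \<in> borel_measurable borel"
    by (rule borel_measurable_indicator) simp
  have c: "?c > 0" using C0 by simp
  define m where "m = enn2real ?G"
  have G4: "?G \<le> 4" by (rule plane_average_indicator_le)
  then have Gm: "?G = ennreal m" unfolding m_def
    by (subst ennreal_enn2real) (auto simp: less_top[symmetric] top_unique intro: le_less_trans)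
  show ?thesis
  proof (cases "?X = top \<or> m = 0")
    case True
    then show ?thesis
    proof
      assume "?X = top"
      then have "ennreal ?c * ?X = top" using c by (simp add: ennreal_mult_top)
      then show ?thesis by simp
    next
      assume "m = 0"
      then show ?thesis by (simp add: m_def[symmetric])
    qed
  next
    case False
    then obtain x where x: "?X = ennreal x" "0 \<le> x" by (cases ?X) auto
    have m: "m > 0" using False by (simp add: m_def less_le)
    have key: "m \<le> \<kappa> powr b * C0 + x / \<kappa>" if \<kappa>: "\<kappa> > 0" for \<kappa>
    proof -
      have "ennreal m = (\<integral>\<^sup>+\<tau>. indicator param_square \<tau> * indicator E (plane_point A B z \<tau>) \<partial>lborel)"
        unfolding Gm[symmetric] plane_average_def ..
      also have "\<dots> \<le> (\<integral>\<^sup>+\<tau>. ennreal (\<kappa> powr b) * (indicator param_square \<tau> * inverse (ennreal (?D \<tau> powr b)))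
          + ennreal (1 / \<kappa>) * (indicator param_square \<tau> * indicator E (plane_point A B z \<tau>) * ennreal (?D \<tau>)) \<partial>lborel)"
      proof (rule nn_integral_mono)
        fix \<tau> :: "real \<times> real"
        show "indicator param_square \<tau> * indicator E (plane_point A B z \<tau>) \<le>
           ennreal (\<kappa> powr b) * (indicator param_square \<tau> * inverse (ennreal (?D \<tau> powr b)))
          + ennreal (1 / \<kappa>) * (indicator param_square \<tau> * indicator E (plane_point A B z \<tau>) * ennreal (?D \<tau>))"
        proof (cases "\<tau> \<in> param_square \<and> plane_point A B z \<tau> \<in> E")
          case True
          have "1 \<le> ennreal (\<kappa> powr b) * inverse (ennreal (?D \<tau> powr b)) + ennreal (1 / \<kappa>) * ennreal (?D \<tau>)"
          (* Either the first summand is at least 1, with the inverse of zero equal to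
             \<infinity>, or the second one is. *)
          proof (cases "?D \<tau> \<le> \<kappa>")
            case True
            have "1 \<le> ennreal (\<kappa> powr b) * inverse (ennreal (?D \<tau> powr b))"
            proof (cases "?D \<tau> = 0")
              case True
              then show ?thesis using \<kappa> by (simp add: ennreal_mult_top)
            next
              case False
              then have "?D \<tau> powr b \<le> \<kappa> powr b" "?D \<tau> powr b > 0" using \<open>?D \<tau> \<le> \<kappa>\<close> b by (auto intro!: powr_mono2)
              then show ?thesis by (simp add: inverse_ennreal ennreal_mult[symmetric] divide_inverse[symmetric])
            qed
            then show ?thesis by (rule order_trans) simp
          next
            case False
            then have "1 \<le> 1 / \<kappa> * ?D \<tau>" using \<kappa> by (simp add: field_simps)
            then have "1 \<le> ennreal (1 / \<kappa>) * ennreal (?D \<tau>)" using \<kappa> by (simp add: ennreal_mult[symmetric])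
            then show ?thesis by (rule order_trans) simp
          qed
          then show ?thesis using True by simp
        qed (auto simp: indicator_def)
      qed
      also have "\<dots> = ennreal (\<kappa> powr b) * (\<integral>\<^sup>+\<tau>. indicator param_square \<tau> * inverse (ennreal (?D \<tau> powr b)) \<partial>lborel)
          + ennreal (1 / \<kappa>) * ?X"
      proof -
        have m1: "(\<lambda>\<tau>. indicator param_square \<tau> * inverse (ennreal (?D \<tau> powr b))) \<in> borel_measurable lborel"
        proof -
          have "(\<lambda>\<tau>. inverse (ennreal (?D \<tau> powr b))) \<in> borel_measurable borel" by measurable
          from borel_measurable_times_ennreal[OF sqm this] show ?thesis by simp
        qed
        have m2: "(\<lambda>\<tau>. indicator param_square \<tau> * indicator E (plane_point A B z \<tau>) * ennreal (?D \<tau>)) \<in> borel_measurable lborel"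
        proof -
          have "(\<lambda>\<tau>. ennreal (?D \<tau>)) \<in> borel_measurable borel" by measurable
          from borel_measurable_times_ennreal[OF hm this] show ?thesis by simp
        qed
        show ?thesis using m1 m2 by (simp add: nn_integral_add nn_integral_cmult)
      qed
      also have "\<dots> \<le> ennreal (\<kappa> powr b) * ennreal C0 + ennreal (1 / \<kappa>) * ennreal x"
        unfolding x using int by (intro add_mono mult_left_mono) auto
      also have "\<dots> = ennreal (\<kappa> powr b * C0 + x / \<kappa>)"
        using \<kappa> C0 x by (simp add: ennreal_mult[symmetric] ennreal_plus[symmetric] del: ennreal_plus)
      finally show ?thesis using \<kappa> C0 x by (subst (asm) ennreal_le_iff) auto
    qed
    have "m powr (1 + 1 / b) \<le> ?c * x"
      using sublevel_optimisation[OF m x(2) C0 b key] .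
    then show ?thesis
      unfolding x(1) m_def[symmetric] using c x by (simp add: ennreal_mult[symmetric] ennreal_leI)
  qed
qed

text \<open>One factor of the power is the average over \<open>\<sigma>\<close>, and the remaining ones are replaced by the weighted integral
  over \<open>\<tau>\<close>, for each \<open>\<sigma>\<close> separately. The result is the bilinear form with weight \<open>\<bar>D (\<sigma> - \<tau>)\<bar>\<close>.\<close>

lemma restricted_plane_estimate:
  fixes A B :: "real^'n^'n"
  assumes E: "E \<in> sets borel" and b: "0 < b" and C0: "0 < C0"
    and int: "\<And>\<sigma>. \<sigma> \<in> param_square \<Longrightarrow>
       (\<integral>\<^sup>+\<tau>. indicator param_square \<tau> * inverse (ennreal (\<bar>pencil_det A B (\<sigma> - \<tau>)\<bar> powr b)) \<partial>lborel) \<le> ennreal C0"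
  shows "(\<integral>\<^sup>+z. ennreal (enn2real (plane_average A B (indicator E) z) powr (2 + 1 / b)) \<partial>lborel)
     \<le> ennreal (2 * (2 * C0) powr (1 / b)) * (emeasure lborel E * emeasure lborel E)"
proof -
  let ?G = "plane_average A B (indicator E)" and ?c = "ennreal (2 * (2 * C0) powr (1 / b))"
  let ?h = "\<lambda>z \<sigma>. indicator param_square \<sigma> * indicator E (plane_point A B z \<sigma>) :: ennreal"
  let ?X = "\<lambda>z \<sigma>. \<integral>\<^sup>+\<tau>. ?h z \<tau> * ennreal \<bar>pencil_det A B (\<sigma> - \<tau>)\<bar> \<partial>lborel"
  have Em: "(indicator E :: _ \<Rightarrow> ennreal) \<in> borel_measurable borel" using E by (rule borel_measurable_indicator)
  have kr: "(\<lambda>x. ennreal \<bar>x\<bar>) \<in> borel_measurable (borel :: real measure)" by measurable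
  have hm: "(\<lambda>w. ?h (fst w) (snd w)) \<in> borel_measurable borel"
    by (rule plane_integrand_measurable[OF Em])
  have h2: "(\<lambda>w :: ((((real^'n) \<times> (real^'n)) \<times> real \<times> real) \<times> real \<times> real). ?h (fst (fst w)) (snd w)) \<in> borel_measurable borel"
    using measurable_borel_compose_continuous[OF hm, of "\<lambda>w. (fst (fst w), snd w)"] by (simp add: continuous_intros)
  have k1: "(\<lambda>w :: ((((real^'n) \<times> (real^'n)) \<times> real \<times> real) \<times> real \<times> real). ennreal \<bar>pencil_det A B (snd (fst w) - snd w)\<bar>) \<in> borel_measurable borel"
    by (rule measurable_borel_compose_continuous[OF kr]) (intro continuous_on_pencil_det continuous_intros)
  note F = borel_measurable_times_ennreal[OF h2 k1]
  have Xm: "(\<lambda>w. ?h (fst w) (snd w) * ?X (fst w) (snd w)) \<in> borel_measurable borel"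
    using borel_measurable_times_ennreal[OF hm] borel_measurable_section_integral(1)[OF F] by simp
  have "(\<integral>\<^sup>+z. ennreal (enn2real (?G z) powr (2 + 1 / b)) \<partial>lborel) \<le> (\<integral>\<^sup>+z. ?c * (\<integral>\<^sup>+\<sigma>. ?h z \<sigma> * ?X z \<sigma> \<partial>lborel) \<partial>lborel)"
  proof (rule nn_integral_mono)
    fix z
    define m where "m = enn2real (?G z)"
    have Gm: "?G z = ennreal m" unfolding m_def using plane_average_indicator_le[of A B E z]
      by (subst ennreal_enn2real) (auto simp: less_top[symmetric] top_unique intro: le_less_trans)
    have zm: "(\<lambda>\<sigma>. ?h z \<sigma> * ?X z \<sigma>) \<in> borel_measurable lborel"
      using measurable_borel_compose_continuous[OF Xm, of "\<lambda>\<sigma>. (z, \<sigma>)"] by (simp add: continuous_intros)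
    (* The factor m becomes the integral over \<sigma>, the other one that over \<tau>. *)
    have "m powr (2 + 1 / b) = m * m powr (1 + 1 / b)"
    proof (cases "m = 0")
      case False
      then have "m > 0" by (simp add: m_def less_le)
      then show ?thesis by (simp add: powr_add power2_eq_square)
    qed simp
    then have "ennreal (m powr (2 + 1 / b)) = ?G z * ennreal (m powr (1 + 1 / b))"
      unfolding Gm by (simp add: ennreal_mult m_def)
    also have "\<dots> = (\<integral>\<^sup>+\<sigma>. ?h z \<sigma> * ennreal (m powr (1 + 1 / b)) \<partial>lborel)"
      unfolding plane_average_def by (rule nn_integral_multc[symmetric]) (simp add: plane_section_measurable[OF Em])
    also have "\<dots> \<le> (\<integral>\<^sup>+\<sigma>. ?c * (?h z \<sigma> * ?X z \<sigma>) \<partial>lborel)"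
    proof (rule nn_integral_mono)
      fix \<sigma> :: "real \<times> real"
      show "?h z \<sigma> * ennreal (m powr (1 + 1 / b)) \<le> ?c * (?h z \<sigma> * ?X z \<sigma>)"
      proof (cases "\<sigma> \<in> param_square")
        case True
        have "?h z \<sigma> * ennreal (m powr (1 + 1 / b)) \<le> ?h z \<sigma> * (?c * ?X z \<sigma>)"
          unfolding m_def by (intro mult_left_mono plane_average_power_le[OF E b C0 True int[OF True]]) auto
        then show ?thesis by (simp only: mult.left_commute)
      qed simp
    qed
    also have "\<dots> = ?c * (\<integral>\<^sup>+\<sigma>. ?h z \<sigma> * ?X z \<sigma> \<partial>lborel)"
      by (rule nn_integral_cmult[OF zm])
    finally show "ennreal (enn2real (?G z) powr (2 + 1 / b)) \<le> ?c * (\<integral>\<^sup>+\<sigma>. ?h z \<sigma> * ?X z \<sigma> \<partial>lborel)"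
      unfolding m_def .
  qed
  also have "\<dots> = ?c * (\<integral>\<^sup>+z. (\<integral>\<^sup>+\<sigma>. ?h z \<sigma> * ?X z \<sigma> \<partial>lborel) \<partial>lborel)"
    by (rule nn_integral_cmult) (use borel_measurable_section_integral(1)[OF Xm] in simp)
  also have "\<dots> \<le> ?c * ((\<integral>\<^sup>+w. indicator E w \<partial>lborel) * (\<integral>\<^sup>+w. indicator E w \<partial>lborel))"
    by (intro mult_left_mono bilinear_plane_bound[OF Em]) auto
  also have "(\<integral>\<^sup>+w. indicator E w \<partial>lborel) = emeasure lborel E" using E by simp
  finally show ?thesis .
qed

section \<open>Interpolation and summation over superlevel sets\<close>

text \<open>Powers of extended nonnegative reals. The case distinction is essential: the passage to real numbers turns
  \<open>\<infinity>\<close> into zero.\<close>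

definition epowr :: "ennreal \<Rightarrow> real \<Rightarrow> ennreal" where
  "epowr x q = (if x = top then top else ennreal (enn2real x powr q))"

lemma epowr_ennreal [simp]: "0 \<le> x \<Longrightarrow> epowr (ennreal x) q = ennreal (x powr q)"
  by (simp add: epowr_def)

lemma epowr_top [simp]: "epowr top q = top"
  by (simp add: epowr_def)

lemma epowr_mono:
  assumes "x \<le> y" "0 \<le> q"
  shows "epowr x q \<le> epowr y q"
proof (cases y)
  case (real r)
  then obtain s where s: "x = ennreal s" "0 \<le> s" using assms by (cases x) (auto simp: top_unique)
  then show ?thesis using real assms by (auto intro!: ennreal_leI powr_mono2)
qed simp

lemma epowr_measurable [measurable]: "(\<lambda>x. epowr x q) \<in> borel_measurable borel"
  unfolding epowr_def by measurable

lemma powr_le_one_plus: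
  fixes x \<theta> :: real
  assumes "0 \<le> x" "0 \<le> \<theta>" "\<theta> \<le> 1"
  shows "x powr \<theta> \<le> 1 + x"
proof (cases "x \<le> 1")
  case True
  then show ?thesis using assms powr_le1[of \<theta> x] by linarith
next
  case False
  then have "x powr \<theta> \<le> x powr 1" using assms by (intro powr_mono) auto
  then show ?thesis using False by simp
qed

text \<open>Interpolation between the first power and the power \<open>r + 1\<close> holds pointwise; dividing by the measure \<open>e\<close> of the
  set balances the two integrals.\<close>

lemma interpolation_pointwise:
  fixes m e \<theta> r :: real
  assumes "0 \<le> m" "0 < e" "0 \<le> \<theta>" "\<theta> \<le> 1"
  shows "m powr (1 + \<theta> * r) \<le> e powr \<theta> * (m + m powr (r + 1) / e)"
proof (cases "m = 0")
  case False
  then have m: "m > 0" using assms by simp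
  have "m powr (1 + \<theta> * r) = m * (m powr r) powr \<theta>" using m by (simp add: powr_add powr_powr mult.commute)
  also have "(m powr r) powr \<theta> = (e * (m powr r / e)) powr \<theta>" using assms by simp
  also have "\<dots> = e powr \<theta> * (m powr r / e) powr \<theta>" by (rule powr_mult)
  also have "m * \<dots> \<le> m * (e powr \<theta> * (1 + m powr r / e))"
    using assms m by (intro mult_left_mono powr_le_one_plus) auto
  also have "\<dots> = e powr \<theta> * (m + m powr (r + 1) / e)"
    using m assms by (simp add: powr_add field_simps)
  finally show ?thesis .
qed (use assms in simp)

lemma plane_average_indicator_real:
  "plane_average A B (indicator E) z = ennreal (enn2real (plane_average A B (indicator E) z))"
  using plane_average_indicator_le[of A B E z]
  by (subst ennreal_enn2real) (auto simp: less_top[symmetric] top_unique intro: le_less_trans)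

text \<open>At \<open>\<theta> = 0\<close> this is the trivial bound for the integral, at \<open>\<theta> = 1\<close> the restricted estimate.\<close>

lemma interpolated_restricted_estimate:
  fixes A B :: "real^'n^'n"
  assumes E: "E \<in> sets borel" "emeasure lborel E = ennreal e" "0 \<le> e" and \<theta>: "0 \<le> \<theta>" "\<theta> \<le> 1" and c: "0 \<le> c"
    and X: "X \<in> sets borel" "emeasure lborel X = ennreal v" "0 \<le> v"
    and rest: "(\<integral>\<^sup>+z. ennreal (enn2real (plane_average A B (indicator E) z) powr (r + 1)) \<partial>lborel)
        \<le> ennreal c * (emeasure lborel E * emeasure lborel E)"
  shows "(\<integral>\<^sup>+z. indicator X (snd z) * ennreal (enn2real (plane_average A B (indicator E) z) powr (1 + \<theta> * r)) \<partial>lborel)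
     \<le> ennreal ((v + c) * e powr (1 + \<theta>))"
proof -
  let ?G = "plane_average A B (indicator E)"
  define m where "m z = enn2real (?G z)" for z
  have Em: "(indicator E :: _ \<Rightarrow> ennreal) \<in> borel_measurable borel" using E(1) by (rule borel_measurable_indicator)
  have Gm: "?G \<in> borel_measurable borel" by (rule plane_average_measurable[OF Em])
  have G: "?G z = ennreal (m z)" for z unfolding m_def by (rule plane_average_indicator_real)
  have m0: "m z \<ge> 0" for z by (simp add: m_def)
  have mm [measurable]: "m \<in> borel_measurable borel" unfolding m_def[abs_def] using Gm by measurable
  have Xm: "(\<lambda>z :: (real^'n) \<times> (real^'n). indicator X (snd z) :: ennreal) \<in> borel_measurable borel"
    by (rule measurable_borel_compose_continuous[OF borel_measurable_indicator[OF X(1)]]) (intro continuous_intros)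
  have "(\<integral>\<^sup>+z. indicator X (snd z) * ?G z \<partial>lborel) \<le> emeasure lborel X * (\<integral>\<^sup>+w. indicator E w \<partial>lborel)"
    by (rule nn_integral_plane_average_le[OF Em X(1)])
  then have L1: "(\<integral>\<^sup>+z. indicator X (snd z) * ?G z \<partial>lborel) \<le> ennreal (v * e)"
    using E X by (simp add: ennreal_mult)
  show ?thesis
  proof (cases "e = 0")
    (* A null set E has zero average at almost every plane, but the pointwise
       interpolation divides by its measure. *)
    case True
    then have "(\<integral>\<^sup>+z. indicator X (snd z) * ?G z \<partial>lborel) = 0" using L1 by simp
    moreover have "(\<lambda>z. indicator X (snd z) * ?G z) \<in> borel_measurable lborel"
      using borel_measurable_times_ennreal[OF Xm Gm] by simp
    ultimately have "AE z in lborel. indicator X (snd z) * ?G z = 0"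
      by (subst (asm) nn_integral_0_iff_AE) auto
    then have "AE z in lborel. indicator X (snd z) * ennreal (m z powr (1 + \<theta> * r)) = 0"
      by eventually_elim (auto simp: G ennreal_eq_0_iff m0 intro: antisym)
    then have "(\<integral>\<^sup>+z. indicator X (snd z) * ennreal (m z powr (1 + \<theta> * r)) \<partial>lborel) = (\<integral>\<^sup>+z. 0 \<partial>(lborel :: ((real^'n) \<times> (real^'n)) measure))"
      by (rule nn_integral_cong_AE)
    then show ?thesis by (simp add: m_def)
  next
    case False
    then have e: "e > 0" using E by simp
    let ?k = "e powr \<theta>"
    have "(\<integral>\<^sup>+z. indicator X (snd z) * ennreal (m z powr (1 + \<theta> * r)) \<partial>lborel)
       \<le> (\<integral>\<^sup>+z. ennreal ?k * (indicator X (snd z) * ?G z) + ennreal (?k / e) * ennreal (m z powr (r + 1)) \<partial>lborel)"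
    proof (rule nn_integral_mono)
      fix z
      have "ennreal (m z powr (1 + \<theta> * r)) \<le> ennreal (?k * (m z + m z powr (r + 1) / e))"
        by (intro ennreal_leI interpolation_pointwise m0 e \<theta>)
      also have "\<dots> = ennreal (?k * m z + ?k / e * m z powr (r + 1))"
        by (simp add: distrib_left)
      also have "\<dots> = ennreal ?k * ?G z + ennreal (?k / e) * ennreal (m z powr (r + 1))"
      proof -
        have "ennreal (?k / e * m z powr (r + 1)) = ennreal (?k / e) * ennreal (m z powr (r + 1))"
          using e by (intro ennreal_mult) auto
        moreover have "ennreal (?k * m z) = ennreal ?k * ennreal (m z)"
          using m0 by (intro ennreal_mult) auto
        moreover have "ennreal (?k * m z + ?k / e * m z powr (r + 1)) = ennreal (?k * m z) + ennreal (?k / e * m z powr (r + 1))"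
          using m0 e by (intro ennreal_plus) auto
        ultimately show ?thesis unfolding G by simp
      qed
      finally show "indicator X (snd z) * ennreal (m z powr (1 + \<theta> * r))
        \<le> ennreal ?k * (indicator X (snd z) * ?G z) + ennreal (?k / e) * ennreal (m z powr (r + 1))"
        by (auto simp: indicator_def)
    qed
    also have "\<dots> = ennreal ?k * (\<integral>\<^sup>+z. indicator X (snd z) * ?G z \<partial>lborel)
        + ennreal (?k / e) * (\<integral>\<^sup>+z. ennreal (m z powr (r + 1)) \<partial>lborel)"
    proof -
      have "(\<lambda>z. indicator X (snd z) * ?G z) \<in> borel_measurable lborel"
        using borel_measurable_times_ennreal[OF Xm Gm] by simp
      moreover have "(\<lambda>z. ennreal (m z powr (r + 1))) \<in> borel_measurable lborel" by measurable
      ultimately show ?thesis by (simp add: nn_integral_add nn_integral_cmult)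
    qed
    also have "\<dots> \<le> ennreal ?k * ennreal (v * e) + ennreal (?k / e) * (ennreal c * (ennreal e * ennreal e))"
      using L1 rest E unfolding m_def by (intro add_mono mult_left_mono) auto
    also have "\<dots> = ennreal (?k * (v * e) + ?k / e * (c * (e * e)))"
      using e c X(3) by (subst ennreal_plus) (auto simp: ennreal_mult[symmetric])
    also have "?k * (v * e) + ?k / e * (c * (e * e)) = (v + c) * e powr (1 + \<theta>)"
      using e by (simp add: powr_add field_simps)
    finally show ?thesis unfolding m_def .
  qed
qed

text \<open>For levels \<open>l \<le> L\<close> the trivial bound is used; for larger \<open>l\<close>, either \<open>m\<close> is
  below an integrable power of \<open>l\<close>, or the last summand dominates.\<close>

lemma layer_pointwise:
  fixes m :: real
  assumes m: "0 \<le> m" "m \<le> 4" and q: "1 < q0" "q0 < q" and "0 < l" "0 < L"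
  defines "b \<equiv> (q - 1) / (q0 - 1)"
  shows "m \<le> (if l \<le> L then 4 else 0) + (if L \<le> l then L powr b * l powr (- b) else 0)
     + L powr (1 - q) * (l powr (q - 1) * m powr q0)"
proof -
  have b: "b * (q0 - 1) = q - 1" using q by (simp add: b_def)
  have t3: "0 \<le> L powr (1 - q) * (l powr (q - 1) * m powr q0)" by simp
  have t2: "0 \<le> L powr b * l powr (- b)" by simp
  show ?thesis
  proof (cases "l \<le> L")
    case True
    then have "m \<le> (if l \<le> L then 4 else 0)" using m by simp
    moreover have "0 \<le> (if L \<le> l then L powr b * l powr (- b) else 0)" by simp
    ultimately show ?thesis using t3 by linarith
  next
    case False
    let ?y = "L powr b * l powr (- b)"
    have ite: "(if l \<le> L then 4 else 0) = (0::real)" "(if L \<le> l then ?y else 0) = ?y" using False by auto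
    have y: "?y > 0" using assms by simp
    show ?thesis
    proof (cases "m \<le> ?y")
      case True
      then show ?thesis unfolding ite using t3 by linarith
    next
      case ny: False
      then have mp: "m > 0" using y by linarith
      have "?y powr (q0 - 1) \<le> m powr (q0 - 1)" using ny y q by (intro powr_mono2) auto
      moreover have "?y powr (q0 - 1) = L powr (q - 1) * l powr (- (q - 1))"
        using assms(5,6) b by (simp add: powr_mult powr_powr)
      ultimately have "1 \<le> m powr (q0 - 1) / (L powr (q - 1) * l powr (- (q - 1)))"
        using assms by (subst le_divide_eq_1_pos) auto
      also have "\<dots> = L powr (1 - q) * l powr (q - 1) * m powr (q0 - 1)"
        using assms(5,6) by (simp add: powr_minus powr_diff field_simps)
      finally have "m * 1 \<le> m * (L powr (1 - q) * l powr (q - 1) * m powr (q0 - 1))"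
        using mp by (intro mult_left_mono) auto
      also have "\<dots> = L powr (1 - q) * (l powr (q - 1) * m powr q0)"
        using mp by (simp add: powr_diff field_simps)
      finally show ?thesis unfolding ite using t2 by linarith
    qed
  qed
qed

text \<open>If \<open>m l\<close> is the average of the indicator of the superlevel set of height \<open>l\<close>, then the integral on the left is the
  average of the function itself. Minkowski's inequality over the levels would only lead to a bound by a Lorentz norm of the
  function; the bound by an integral of the lower power \<open>q0 < q\<close> of \<open>m\<close> leads to the norm itself. It follows from the pointwise bound upon
  integration over \<open>l\<close> and a choice of \<open>L\<close>.\<close>

lemma layer_cake_power_bound:
  fixes m :: "real \<Rightarrow> real"
  assumes m: "\<And>l. 0 \<le> m l" "\<And>l. m l \<le> 4" and mm [measurable]: "m \<in> borel_measurable borel" and q: "1 < q0" "q0 < q"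
  defines "b \<equiv> (q - 1) / (q0 - 1)"
  shows "epowr (\<integral>\<^sup>+l. indicator {0<..} l * ennreal (m l) \<partial>lborel) q
    \<le> ennreal ((5 + 1 / (b - 1)) powr q) * (\<integral>\<^sup>+l. indicator {0<..} l * ennreal (l powr (q - 1) * m l powr q0) \<partial>lborel)"
    (is "epowr ?F q \<le> ennreal ?C * ?R")
proof -
  have b: "b > 1" using q by (simp add: b_def)
  let ?a = "1 / (b - 1)"
  have a: "?a > 0" using b by simp
  have main: "?F \<le> ennreal ((4 + ?a) * L) + ennreal (L powr (1 - q)) * ?R" if L: "L > 0" for L
  proof -
    have "((\<lambda>l. l powr (- b)) has_integral -(L powr (- b + 1)) / (- b + 1)) {L..}"
      using b L by (intro has_integral_powr_to_inf) auto
    from nn_integral_has_integral_lebesgue'[OF _ this]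
    have I2: "(\<integral>\<^sup>+l. ennreal (l powr (- b)) * indicator {L..} l \<partial>lborel) = ennreal (-(L powr (- b + 1)) / (- b + 1))"
      by simp
    have "?F \<le> (\<integral>\<^sup>+l. 4 * indicator {0..L} l + ennreal (L powr b) * (ennreal (l powr (- b)) * indicator {L..} l)
         + ennreal (L powr (1 - q)) * (indicator {0<..} l * ennreal (l powr (q - 1) * m l powr q0)) \<partial>lborel)"
    proof (rule nn_integral_mono)
      fix l :: real
      show "indicator {0<..} l * ennreal (m l) \<le> 4 * indicator {0..L} l + ennreal (L powr b) * (ennreal (l powr (- b)) * indicator {L..} l)
         + ennreal (L powr (1 - q)) * (indicator {0<..} l * ennreal (l powr (q - 1) * m l powr q0))"
      proof (cases "l > 0")
        case True
        have "ennreal (m l) \<le> ennreal ((if l \<le> L then 4 else 0) + (if L \<le> l then L powr b * l powr (- b) else 0)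
            + L powr (1 - q) * (l powr (q - 1) * m l powr q0))"
          unfolding b_def by (intro ennreal_leI layer_pointwise m q True L)
        also have "\<dots> = ennreal (if l \<le> L then 4 else 0) + ennreal (if L \<le> l then L powr b * l powr (- b) else 0)
            + ennreal (L powr (1 - q) * (l powr (q - 1) * m l powr q0))"
          by (subst ennreal_plus[symmetric] | simp)+
        finally show ?thesis using True by (auto simp: indicator_def ennreal_mult)
      qed simp
    qed
    also have "\<dots> = 4 * ennreal L + ennreal (L powr b) * ennreal (-(L powr (- b + 1)) / (- b + 1)) + ennreal (L powr (1 - q)) * ?R"
    proof -
      have m3: "(\<lambda>l. indicator {0<..} l * ennreal (l powr (q - 1) * m l powr q0)) \<in> borel_measurable lborel" by measurable
      have m2: "(\<lambda>l. ennreal (l powr (- b)) * indicator {L..} l) \<in> borel_measurable lborel" by measurable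
      have m1: "(\<lambda>l. 4 * indicator {0..L} l :: ennreal) \<in> borel_measurable lborel" by measurable
      have "(\<integral>\<^sup>+l. 4 * indicator {0..L} l \<partial>lborel) = 4 * ennreal L"
        using L by (subst nn_integral_cmult_indicator) auto
      then show ?thesis
        using m1 m2 m3 I2 by (simp add: nn_integral_add nn_integral_cmult)
    qed
    also have "4 * ennreal L + ennreal (L powr b) * ennreal (-(L powr (- b + 1)) / (- b + 1)) = ennreal ((4 + ?a) * L)"
    proof -
      have "4 * ennreal L = ennreal (4 * L)" using L by (simp add: ennreal_mult)
      moreover have "-(L powr (- b + 1)) / (- b + 1) = L powr (1 - b) * ?a"
        using b by (simp add: field_simps)
      moreover have "L powr b * (L powr (1 - b) * ?a) = L * ?a"
        using L by (simp add: powr_add[symmetric] mult.assoc[symmetric])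
      ultimately show ?thesis
        using L a by (simp add: ennreal_mult[symmetric] ennreal_plus[symmetric] algebra_simps del: ennreal_plus)
    qed
    finally show ?thesis .
  qed
  have "5 + ?a > 0" using a by linarith
  then have C: "?C > 0" by simp
  show ?thesis
  proof (cases ?R)
    case top
    then have "ennreal ?C * ?R = top" using C by (simp add: ennreal_mult_top)
    then show ?thesis by simp
  next
    case (real \<rho>)
    show ?thesis
    proof (cases "\<rho> = 0")
      case True
      then have le: "?F \<le> ennreal ((4 + ?a) * L)" if "L > 0" for L using main[OF that] real by simp
      have "?F = 0"
      proof (cases ?F)
        case (real f)
        have "f \<le> 0"
        proof (rule ccontr)
          assume "\<not> f \<le> 0"
          then have f: "f > 0" by simp
          have "4 + ?a > 0" using a by linarith
          then have pos: "2 * (4 + ?a) > 0" by (rule mult_pos_pos[OF zero_less_numeral])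
          have cancel: "y * (f / (2 * y)) = f / 2" if "y > 0" for y using that by simp
          have "(4 + ?a) * (f / (2 * (4 + ?a))) = f / 2" by (rule cancel) fact
          then have "ennreal f \<le> ennreal (f / 2)"
            using le[OF divide_pos_pos[OF f pos]] real by metis
          then show False using f by (simp add: ennreal_le_iff)
        qed
        then show ?thesis using real by simp
      next
        case top
        then show ?thesis using le[of 1] by (simp add: top_unique)
      qed
      then show ?thesis using epowr_ennreal[of 0 q] by simp
    next
      case False
      then have \<rho>: "\<rho> > 0" using real by simp
      (* With this L both terms of the main estimate are multiples of L. *)
      define L where "L = \<rho> powr (1 / q)"
      have L: "L > 0" using \<rho> by (simp add: L_def)
      have "L powr (1 - q) * \<rho> = L"
      proof -
        have "L powr (1 - q) * \<rho> = \<rho> powr ((1 / q) * (1 - q)) * \<rho> powr 1" using \<rho> by (simp add: L_def powr_powr)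
        also have "\<dots> = \<rho> powr ((1 / q) * (1 - q) + 1)" by (simp only: powr_add)
        also have "(1 / q) * (1 - q) + 1 = 1 / q" using q by (simp add: field_simps)
        finally show ?thesis by (simp add: L_def)
      qed
      then have "?F \<le> ennreal ((4 + ?a) * L) + ennreal L"
        using main[OF L] real by (simp add: ennreal_mult[symmetric])
      also have "\<dots> = ennreal ((5 + ?a) * L)"
        using L a by (simp add: ennreal_plus[symmetric] algebra_simps del: ennreal_plus)
      finally have "epowr ?F q \<le> epowr (ennreal ((5 + ?a) * L)) q" using q by (intro epowr_mono) auto
      also have "\<dots> = ennreal (((5 + ?a) * L) powr q)" using L a by (intro epowr_ennreal) auto
      also have "((5 + ?a) * L) powr q = ?C * \<rho>"
        using L a \<rho> q by (simp add: powr_mult powr_powr L_def)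
      finally show ?thesis using real C by (simp add: ennreal_mult)
    qed
  qed
qed

lemma measurable_superlevel_indicator:
  fixes g :: "'a::euclidean_space \<Rightarrow> ennreal"
  assumes g: "g \<in> borel_measurable borel"
  shows "(\<lambda>x. indicator {w. ennreal (snd x) < g w} (fst x) :: ennreal) \<in> borel_measurable borel"
proof -
  have m1: "(\<lambda>x :: 'a \<times> real. ennreal (snd x)) \<in> borel_measurable borel"
    by (rule measurable_borel_compose_continuous[OF measurable_ennreal]) (intro continuous_intros)
  have m2: "(\<lambda>x :: 'a \<times> real. g (fst x)) \<in> borel_measurable borel"
    by (rule measurable_borel_compose_continuous[OF g]) (intro continuous_intros)
  have "{x :: 'a \<times> real. ennreal (snd x) < g (fst x)} \<in> sets borel"
    using borel_measurable_less[OF m1 m2] by simp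
  then have "(indicator {x :: 'a \<times> real. ennreal (snd x) < g (fst x)} :: _ \<Rightarrow> ennreal) \<in> borel_measurable borel"
    by (rule borel_measurable_indicator)
  moreover have "(\<lambda>x. indicator {w. ennreal (snd x) < g w} (fst x) :: ennreal) = indicator {x :: 'a \<times> real. ennreal (snd x) < g (fst x)}"
    by (auto simp: fun_eq_iff indicator_def)
  ultimately show ?thesis by simp
qed

lemma measurable_indicator_positive:
  "(\<lambda>w :: 'a::euclidean_space \<times> real. indicator {0<..} (snd w) :: ennreal) \<in> borel_measurable borel"
proof -
  have "{0::real<..} \<in> sets borel" by simp
  from measurable_borel_compose_continuous[OF borel_measurable_indicator[OF this], of snd]
  show ?thesis by (simp add: continuous_on_snd)
qed

lemma layer_cake_ennreal:
  "(x::ennreal) = (\<integral>\<^sup>+l. indicator {0<..} l * indicator {w. ennreal l < w} x \<partial>lborel)"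
proof (cases x)
  case (real r)
  have "(\<integral>\<^sup>+l. indicator {0<..} l * indicator {w. ennreal l < w} x \<partial>lborel) = (\<integral>\<^sup>+l. indicator {0<..<r} l \<partial>lborel)"
    using real by (intro nn_integral_cong) (auto simp: indicator_def ennreal_less_iff)
  also have "\<dots> = ennreal r" using real by simp
  finally show ?thesis using real by simp
next
  case top
  have "(\<integral>\<^sup>+l. indicator {0<..} l * indicator {w. ennreal l < w} x \<partial>lborel) = (\<integral>\<^sup>+l. indicator {0::real<..} l \<partial>lborel)"
    unfolding top by (rule nn_integral_cong) (auto simp: indicator_def)
  also have "\<dots> = emeasure lborel {0::real<..}" by simp
  also have "\<dots> = top"
  proof (rule ccontr)
    assume "emeasure lborel {0::real<..} \<noteq> top"
    then obtain r where r: "emeasure lborel {0::real<..} = ennreal r" "0 \<le> r"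
      by (cases "emeasure lborel {0::real<..}") auto
    have "ennreal (r + 1) = emeasure lborel {0<..<r + 1}" using r by simp
    also have "\<dots> \<le> emeasure lborel {0::real<..}" by (intro emeasure_mono) auto
    finally show False using r by (simp add: ennreal_le_iff)
  qed
  finally show ?thesis using top by simp
qed

lemma layer_cake_power_le:
  assumes p: "p > 0"
  shows "(\<integral>\<^sup>+l. indicator {0<..} l * (ennreal (l powr (p - 1)) * indicator {w. ennreal l < w} x) \<partial>lborel) \<le> ennreal (1 / p) * epowr x p"
proof (cases x)
  case (real r)
  have "((\<lambda>l. l powr (p - 1)) has_integral (r powr (p - 1 + 1) / (p - 1 + 1))) {0..r}"
    using p real by (intro has_integral_powr_from_0) auto
  from nn_integral_has_integral_lebesgue'[OF _ this]
  have I: "(\<integral>\<^sup>+l. ennreal (l powr (p - 1)) * indicator {0..r} l \<partial>lborel) = ennreal (r powr p / p)" by simp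
  have "(\<integral>\<^sup>+l. indicator {0<..} l * (ennreal (l powr (p - 1)) * indicator {w. ennreal l < w} x) \<partial>lborel)
     \<le> (\<integral>\<^sup>+l. ennreal (l powr (p - 1)) * indicator {0..r} l \<partial>lborel)"
    using real by (intro nn_integral_mono) (auto simp: indicator_def ennreal_less_iff)
  also have "\<dots> = ennreal (1 / p) * epowr x p" unfolding I using real p by (simp add: ennreal_mult[symmetric])
  finally show ?thesis .
next
  case top
  then show ?thesis using p by (simp add: ennreal_mult_top)
qed

text \<open>Decompose \<open>g\<close> into its superlevel sets \<open>E l\<close>. By \<open>layer_cake_power_bound\<close>, the power \<open>q\<close> of the average of \<open>g\<close> is
  controlled by an integral over \<open>l\<close> of the powers \<open>q0 = 1 + \<theta> r\<close> of the averages of the sets, and the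
  interpolated estimate turns these into \<open>\<bar>E l\<bar>^(1 + \<theta>)\<close>. Chebyshev's inequality for the factor \<open>\<bar>E l\<bar>^\<theta>\<close> leaves the
  integral of \<open>l^(p - 1) \<bar>E l\<bar>\<close>, which is the power \<open>p\<close> of the norm of \<open>g\<close> up to a constant. It is in the condition
  \<open>q0 < q\<close> that the strict inequality between the exponents enters.\<close>

lemma plane_average_strong_type:
  fixes A B :: "real^'n^'n"
  assumes b: "0 < b" and C0: "0 < C0"
    and int: "\<And>\<sigma>. \<sigma> \<in> param_square \<Longrightarrow>
       (\<integral>\<^sup>+\<tau>. indicator param_square \<tau> * inverse (ennreal (\<bar>pencil_det A B (\<sigma> - \<tau>)\<bar> powr b)) \<partial>lborel) \<le> ennreal C0"
    and X: "X \<in> sets borel" "emeasure lborel X = ennreal v" "0 \<le> v"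
    and \<theta>: "0 < \<theta>" "\<theta> \<le> 1" and p: "0 < p" and q: "q = p * (1 + \<theta>)" "1 + \<theta> * (1 + 1 / b) < q"
  shows "\<exists>K\<ge>0. \<forall>g x. g \<in> borel_measurable borel \<longrightarrow> 0 \<le> x \<longrightarrow> (\<integral>\<^sup>+w. epowr (g w) p \<partial>lborel) = ennreal x \<longrightarrow>
     (\<integral>\<^sup>+z. indicator X (snd z) * epowr (plane_average A B g z) q \<partial>lborel) \<le> ennreal (K * x powr (1 + \<theta>))"
proof -
  define r where "r = 1 + 1 / b"
  define q0 where "q0 = 1 + \<theta> * r"
  have r: "r > 0" using b by (simp add: r_def add_pos_pos)
  have q0: "1 < q0" "q0 < q" using q \<theta> r by (simp_all add: q0_def r_def)
  define c where "c = 2 * (2 * C0) powr (1 / b)"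
  have c: "c \<ge> 0" by (simp add: c_def)
  define C where "C = (5 + 1 / ((q - 1) / (q0 - 1) - 1)) powr q"
  have C: "C \<ge> 0" by (simp add: C_def)
  define K where "K = C * (v + c) / p"
  have K: "K \<ge> 0" using C c X p by (simp add: K_def)
  have "(\<integral>\<^sup>+z. indicator X (snd z) * epowr (plane_average A B g z) q \<partial>lborel) \<le> ennreal (K * x powr (1 + \<theta>))"
    if g: "g \<in> borel_measurable borel" and x: "0 \<le> x" "(\<integral>\<^sup>+w. epowr (g w) p \<partial>lborel) = ennreal x" for g x
  proof -
    define E where "E l = {w. ennreal l < g w}" for l
    define m where "m l z = enn2real (plane_average A B (indicator (E l)) z)" for l z
    have Eb: "E l \<in> sets borel" for l
      unfolding E_def using borel_measurable_less[of "\<lambda>_. ennreal l" borel g] g by simp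
    have m04: "0 \<le> m l z" "m l z \<le> 4" for l z
    proof -
      have "ennreal (m l z) \<le> ennreal 4"
        unfolding m_def plane_average_indicator_real[symmetric] using plane_average_indicator_le by simp
      then show "m l z \<le> 4" by (subst (asm) ennreal_le_iff) auto
    qed (simp add: m_def)
    have gp: "(\<lambda>w. epowr (g w) p) \<in> borel_measurable borel"
      by (rule measurable_compose[OF g epowr_measurable])
    define e where "e l = enn2real (emeasure lborel (E l))" for l
    have markov: "emeasure lborel (E l) = ennreal (e l) \<and> e l \<le> x * l powr (- p)" if l: "l > 0" for l
    proof -
      have "ennreal (l powr p) * emeasure lborel (E l) = (\<integral>\<^sup>+w. ennreal (l powr p) * indicator (E l) w \<partial>lborel)"
        using Eb by (subst nn_integral_cmult_indicator) auto
      also have "\<dots> \<le> (\<integral>\<^sup>+w. epowr (g w) p \<partial>lborel)"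
      proof (rule nn_integral_mono)
        fix w
        show "ennreal (l powr p) * indicator (E l) w \<le> epowr (g w) p"
        proof (cases "w \<in> E l")
          case True
          then have "epowr (ennreal l) p \<le> epowr (g w) p" using p by (intro epowr_mono) (auto simp: E_def)
          then show ?thesis using True l by simp
        qed simp
      qed
      finally have le: "ennreal (l powr p) * emeasure lborel (E l) \<le> ennreal x" using x by simp
      have "emeasure lborel (E l) \<noteq> top"
      proof
        assume "emeasure lborel (E l) = top"
        then show False using le l by (simp add: ennreal_mult_top top_unique)
      qed
      then have eq: "emeasure lborel (E l) = ennreal (e l)" unfolding e_def by (simp add: less_top)
      have "l powr p * e l \<le> x"
        using le x unfolding eq by (simp add: ennreal_mult[symmetric] ennreal_le_iff e_def)
      then show ?thesis using eq l by (simp add: powr_minus field_simps)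
    qed
    note supl = measurable_superlevel_indicator[OF g]
    have J: "(\<lambda>w :: (((real^'n) \<times> (real^'n)) \<times> real) \<times> (real \<times> real).
        indicator param_square (snd w) * indicator (E (snd (fst w))) (plane_point A B (fst (fst w)) (snd w)) :: ennreal) \<in> borel_measurable borel"
    proof (rule borel_measurable_times_ennreal)
      show "(\<lambda>w :: (((real^'n) \<times> (real^'n)) \<times> real) \<times> (real \<times> real). indicator param_square (snd w) :: ennreal) \<in> borel_measurable borel"
        by (rule measurable_borel_compose_continuous[OF borel_measurable_indicator[OF param_square_borel]]) (intro continuous_intros)
      have "continuous_on UNIV (\<lambda>w :: (((real^'n) \<times> (real^'n)) \<times> real) \<times> (real \<times> real). plane_point A B (fst (fst w)) (snd w))"
        unfolding plane_point_def by (intro continuous_intros bounded_linear.continuous_on[OF matrix_vector_mul_bounded_linear])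
      then have "continuous_on UNIV (\<lambda>w :: (((real^'n) \<times> (real^'n)) \<times> real) \<times> (real \<times> real). (plane_point A B (fst (fst w)) (snd w), snd (fst w)))"
        by (intro continuous_intros)
      from measurable_borel_compose_continuous[OF supl this]
      show "(\<lambda>w :: (((real^'n) \<times> (real^'n)) \<times> real) \<times> (real \<times> real). indicator (E (snd (fst w))) (plane_point A B (fst (fst w)) (snd w)) :: ennreal) \<in> borel_measurable borel"
        by (simp add: E_def)
    qed
    have Gj: "(\<lambda>w. plane_average A B (indicator (E (snd w))) (fst w)) \<in> borel_measurable borel"
      using borel_measurable_section_integral(1)[OF J] by (simp add: plane_average_def)
    have mj: "(\<lambda>w. m (snd w) (fst w)) \<in> borel_measurable borel"
      unfolding m_def by (rule measurable_compose[OF Gj]) measurable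
    (* The average of g is the integral over l of the averages of its superlevel sets. *)
    have F: "plane_average A B g z = (\<integral>\<^sup>+l. indicator {0<..} l * ennreal (m l z) \<partial>lborel)" for z
    proof -
      have Jz: "(\<lambda>w :: (real \<times> real) \<times> real. indicator {0<..} (snd w) * (indicator param_square (fst w) * indicator (E (snd w)) (plane_point A B z (fst w))) :: ennreal) \<in> borel_measurable borel"
        using borel_measurable_times_ennreal[OF measurable_indicator_positive measurable_borel_compose_continuous[OF J, of "\<lambda>w. ((z, snd w), fst w)"]]
        by (simp add: continuous_intros)
      have sg: "(\<lambda>l. indicator {0<..} l * indicator {w. ennreal l < w} y :: ennreal) \<in> borel_measurable lborel" for y :: ennreal
      proof -
        have "{l. ennreal l < y} \<in> sets borel"
          using borel_measurable_less[OF measurable_ennreal, of "\<lambda>_. y"] by simp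
        then have "(indicator ({0<..} \<inter> {l. ennreal l < y}) :: real \<Rightarrow> ennreal) \<in> borel_measurable borel"
          by (intro borel_measurable_indicator) auto
        moreover have "(\<lambda>l. indicator {0<..} l * indicator {w. ennreal l < w} y :: ennreal) = indicator ({0<..} \<inter> {l. ennreal l < y})"
          by (auto simp: fun_eq_iff indicator_def)
        ultimately show ?thesis by simp
      qed
      have "plane_average A B g z = (\<integral>\<^sup>+\<sigma>. (\<integral>\<^sup>+l. indicator {0<..} l * (indicator param_square \<sigma> * indicator (E l) (plane_point A B z \<sigma>)) \<partial>lborel) \<partial>lborel)"
        unfolding plane_average_def
      proof (rule nn_integral_cong)
        fix \<sigma> :: "real \<times> real"
        have "indicator param_square \<sigma> * g (plane_point A B z \<sigma>)
          = indicator param_square \<sigma> * (\<integral>\<^sup>+l. indicator {0<..} l * indicator {w. ennreal l < w} (g (plane_point A B z \<sigma>)) \<partial>lborel)"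
          using layer_cake_ennreal[of "g (plane_point A B z \<sigma>)"] by simp
        also have "\<dots> = (\<integral>\<^sup>+l. indicator param_square \<sigma> * (indicator {0<..} l * indicator {w. ennreal l < w} (g (plane_point A B z \<sigma>))) \<partial>lborel)"
          by (rule nn_integral_cmult[symmetric]) (rule sg)
        also have "\<dots> = (\<integral>\<^sup>+l. indicator {0<..} l * (indicator param_square \<sigma> * indicator (E l) (plane_point A B z \<sigma>)) \<partial>lborel)"
          by (intro nn_integral_cong) (auto simp: indicator_def E_def)
        finally show "indicator param_square \<sigma> * g (plane_point A B z \<sigma>)
          = (\<integral>\<^sup>+l. indicator {0<..} l * (indicator param_square \<sigma> * indicator (E l) (plane_point A B z \<sigma>)) \<partial>lborel)" .
      qed
      also have "\<dots> = (\<integral>\<^sup>+l. (\<integral>\<^sup>+\<sigma>. indicator {0<..} l * (indicator param_square \<sigma> * indicator (E l) (plane_point A B z \<sigma>)) \<partial>lborel) \<partial>lborel)"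
        using nn_integral_lborel_swap_order[OF Jz] by simp
      also have "\<dots> = (\<integral>\<^sup>+l. indicator {0<..} l * ennreal (m l z) \<partial>lborel)"
      proof (rule nn_integral_cong)
        fix l :: real
        have "(\<integral>\<^sup>+\<sigma>. indicator {0<..} l * (indicator param_square \<sigma> * indicator (E l) (plane_point A B z \<sigma>)) \<partial>lborel)
          = indicator {0<..} l * plane_average A B (indicator (E l)) z"
          unfolding plane_average_def
          using plane_section_measurable[OF borel_measurable_indicator[OF Eb[of l]], of A B z]
          by (intro nn_integral_cmult) simp
        then show "(\<integral>\<^sup>+\<sigma>. indicator {0<..} l * (indicator param_square \<sigma> * indicator (E l) (plane_point A B z \<sigma>)) \<partial>lborel)
          = indicator {0<..} l * ennreal (m l z)"
          by (simp add: m_def plane_average_indicator_real[symmetric])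
      qed
      finally show ?thesis .
    qed
    let ?R = "\<lambda>z l. indicator {0<..} l * ennreal (l powr (q - 1) * m l z powr q0)"
    have Rj: "(\<lambda>w. indicator X (snd (fst w)) * ?R (fst w) (snd w)) \<in> borel_measurable borel"
    proof (intro borel_measurable_times_ennreal measurable_indicator_positive)
      show "(\<lambda>w :: ((real^'n) \<times> (real^'n)) \<times> real. indicator X (snd (fst w)) :: ennreal) \<in> borel_measurable borel"
        by (rule measurable_borel_compose_continuous[OF borel_measurable_indicator[OF X(1)]]) (intro continuous_intros)
      have "(\<lambda>w :: ((real^'n) \<times> (real^'n)) \<times> real. snd w powr (q - 1)) \<in> borel_measurable borel"
        by (rule measurable_borel_compose_continuous[where f="\<lambda>l. l powr (q - 1)"]) (measurable, intro continuous_intros)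
      moreover have "(\<lambda>w. m (snd w) (fst w) powr q0) \<in> borel_measurable borel"
        by (rule measurable_compose[OF mj]) measurable
      ultimately show "(\<lambda>w. ennreal (snd w powr (q - 1) * m (snd w) (fst w) powr q0)) \<in> borel_measurable borel"
        by measurable
    qed
    have mz: "(\<lambda>l. m l z) \<in> borel_measurable borel" for z
      using measurable_borel_compose_continuous[OF mj, of "\<lambda>l. (z, l)"] by (simp add: continuous_intros)
    have "(\<integral>\<^sup>+z. indicator X (snd z) * epowr (plane_average A B g z) q \<partial>lborel)
       \<le> (\<integral>\<^sup>+z. ennreal C * (\<integral>\<^sup>+l. indicator X (snd z) * ?R z l \<partial>lborel) \<partial>lborel)"
    proof (rule nn_integral_mono)
      fix z
      have "epowr (plane_average A B g z) q \<le> ennreal C * (\<integral>\<^sup>+l. ?R z l \<partial>lborel)"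
        unfolding F C_def by (intro layer_cake_power_bound m04 mz q0)
      then show "indicator X (snd z) * epowr (plane_average A B g z) q \<le> ennreal C * (\<integral>\<^sup>+l. indicator X (snd z) * ?R z l \<partial>lborel)"
        by (cases "snd z \<in> X") auto
    qed
    also have "\<dots> = ennreal C * (\<integral>\<^sup>+z. (\<integral>\<^sup>+l. indicator X (snd z) * ?R z l \<partial>lborel) \<partial>lborel)"
      by (rule nn_integral_cmult) (use borel_measurable_section_integral(1)[OF Rj] in simp)
    also have "(\<integral>\<^sup>+z. (\<integral>\<^sup>+l. indicator X (snd z) * ?R z l \<partial>lborel) \<partial>lborel) = (\<integral>\<^sup>+l. (\<integral>\<^sup>+z. indicator X (snd z) * ?R z l \<partial>lborel) \<partial>lborel)"
      using nn_integral_lborel_swap_order[OF Rj] by simp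
    also have "\<dots> \<le> (\<integral>\<^sup>+l. ennreal ((v + c) * x powr \<theta>) * (indicator {0<..} l * (ennreal (l powr (p - 1)) * emeasure lborel (E l))) \<partial>lborel)"
    proof (rule nn_integral_mono)
      fix l :: real
      show "(\<integral>\<^sup>+z. indicator X (snd z) * ?R z l \<partial>lborel)
        \<le> ennreal ((v + c) * x powr \<theta>) * (indicator {0<..} l * (ennreal (l powr (p - 1)) * emeasure lborel (E l)))"
      proof (cases "l > 0")
        case True
        have el: "0 \<le> e l" by (simp add: e_def)
        have rest: "(\<integral>\<^sup>+z. indicator X (snd z) * ennreal (m l z powr (1 + \<theta> * r)) \<partial>lborel) \<le> ennreal ((v + c) * e l powr (1 + \<theta>))"
          unfolding m_def
        proof (rule interpolated_restricted_estimate[OF Eb _ el _ \<theta>(2) c X])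
          show "emeasure lborel (E l) = ennreal (e l)" using markov[OF True] by simp
          show "(\<integral>\<^sup>+z. ennreal (enn2real (plane_average A B (indicator (E l)) z) powr (r + 1)) \<partial>lborel)
             \<le> ennreal c * (emeasure lborel (E l) * emeasure lborel (E l))"
            using restricted_plane_estimate[OF Eb[of l] b C0 int] by (simp add: r_def c_def add.commute)
        qed (use \<theta> in simp)
        have Xm: "(\<lambda>z. indicator X (snd z) * ennreal (m l z powr (1 + \<theta> * r))) \<in> borel_measurable lborel"
        proof -
          have "(\<lambda>z :: (real^'n) \<times> (real^'n). indicator X (snd z) :: ennreal) \<in> borel_measurable borel"
            by (rule measurable_borel_compose_continuous[OF borel_measurable_indicator[OF X(1)]]) (intro continuous_intros)
          moreover have "(\<lambda>z. m l z) \<in> borel_measurable borel"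
            using measurable_borel_compose_continuous[OF mj, of "\<lambda>z. (z, l)"] by (simp add: continuous_intros)
          then have "(\<lambda>z. ennreal (m l z powr (1 + \<theta> * r))) \<in> borel_measurable borel" by measurable
          ultimately show ?thesis using borel_measurable_times_ennreal by simp
        qed
        have "(\<integral>\<^sup>+z. indicator X (snd z) * ?R z l \<partial>lborel)
          = (\<integral>\<^sup>+z. ennreal (l powr (q - 1)) * (indicator X (snd z) * ennreal (m l z powr (1 + \<theta> * r))) \<partial>lborel)"
          using True by (intro nn_integral_cong) (auto simp: indicator_def ennreal_mult q0_def)
        also have "\<dots> = ennreal (l powr (q - 1)) * (\<integral>\<^sup>+z. indicator X (snd z) * ennreal (m l z powr (1 + \<theta> * r)) \<partial>lborel)"
          by (rule nn_integral_cmult[OF Xm])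
        also have "\<dots> \<le> ennreal (l powr (q - 1)) * ennreal ((v + c) * e l powr (1 + \<theta>))"
          by (intro mult_left_mono rest) simp
        also have "\<dots> = ennreal (l powr (q - 1) * ((v + c) * e l powr (1 + \<theta>)))"
          using X c by (intro ennreal_mult[symmetric]) auto
        also have "\<dots> \<le> ennreal ((v + c) * x powr \<theta> * (l powr (p - 1) * e l))"
        proof (rule ennreal_leI)
          (* Chebyshev's inequality, used for the power \<theta> only. *)
          have "e l powr \<theta> \<le> (x * l powr (- p)) powr \<theta>"
            using markov[OF True] el \<theta> by (intro powr_mono2) auto
          also have "\<dots> = x powr \<theta> * l powr (- (p * \<theta>))" by (simp add: powr_mult powr_powr)
          finally have et: "e l powr \<theta> \<le> x powr \<theta> * l powr (- (p * \<theta>))" .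
          have e1: "e l powr (1 + \<theta>) = e l * e l powr \<theta>"
          proof (cases "e l = 0")
            case False then show ?thesis using el by (simp add: powr_add)
          qed simp
          have "l powr (q - 1) * l powr (- (p * \<theta>)) = l powr (p - 1)"
            unfolding powr_add[symmetric] q(1) by (rule arg_cong[where f="\<lambda>y. l powr y"]) (simp add: algebra_simps)
          moreover have "a * x' * (p' * e') = q' * (a * (e' * (x' * y')))" if "q' * y' = p'" for a x' p' e' q' y' :: real
            unfolding that[symmetric] by (simp only: mult_ac)
          ultimately have "(v + c) * x powr \<theta> * (l powr (p - 1) * e l)
             = l powr (q - 1) * ((v + c) * (e l * (x powr \<theta> * l powr (- (p * \<theta>)))))" by blast
          also have "\<dots> \<ge> l powr (q - 1) * ((v + c) * (e l * e l powr \<theta>))"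
            using et el X c by (intro mult_left_mono) auto
          finally show "l powr (q - 1) * ((v + c) * e l powr (1 + \<theta>)) \<le> (v + c) * x powr \<theta> * (l powr (p - 1) * e l)"
            unfolding e1 .
        qed
        also have "\<dots> = ennreal ((v + c) * x powr \<theta>) * (indicator {0<..} l * (ennreal (l powr (p - 1)) * emeasure lborel (E l)))"
          using True markov[OF True] el X c by (simp add: ennreal_mult)
        finally show ?thesis .
      qed simp
    qed
    also have "\<dots> = ennreal ((v + c) * x powr \<theta>) * (\<integral>\<^sup>+l. indicator {0<..} l * (ennreal (l powr (p - 1)) * emeasure lborel (E l)) \<partial>lborel)"
    proof (rule nn_integral_cmult)
      have "(\<lambda>l. \<integral>\<^sup>+w. indicator (E l) w \<partial>lborel) \<in> borel_measurable borel"
        using borel_measurable_section_integral(2)[OF supl] by (simp add: E_def)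
      then have "(\<lambda>l. emeasure lborel (E l)) \<in> borel_measurable borel" using Eb by simp
      then show "(\<lambda>l. indicator {0<..} l * (ennreal (l powr (p - 1)) * emeasure lborel (E l))) \<in> borel_measurable lborel"
        by measurable
    qed
    also have "(\<integral>\<^sup>+l. indicator {0<..} l * (ennreal (l powr (p - 1)) * emeasure lborel (E l)) \<partial>lborel)
       = (\<integral>\<^sup>+l. (\<integral>\<^sup>+w. indicator {0<..} l * (ennreal (l powr (p - 1)) * indicator {y. ennreal l < y} (g w)) \<partial>lborel) \<partial>lborel)"
    proof (rule nn_integral_cong)
      fix l :: real
      have "(\<integral>\<^sup>+w. indicator {0<..} l * (ennreal (l powr (p - 1)) * indicator {y. ennreal l < y} (g w)) \<partial>lborel)
        = (\<integral>\<^sup>+w. (indicator {0<..} l * ennreal (l powr (p - 1))) * indicator (E l) w \<partial>lborel)"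
        by (intro nn_integral_cong) (auto simp: indicator_def E_def)
      also have "\<dots> = (indicator {0<..} l * ennreal (l powr (p - 1))) * emeasure lborel (E l)"
        using Eb by (intro nn_integral_cmult_indicator) simp
      finally show "indicator {0<..} l * (ennreal (l powr (p - 1)) * emeasure lborel (E l))
        = (\<integral>\<^sup>+w. indicator {0<..} l * (ennreal (l powr (p - 1)) * indicator {y. ennreal l < y} (g w)) \<partial>lborel)"
        by (simp add: mult.assoc)
    qed
    also have "\<dots> = (\<integral>\<^sup>+w. (\<integral>\<^sup>+l. indicator {0<..} l * (ennreal (l powr (p - 1)) * indicator {y. ennreal l < y} (g w)) \<partial>lborel) \<partial>lborel)"
    proof -
      have pw: "(\<lambda>u :: ((real^'n) \<times> real \<times> real) \<times> real. ennreal (snd u powr (p - 1))) \<in> borel_measurable borel"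
        by (rule measurable_borel_compose_continuous[where f="\<lambda>l. ennreal (l powr (p - 1))"]) (measurable, intro continuous_intros)
      have "(\<lambda>u. indicator {0<..} (snd u) * (ennreal (snd u powr (p - 1)) * indicator {y. ennreal (snd u) < y} (g (fst u)))) \<in> borel_measurable borel"
        using borel_measurable_times_ennreal[OF measurable_indicator_positive borel_measurable_times_ennreal[OF pw supl]]
        by (simp add: indicator_def cong: if_cong)
      from nn_integral_lborel_swap_order[OF this] show ?thesis by simp
    qed
    also have "\<dots> \<le> (\<integral>\<^sup>+w. ennreal (1 / p) * epowr (g w) p \<partial>lborel)"
      by (intro nn_integral_mono layer_cake_power_le p)
    also have "\<dots> = ennreal (1 / p) * ennreal x"
      using gp x by (simp add: nn_integral_cmult)
    finally have "(\<integral>\<^sup>+z. indicator X (snd z) * epowr (plane_average A B g z) q \<partial>lborel)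
      \<le> ennreal C * (ennreal ((v + c) * x powr \<theta>) * (ennreal (1 / p) * ennreal x))"
      by (simp add: mult_left_mono)
    also have "\<dots> = ennreal (C * ((v + c) * x powr \<theta> * (1 / p * x)))"
      using C X c p x by (simp add: ennreal_mult[symmetric])
    also have "C * ((v + c) * x powr \<theta> * (1 / p * x)) = K * x powr (1 + \<theta>)"
    proof (cases "x = 0")
      case False
      then have "x powr (1 + \<theta>) = x * x powr \<theta>" using x by (simp add: powr_add)
      then show ?thesis by (simp add: K_def)
    qed (use \<theta> in simp)
    finally show ?thesis .
  qed
  then show ?thesis using K by blast
qed

section \<open>The plane transform and averages over planes\<close>

lemma plane_transform_eq:
  assumes grad: "\<And>\<xi>. grad Q1 \<xi> = A *v \<xi>" "\<And>\<xi>. grad Q2 \<xi> = B *v \<xi>"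
  shows "plane_transform Q1 Q2 f z = (LINT \<sigma>|lebesgue. indicator param_square \<sigma> *\<^sub>R f (plane_point A B z \<sigma>))"
  unfolding plane_transform_def set_lebesgue_integral_def plane_point_def
  by (simp add: grad case_prod_beta')

text \<open>If the integral that defines the transform does not converge absolutely, the transform is zero by convention and
  the bound holds trivially.\<close>

lemma norm_plane_transform_le:
  assumes grad: "\<And>\<xi>. grad Q1 \<xi> = A *v \<xi>" "\<And>\<xi>. grad Q2 \<xi> = B *v \<xi>"
    and le: "\<And>w. ennreal (norm (f w)) \<le> g w"
  shows "ennreal (norm (plane_transform Q1 Q2 f z)) \<le> plane_average A B g z"
proof -
  let ?h = "\<lambda>\<sigma>. indicator param_square \<sigma> *\<^sub>R f (plane_point A B z \<sigma>)"
  show ?thesis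
  proof (cases "integrable lebesgue ?h")
    case True
    have "ennreal (norm (plane_transform Q1 Q2 f z)) \<le> (\<integral>\<^sup>+\<sigma>. ennreal (norm (?h \<sigma>)) \<partial>lebesgue)"
      unfolding plane_transform_eq[OF grad] by (rule integral_norm_bound_ennreal[OF True])
    also have "\<dots> \<le> (\<integral>\<^sup>+\<sigma>. indicator param_square \<sigma> * g (plane_point A B z \<sigma>) \<partial>lebesgue)"
      using le by (intro nn_integral_mono) (auto simp: indicator_def)
    finally show ?thesis unfolding plane_average_def nn_integral_completion .
  next
    case False
    then show ?thesis unfolding plane_transform_eq[OF grad] by (simp add: not_integrable_integral_eq)
  qed
qed

text \<open>The value \<open>\<infinity>\<close> on a Borel null set makes the majorant dominate \<open>f\<close> at every point, not only almost everywhere,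
  without changing its norm. Individual planes are null sets, so this matters.\<close>

lemma borel_majorant:
  fixes f :: "'a::euclidean_space \<Rightarrow> complex"
  assumes f: "f \<in> borel_measurable lebesgue" and S: "S \<in> sets borel" "\<forall>z. z \<notin> S \<longrightarrow> f z = 0"
  shows "\<exists>g. g \<in> borel_measurable borel \<and> (\<forall>w. ennreal (norm (f w)) \<le> g w) \<and> (\<forall>w. w \<notin> S \<longrightarrow> g w = 0) \<and>
    (AE w in lborel. g w = ennreal (norm (f w)))"
proof -
  have "(\<lambda>w. norm (f w)) \<in> borel_measurable lebesgue" using f by measurable
  then obtain h where h: "h \<in> borel_measurable lborel" "AE w in lborel. norm (f w) = h w"
    using completion_ex_borel_measurable_real by blast
  from h(2) obtain N where N: "N \<in> null_sets lborel" "{w \<in> space lborel. norm (f w) \<noteq> h w} \<subseteq> N"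
    unfolding eventually_ae_filter by auto
  have Nb: "N \<in> sets borel" using N by auto
  define g where "g w = (if w \<in> S then (if w \<in> N then top else ennreal (h w)) else 0)" for w
  have "g \<in> borel_measurable borel"
    unfolding g_def[abs_def] using h(1) Nb S(1)
    by (intro measurable_If_set measurable_const) (auto intro: measurable_compose[OF _ measurable_ennreal])
  moreover have eq: "norm (f w) = h w" if "w \<notin> N" for w using N(2) that by auto
  then have "ennreal (norm (f w)) \<le> g w" for w
    using S(2) by (simp add: g_def)
  moreover have "AE w in lborel. g w = ennreal (norm (f w))"
    using AE_not_in[OF N(1)]
  proof eventually_elim
    case (elim w)
    then show ?case using eq[of w] S(2) by (auto simp: g_def)
  qed
  ultimately show ?thesis by (intro exI[of _ g]) (simp add: g_def)
qed

text \<open>Almost every plane meets a given null set in a null set of parameters: the average over planes of its indicator has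
  integral zero.\<close>

lemma AE_plane_avoids_null_set:
  fixes A B :: "real^'n^'n"
  assumes N: "N \<in> sets borel" "emeasure lborel N = 0"
  shows "AE z in lborel. AE \<sigma> in lborel. \<sigma> \<in> param_square \<longrightarrow> plane_point A B z \<sigma> \<notin> N"
proof -
  have Nm: "(indicator N :: _ \<Rightarrow> ennreal) \<in> borel_measurable borel" using N(1) by (rule borel_measurable_indicator)
  have "(\<integral>\<^sup>+z. indicator UNIV (snd z) * plane_average A B (indicator N) z \<partial>lborel)
    \<le> emeasure lborel (UNIV :: (real^'n) set) * (\<integral>\<^sup>+w. indicator N w \<partial>lborel)"
    by (rule nn_integral_plane_average_le[OF Nm]) simp
  also have "\<dots> = 0" using N by simp
  finally have "(\<integral>\<^sup>+z. plane_average A B (indicator N) z \<partial>lborel) = 0" by simp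
  then have "AE z in lborel. plane_average A B (indicator N) z = 0"
    using plane_average_measurable[OF Nm, of A B] by (subst (asm) nn_integral_0_iff_AE) auto
  then show ?thesis
  proof eventually_elim
    case (elim z)
    have "(\<lambda>\<sigma>. indicator param_square \<sigma> * indicator N (plane_point A B z \<sigma>) :: ennreal) \<in> borel_measurable lborel"
      using plane_section_measurable[OF Nm, of A B z] by simp
    with elim have "AE \<sigma> in lborel. indicator param_square \<sigma> * indicator N (plane_point A B z \<sigma>) = (0::ennreal)"
      unfolding plane_average_def by (subst (asm) nn_integral_0_iff_AE)
    then show ?case by eventually_elim (auto simp: indicator_def split: if_splits)
  qed
qed

text \<open>Measurability matters because the essential supremum of a function that is not measurable is \<open>\<infinity>\<close> by
  definition. A Borel function that agrees with \<open>f\<close> almost everywhere has the same transform at almost every plane.\<close>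

lemma plane_transform_measurable:
  fixes A B :: "real^'n^'n"
  assumes grad: "\<And>\<xi>. grad Q1 \<xi> = A *v \<xi>" "\<And>\<xi>. grad Q2 \<xi> = B *v \<xi>"
    and f: "f \<in> borel_measurable lebesgue"
  shows "plane_transform Q1 Q2 f \<in> borel_measurable lebesgue"
proof -
  have "(\<lambda>w. Re (f w)) \<in> borel_measurable lebesgue" "(\<lambda>w. Im (f w)) \<in> borel_measurable lebesgue"
    using f by (auto intro: measurable_compose[OF f])
  from this[THEN completion_ex_borel_measurable_real]
  obtain h1 h2 where h: "h1 \<in> borel_measurable lborel" "AE w in lborel. Re (f w) = h1 w"
    "h2 \<in> borel_measurable lborel" "AE w in lborel. Im (f w) = h2 w"
    by blast
  define h where "h w = Complex (h1 w) (h2 w)" for w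
  have "h w = complex_of_real (h1 w) + \<i> * complex_of_real (h2 w)" for w
    by (simp add: h_def complex_eq_iff)
  then have hm: "h \<in> borel_measurable borel"
    using h(1,3) by (simp add: fun_eq_iff[symmetric] cong: measurable_cong)
  have "AE w in lborel. f w = h w"
    using h(2,4) by eventually_elim (simp add: h_def complex_eq_iff)
  then obtain N where N: "N \<in> null_sets lborel" "{w \<in> space lborel. f w \<noteq> h w} \<subseteq> N"
    unfolding eventually_ae_filter by auto
  have fh: "f w = h w" if "w \<notin> N" for w using N(2) that by auto
  have ae: "AE z in lborel. AE \<sigma> in lborel. \<sigma> \<in> param_square \<longrightarrow> plane_point A B z \<sigma> \<notin> N"
    using N by (intro AE_plane_avoids_null_set) auto
  let ?Th = "\<lambda>z. LINT \<sigma>|lborel. indicator param_square \<sigma> *\<^sub>R h (plane_point A B z \<sigma>)"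
  have Hj: "(\<lambda>w. indicator param_square (snd w) *\<^sub>R h (plane_point A B (fst w) (snd w))) \<in> borel_measurable borel"
  proof (rule borel_measurable_scaleR)
    show "(\<lambda>w :: ((real^'n) \<times> (real^'n)) \<times> (real \<times> real). indicator param_square (snd w) :: real) \<in> borel_measurable borel"
      by (rule measurable_borel_compose_continuous[OF borel_measurable_indicator[OF param_square_borel]]) (intro continuous_intros)
    show "(\<lambda>w. h (plane_point A B (fst w) (snd w))) \<in> borel_measurable borel"
      by (rule measurable_borel_compose_continuous[OF hm continuous_on_plane_point])
  qed
  have Hz: "(\<lambda>\<sigma>. indicator param_square \<sigma> *\<^sub>R h (plane_point A B z \<sigma>)) \<in> borel_measurable borel" for z
    using measurable_borel_compose_continuous[OF Hj, of "\<lambda>\<sigma>. (z, \<sigma>)"] by (simp add: continuous_intros)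
  have "(\<lambda>(z, \<sigma>). indicator param_square \<sigma> *\<^sub>R h (plane_point A B z \<sigma>)) \<in> borel_measurable (lborel \<Otimes>\<^sub>M lborel)"
    using Hj unfolding lborel_prod by (simp add: case_prod_beta')
  then have "?Th \<in> borel_measurable lborel"
    by (rule lborel.borel_measurable_lebesgue_integral)
  then have Thm: "?Th \<in> borel_measurable lebesgue" by (rule measurable_completion)
  have eq: "AE z in lebesgue. ?Th z = plane_transform Q1 Q2 f z"
    unfolding AE_completion_iff using ae
  proof eventually_elim
    case (elim z)
    let ?u = "\<lambda>\<sigma>. indicator param_square \<sigma> *\<^sub>R h (plane_point A B z \<sigma>)"
    let ?v = "\<lambda>\<sigma>. indicator param_square \<sigma> *\<^sub>R f (plane_point A B z \<sigma>)"
    have um: "?u \<in> borel_measurable lebesgue"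
      by (rule measurable_completion) (use Hz in simp)
    have uv: "AE \<sigma> in lebesgue. ?u \<sigma> = ?v \<sigma>"
      unfolding AE_completion_iff using elim by eventually_elim (auto simp: indicator_def fh)
    have vm: "?v \<in> borel_measurable lebesgue" by (rule borel_measurable_AE[OF um uv])
    have "?Th z = integral\<^sup>L lebesgue ?u"
      by (rule integral_completion[symmetric]) (use Hz in simp)
    also have "\<dots> = integral\<^sup>L lebesgue ?v" by (rule integral_cong_AE[OF um vm uv])
    finally show ?case unfolding plane_transform_eq[OF grad] .
  qed
  show ?thesis by (rule borel_measurable_AE[OF Thm eq])
qed

lemma unit_cube_eq_cbox: "(unit_cube :: (real^'n) set) = cbox (-1) 1"
  by (auto simp: unit_cube_def mem_box_cart)

lemma unit_cube_borel: "(unit_cube :: (real^'n) set) \<in> sets borel"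
  by (simp add: unit_cube_eq_cbox)

lemma emeasure_bounded_real:
  fixes S :: "'a::euclidean_space set"
  assumes "bounded S"
  obtains v where "0 \<le> v" "emeasure lborel S = ennreal v"
proof -
  have "emeasure lborel S < \<infinity>" by (rule emeasure_bounded_finite[OF assms])
  then show thesis using that by (cases "emeasure lborel S") auto
qed

lemma plane_displacement_bound:
  fixes A B :: "real^'n^'n"
  obtains a where "0 \<le> a" "\<And>\<xi> \<sigma>. \<xi> \<in> unit_cube \<Longrightarrow> \<sigma> \<in> param_square \<Longrightarrow>
     norm (fst \<sigma> *\<^sub>R (A *v \<xi>) + snd \<sigma> *\<^sub>R (B *v \<xi>)) \<le> a"
proof -
  have "compact (unit_cube \<times> param_square :: ((real^'n) \<times> real \<times> real) set)"
    unfolding unit_cube_eq_cbox by (intro compact_Times) auto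
  moreover have "continuous_on (unit_cube \<times> param_square) (\<lambda>w. fst (snd w) *\<^sub>R (A *v fst w) + snd (snd w) *\<^sub>R (B *v fst w))"
    by (intro continuous_intros bounded_linear.continuous_on[OF matrix_vector_mul_bounded_linear])
  ultimately have "bounded ((\<lambda>w. fst (snd w) *\<^sub>R (A *v fst w) + snd (snd w) *\<^sub>R (B *v fst w)) ` (unit_cube \<times> param_square))"
    by (intro compact_imp_bounded compact_continuous_image)
  then obtain a where a: "a > 0" "\<And>w. w \<in> unit_cube \<times> param_square \<Longrightarrow> norm (fst (snd w) *\<^sub>R (A *v fst w) + snd (snd w) *\<^sub>R (B *v fst w)) \<le> a"
    unfolding bounded_pos by auto
  have "norm (fst \<sigma> *\<^sub>R (A *v \<xi>) + snd \<sigma> *\<^sub>R (B *v \<xi>)) \<le> a" if "\<xi> \<in> unit_cube" "\<sigma> \<in> param_square" for \<xi> \<sigma>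
    using a(2)[of "(\<xi>, \<sigma>)"] that by simp
  then show thesis using that[of a] a(1) by simp
qed

text \<open>For \<open>\<xi>\<close> in the cube, planes move by a bounded amount, so planes based far away miss the support of \<open>g\<close>.\<close>

lemma plane_average_zero_far:
  fixes A B :: "real^'n^'n"
  assumes a: "\<And>\<xi> \<sigma>. \<xi> \<in> unit_cube \<Longrightarrow> \<sigma> \<in> param_square \<Longrightarrow>
     norm (fst \<sigma> *\<^sub>R (A *v \<xi>) + snd \<sigma> *\<^sub>R (B *v \<xi>)) \<le> a"
    and g: "\<And>w. w \<notin> ball 0 C \<times> param_square \<Longrightarrow> g w = 0"
    and z: "snd z \<in> unit_cube" "z \<notin> ball 0 (C + a) \<times> unit_cube"
  shows "plane_average A B g z = 0"
proof -
  have n: "norm (fst z) \<ge> C + a" using z by (auto simp: mem_Times_iff)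
  have "indicator param_square \<sigma> * g (plane_point A B z \<sigma>) = 0" for \<sigma>
  proof (cases "\<sigma> \<in> param_square")
    case True
    let ?y = "fst \<sigma> *\<^sub>R (A *v snd z) + snd \<sigma> *\<^sub>R (B *v snd z)"
    have "norm (fst z) \<le> norm (fst z - ?y) + norm ?y" by (metis norm_triangle_sub add.commute)
    then have "norm (fst z - ?y) \<ge> C" using n a[OF z(1) True] by linarith
    then have "plane_point A B z \<sigma> \<notin> ball 0 C \<times> param_square"
      by (simp add: plane_point_def mem_Times_iff diff_diff_eq)
    then show ?thesis using g by simp
  qed simp
  then have "plane_average A B g z = (\<integral>\<^sup>+\<sigma>. 0 \<partial>(lborel :: (real \<times> real) measure))"
    unfolding plane_average_def by (rule nn_integral_cong)
  then show ?thesis by simp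
qed

lemma nn_integral_lebesgue_on_cube:
  "(\<integral>\<^sup>+z. h z \<partial>lebesgue_on (UNIV \<times> (unit_cube :: (real^'n) set))) = (\<integral>\<^sup>+z. indicator unit_cube (snd z) * h z \<partial>lborel)"
  for h :: "(real^'n) \<times> (real^'n) \<Rightarrow> ennreal"
proof -
  have "closed (UNIV \<times> unit_cube :: ((real^'n) \<times> (real^'n)) set)"
    unfolding unit_cube_eq_cbox by (intro closed_Times) auto
  then have "(UNIV \<times> unit_cube :: ((real^'n) \<times> (real^'n)) set) \<in> sets lebesgue" by simp
  then have "(\<integral>\<^sup>+z. h z \<partial>lebesgue_on (UNIV \<times> (unit_cube :: (real^'n) set))) = (\<integral>\<^sup>+z. h z * indicator (UNIV \<times> unit_cube) z \<partial>lebesgue)"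
    by (intro nn_integral_restrict_space) simp
  also have "\<dots> = (\<integral>\<^sup>+z. indicator unit_cube (snd z) * h z \<partial>lebesgue)"
    by (intro nn_integral_cong) (auto simp: indicator_def)
  finally show ?thesis unfolding nn_integral_completion .
qed

section \<open>Estimates for stable pairs\<close>

lemma Lp_norm_finiteE:
  assumes p: "0 \<le> p" and fin: "Lp_norm (ennreal p) M f < \<infinity>"
  obtains x where "0 \<le> x" "(\<integral>\<^sup>+z. ennreal (norm (f z) powr p) \<partial>M) = ennreal x"
    "Lp_norm (ennreal p) M f = ennreal (x powr (1 / p))"
proof (cases "\<integral>\<^sup>+z. ennreal (norm (f z) powr p) \<partial>M")
  case (real x)
  then show thesis using that[of x] p by (simp add: Lp_norm_def Let_def)
next
  case top
  then have "Lp_norm (ennreal p) M f = \<infinity>" using p by (simp add: Lp_norm_def Let_def)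
  with fin show thesis by simp
qed

lemma Lp_norm_leI:
  assumes q: "0 < q" and y: "0 \<le> y" and le: "(\<integral>\<^sup>+z. ennreal (norm (f z) powr q) \<partial>M) \<le> ennreal y"
  shows "Lp_norm (ennreal q) M f \<le> ennreal (y powr (1 / q))"
proof (cases "\<integral>\<^sup>+z. ennreal (norm (f z) powr q) \<partial>M")
  case (real x)
  then have "x \<le> y" using le y by simp
  then show ?thesis using real q by (auto simp: Lp_norm_def Let_def intro!: ennreal_leI powr_mono2)
next
  case top
  then show ?thesis using le by (simp add: top_unique)
qed

lemma nn_integral_plane_transform_le:
  fixes A B :: "real^'n^'n"
  assumes grad: "\<And>\<xi>. grad Q1 \<xi> = A *v \<xi>" "\<And>\<xi>. grad Q2 \<xi> = B *v \<xi>"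
    and le: "\<And>w. ennreal (norm (f w)) \<le> g w" and q: "0 \<le> q"
  shows "(\<integral>\<^sup>+z. ennreal (norm (plane_transform Q1 Q2 f z) powr q) \<partial>lebesgue_on (UNIV \<times> unit_cube))
    \<le> (\<integral>\<^sup>+z. indicator unit_cube (snd z) * epowr (plane_average A B g z) q \<partial>lborel)"
  unfolding nn_integral_lebesgue_on_cube
proof (rule nn_integral_mono)
  fix z :: "(real^'n) \<times> (real^'n)"
  have "ennreal (norm (plane_transform Q1 Q2 f z) powr q) = epowr (ennreal (norm (plane_transform Q1 Q2 f z))) q"
    by simp
  also have "\<dots> \<le> epowr (plane_average A B g z) q"
    by (rule epowr_mono[OF norm_plane_transform_le[OF grad le] q])
  finally show "indicator unit_cube (snd z) * ennreal (norm (plane_transform Q1 Q2 f z) powr q)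
    \<le> indicator unit_cube (snd z) * epowr (plane_average A B g z) q"
    by (rule mult_left_mono) simp
qed

text \<open>With the best \<open>L\<close>, this replaces Hoelder's inequality on a set of finite measure.\<close>

lemma lower_exponent_pointwise:
  assumes L: "0 < L" and q: "0 < q" "q \<le> q1"
  shows "epowr F q \<le> ennreal (L powr q) + ennreal (L powr (q - q1)) * epowr F q1"
proof (cases F)
  case (real y)
  have "y powr q \<le> L powr q + L powr (q - q1) * y powr q1"
  proof (cases "y \<le> L")
    case True
    then have "y powr q \<le> L powr q" using real q by (intro powr_mono2) auto
    then show ?thesis by (simp add: add_increasing2)
  next
    case False
    then have "y powr q = y powr (q - q1) * y powr q1" by (simp flip: powr_add)
    also have "\<dots> \<le> L powr (q - q1) * y powr q1"
      using False L q by (intro mult_right_mono powr_mono2') auto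
    finally show ?thesis by (simp add: add_increasing)
  qed
  then show ?thesis using real by (simp flip: ennreal_mult ennreal_plus)
next
  case top
  then show ?thesis using L by (simp add: ennreal_mult_top)
qed

lemma ennreal_eq_zero_if_le_powr:
  fixes J :: ennreal
  assumes q: "0 < q" and \<omega>: "0 \<le> \<omega>" and le: "\<And>L. 0 < L \<Longrightarrow> J \<le> ennreal (L powr q * \<omega>)"
  shows "J = 0"
proof (cases J)
  case (real \<rho>)
  show ?thesis
  proof (rule ccontr)
    assume "J \<noteq> 0"
    then have \<rho>: "0 < \<rho>" using real by (cases "\<rho> = 0") auto
    define L where "L = (\<rho> / (2 * (\<omega> + 1))) powr (1 / q)"
    have L: "0 < L" using \<rho> \<omega> by (simp add: L_def)
    have "L powr q = \<rho> / (2 * (\<omega> + 1))" using \<rho> \<omega> q by (simp add: L_def powr_powr)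
    with le[OF L] real \<rho> \<omega> have "\<rho> \<le> \<rho> / (2 * (\<omega> + 1)) * \<omega>" by simp
    also have "\<dots> = \<rho> * (\<omega> / (2 * (\<omega> + 1)))" by simp
    also have "\<dots> < \<rho> * 1" using \<rho> \<omega> by (intro mult_strict_left_mono) (auto simp: field_simps)
    finally show False by simp
  qed
next
  case top
  then show ?thesis using le[of 1] by (simp add: top_unique)
qed

text \<open>On the cube the transform lives on the set \<open>\<Omega>\<close> of finite measure, so an estimate with the exponent
  \<open>p (1 + \<theta>)\<close> implies those with smaller \<open>q\<close>.\<close>

lemma plane_transform_estimate_finite_exponents:
  fixes A B :: "real^'n^'n"
  assumes grad: "\<And>\<xi>. grad Q1 \<xi> = A *v \<xi>" "\<And>\<xi>. grad Q2 \<xi> = B *v \<xi>"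
    and p: "1 \<le> p" and \<theta>: "0 \<le> \<theta>" and q: "0 < q" "q \<le> p * (1 + \<theta>)" and K0: "0 \<le> K0"
    and strong: "\<And>g x. g \<in> borel_measurable borel \<Longrightarrow> 0 \<le> x \<Longrightarrow> (\<integral>\<^sup>+w. epowr (g w) p \<partial>lborel) = ennreal x \<Longrightarrow>
       (\<integral>\<^sup>+z. indicator unit_cube (snd z) * epowr (plane_average A B g z) (p * (1 + \<theta>)) \<partial>lborel)
         \<le> ennreal (K0 * x powr (1 + \<theta>))"
  shows "\<exists>K\<ge>0. plane_transform_estimate Q1 Q2 C (ennreal p) (ennreal q) K"
proof -
  define q1 where "q1 = p * (1 + \<theta>)"
  obtain a where a: "0 \<le> a" "\<And>\<xi> \<sigma>. \<xi> \<in> unit_cube \<Longrightarrow> \<sigma> \<in> param_square \<Longrightarrow>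
     norm (fst \<sigma> *\<^sub>R (A *v \<xi>) + snd \<sigma> *\<^sub>R (B *v \<xi>)) \<le> a"
    using plane_displacement_bound by blast
  define \<Omega> where "\<Omega> = ball (0 :: real^'n) (C + a) \<times> (unit_cube :: (real^'n) set)"
  have "bounded \<Omega>" unfolding \<Omega>_def unit_cube_eq_cbox by (intro bounded_Times) auto
  then obtain \<omega> where \<omega>: "0 \<le> \<omega>" "emeasure lborel \<Omega> = ennreal \<omega>" by (rule emeasure_bounded_real)
  have \<Omega>: "\<Omega> \<in> sets borel" unfolding \<Omega>_def by (intro borel_Times unit_cube_borel) simp
  have "plane_transform_estimate Q1 Q2 C (ennreal p) (ennreal q) ((\<omega> + K0) powr (1 / q))"
    unfolding plane_transform_estimate_def
  proof (intro allI impI)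
    fix f :: "(real^'n) \<times> real \<times> real \<Rightarrow> complex"
    assume f: "f \<in> borel_measurable lebesgue" and fin: "Lp_norm (ennreal p) lebesgue f < \<infinity>"
      and supp: "\<forall>z. z \<notin> ball 0 C \<times> {-1..1} \<times> {-1..1} \<longrightarrow> f z = 0"
    obtain x where x: "0 \<le> x" "(\<integral>\<^sup>+z. ennreal (norm (f z) powr p) \<partial>lebesgue) = ennreal x"
      "Lp_norm (ennreal p) lebesgue f = ennreal (x powr (1 / p))"
      using Lp_norm_finiteE[OF _ fin] p by auto
    have ball: "ball (0::real^'n) C \<times> param_square \<in> sets borel"
      by (intro borel_Times) auto
    have f0: "f z = 0" if "z \<notin> ball 0 C \<times> param_square" for z using supp that by blast
    obtain g where g: "g \<in> borel_measurable borel" "\<And>w. ennreal (norm (f w)) \<le> g w"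
      "\<And>w. w \<notin> ball 0 C \<times> param_square \<Longrightarrow> g w = 0" "AE w in lborel. g w = ennreal (norm (f w))"
      using borel_majorant[OF f ball] f0 by blast
    have "(\<integral>\<^sup>+w. epowr (g w) p \<partial>lborel) = (\<integral>\<^sup>+w. ennreal (norm (f w) powr p) \<partial>lborel)"
      by (rule nn_integral_cong_AE) (use g(4) in \<open>auto elim: eventually_mono\<close>)
    also have "\<dots> = ennreal x" using x(2) unfolding nn_integral_completion .
    finally have gx: "(\<integral>\<^sup>+w. epowr (g w) p \<partial>lborel) = ennreal x" .
    let ?F = "plane_average A B g"
    have F: "?F \<in> borel_measurable borel" by (rule plane_average_measurable[OF g(1)])
    have Fq1: "(\<lambda>z. indicator unit_cube (snd z) * epowr (?F z) q1) \<in> borel_measurable borel"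
    proof (rule borel_measurable_times_ennreal)
      show "(\<lambda>z. indicator unit_cube (snd z) :: ennreal) \<in> borel_measurable (borel :: ((real^'n) \<times> (real^'n)) measure)"
        by (rule measurable_borel_compose_continuous[OF borel_measurable_indicator[OF unit_cube_borel]]) (intro continuous_intros)
      show "(\<lambda>z. epowr (?F z) q1) \<in> borel_measurable borel"
        by (rule measurable_compose[OF F epowr_measurable])
    qed
    define J where "J = (\<integral>\<^sup>+z. indicator unit_cube (snd z) * epowr (?F z) q \<partial>lborel)"
    have key: "J \<le> ennreal (L powr q * \<omega> + L powr (q - q1) * (K0 * x powr (1 + \<theta>)))" if L: "0 < L" for L
    proof -
      have "J \<le> (\<integral>\<^sup>+z. ennreal (L powr q) * indicator \<Omega> z
          + ennreal (L powr (q - q1)) * (indicator unit_cube (snd z) * epowr (?F z) q1) \<partial>lborel)"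
        unfolding J_def
      proof (rule nn_integral_mono)
        fix z
        show "indicator unit_cube (snd z) * epowr (?F z) q \<le> ennreal (L powr q) * indicator \<Omega> z
          + ennreal (L powr (q - q1)) * (indicator unit_cube (snd z) * epowr (?F z) q1)"
        proof (cases "snd z \<in> unit_cube")
          case True
          show ?thesis
          proof (cases "z \<in> \<Omega>")
            case True
            then show ?thesis using lower_exponent_pointwise[OF L q, of "?F z"] \<open>snd z \<in> unit_cube\<close>
              by (simp add: q1_def)
          next
            case False
            then have "?F z = 0"
              using plane_average_zero_far[OF a(2) g(3) \<open>snd z \<in> unit_cube\<close>] by (simp add: \<Omega>_def)
            then show ?thesis using q by (simp add: epowr_def)
          qed
        qed simp
      qed
      also have "\<dots> = (\<integral>\<^sup>+z. ennreal (L powr q) * indicator \<Omega> z \<partial>lborel)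
          + (\<integral>\<^sup>+z. ennreal (L powr (q - q1)) * (indicator unit_cube (snd z) * epowr (?F z) q1) \<partial>lborel)"
        by (rule nn_integral_add) (use \<Omega> Fq1 in simp_all)
      also have "(\<integral>\<^sup>+z. ennreal (L powr q) * indicator \<Omega> z \<partial>lborel) = ennreal (L powr q * \<omega>)"
        using \<Omega> \<omega> by (simp add: nn_integral_cmult_indicator ennreal_mult)
      also have "(\<integral>\<^sup>+z. ennreal (L powr (q - q1)) * (indicator unit_cube (snd z) * epowr (?F z) q1) \<partial>lborel)
          = ennreal (L powr (q - q1)) * (\<integral>\<^sup>+z. indicator unit_cube (snd z) * epowr (?F z) q1 \<partial>lborel)"
        by (rule nn_integral_cmult) (use Fq1 in simp)
      also have "\<dots> \<le> ennreal (L powr (q - q1)) * ennreal (K0 * x powr (1 + \<theta>))"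
        using strong[OF g(1) x(1) gx] unfolding q1_def by (rule mult_left_mono) simp
      finally show ?thesis using \<omega> K0 by (simp flip: ennreal_mult ennreal_plus)
    qed
    have J: "J \<le> ennreal ((\<omega> + K0) * x powr (q / p))"
    proof (cases "x = 0")
      case True
      (* Letting L tend to zero. *)
      then have "J = 0" using key q \<omega> by (intro ennreal_eq_zero_if_le_powr[of q \<omega>]) auto
      then show ?thesis by simp
    next
      case False
      then have x0: "0 < x" using x by simp
      (* Both terms of the estimate then scale like the power q of the norm of f. *)
      define L where "L = x powr (1 / p)"
      have L: "0 < L" using x0 by (simp add: L_def)
      have 1: "L powr q = x powr (q / p)" by (simp add: L_def powr_powr)
      have "1 / p * (q - q1) + (1 + \<theta>) = q / p" using p by (simp add: q1_def field_simps)
      then have 2: "L powr (q - q1) * x powr (1 + \<theta>) = x powr (q / p)"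
        unfolding L_def powr_powr powr_add[symmetric] by simp
      have "L powr q * \<omega> + L powr (q - q1) * (K0 * x powr (1 + \<theta>))
        = L powr q * \<omega> + K0 * (L powr (q - q1) * x powr (1 + \<theta>))" by simp
      also have "\<dots> = (\<omega> + K0) * x powr (q / p)" unfolding 1 2 by (simp add: algebra_simps)
      finally show ?thesis using key[OF L] by simp
    qed
    have "(\<integral>\<^sup>+z. ennreal (norm (plane_transform Q1 Q2 f z) powr q) \<partial>lebesgue_on (UNIV \<times> unit_cube))
      \<le> ennreal ((\<omega> + K0) * x powr (q / p))"
      using nn_integral_plane_transform_le[OF grad g(2), of q] q J unfolding J_def by (meson less_imp_le order_trans)
    from Lp_norm_leI[OF q(1) _ this]
    have "Lp_norm (ennreal q) (lebesgue_on (UNIV \<times> unit_cube)) (plane_transform Q1 Q2 f)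
      \<le> ennreal (((\<omega> + K0) * x powr (q / p)) powr (1 / q))" using \<omega> K0 by simp
    also have "((\<omega> + K0) * x powr (q / p)) powr (1 / q) = (\<omega> + K0) powr (1 / q) * x powr (1 / p)"
      using \<omega> K0 q by (simp add: powr_mult powr_powr)
    finally show "Lp_norm (ennreal q) (lebesgue_on (UNIV \<times> unit_cube)) (plane_transform Q1 Q2 f)
      \<le> ennreal ((\<omega> + K0) powr (1 / q)) * Lp_norm (ennreal p) lebesgue f"
      using x by (simp add: ennreal_mult)
  qed
  then show ?thesis by (intro exI[of _ "(\<omega> + K0) powr (1 / q)"]) simp
qed

lemma plane_average_bounded_AE:
  fixes A B :: "real^'n^'n"
  assumes g: "g \<in> borel_measurable borel" and le: "AE w in lborel. g w \<le> ennreal \<mu>"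
  shows "AE z in lborel. plane_average A B g z \<le> ennreal \<mu> * emeasure lborel param_square"
proof -
  from le obtain N where N: "N \<in> null_sets lborel" "{w \<in> space lborel. \<not> g w \<le> ennreal \<mu>} \<subseteq> N"
    unfolding eventually_ae_filter by auto
  have gN: "g w \<le> ennreal \<mu>" if "w \<notin> N" for w using N(2) that by auto
  have "AE z in lborel. AE \<sigma> in lborel. \<sigma> \<in> param_square \<longrightarrow> plane_point A B z \<sigma> \<notin> N"
    using N by (intro AE_plane_avoids_null_set) auto
  then show ?thesis
  proof eventually_elim
    case (elim z)
    have "plane_average A B g z \<le> (\<integral>\<^sup>+\<sigma>. ennreal \<mu> * indicator param_square \<sigma> \<partial>lborel)"
      unfolding plane_average_def
    proof (rule nn_integral_mono_AE)
      from elim show "AE \<sigma> in lborel. indicator param_square \<sigma> * g (plane_point A B z \<sigma>) \<le> ennreal \<mu> * indicator param_square \<sigma>"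
      proof eventually_elim
        case (elim \<sigma>)
        then show ?case using gN by (cases "\<sigma> \<in> param_square") auto
      qed
    qed
    also have "\<dots> = ennreal \<mu> * emeasure lborel param_square"
      by (rule nn_integral_cmult_indicator) (use param_square_borel in simp)
    finally show ?case .
  qed
qed

text \<open>Averages over the parameter square are bounded by the supremum, and they vanish outside a set of finite measure.\<close>

lemma plane_transform_estimate_infinite_exponent:
  fixes A B :: "real^'n^'n"
  assumes grad: "\<And>\<xi>. grad Q1 \<xi> = A *v \<xi>" "\<And>\<xi>. grad Q2 \<xi> = B *v \<xi>" and q: "1 \<le> q"
  shows "\<exists>K\<ge>0. plane_transform_estimate Q1 Q2 C \<infinity> q K"
proof -
  obtain a where a: "0 \<le> a" "\<And>\<xi> \<sigma>. \<xi> \<in> unit_cube \<Longrightarrow> \<sigma> \<in> param_square \<Longrightarrow>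
     norm (fst \<sigma> *\<^sub>R (A *v \<xi>) + snd \<sigma> *\<^sub>R (B *v \<xi>)) \<le> a"
    using plane_displacement_bound by blast
  define \<Omega> where "\<Omega> = ball (0 :: real^'n) (C + a) \<times> (unit_cube :: (real^'n) set)"
  have "bounded \<Omega>" unfolding \<Omega>_def unit_cube_eq_cbox by (intro bounded_Times) auto
  then obtain \<omega> where \<omega>: "0 \<le> \<omega>" "emeasure lborel \<Omega> = ennreal \<omega>" by (rule emeasure_bounded_real)
  have \<Omega>: "\<Omega> \<in> sets borel" unfolding \<Omega>_def by (intro borel_Times unit_cube_borel) simp
  have "bounded param_square" by (intro bounded_Times) auto
  then obtain s where s: "0 \<le> s" "emeasure lborel param_square = ennreal s" by (rule emeasure_bounded_real)
  have cube: "(UNIV \<times> unit_cube :: ((real^'n) \<times> (real^'n)) set) \<in> sets lebesgue"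
  proof -
    have "closed (UNIV \<times> unit_cube :: ((real^'n) \<times> (real^'n)) set)"
      unfolding unit_cube_eq_cbox by (intro closed_Times) auto
    then show ?thesis by simp
  qed
  define K where "K = (if q = \<infinity> then s else s * \<omega> powr (1 / enn2real q))"
  have "plane_transform_estimate Q1 Q2 C \<infinity> q K"
    unfolding plane_transform_estimate_def
  proof (intro allI impI)
    fix f :: "(real^'n) \<times> real \<times> real \<Rightarrow> complex"
    assume f: "f \<in> borel_measurable lebesgue" and fin: "Lp_norm \<infinity> lebesgue f < \<infinity>"
      and supp: "\<forall>z. z \<notin> ball 0 C \<times> {-1..1} \<times> {-1..1} \<longrightarrow> f z = 0"
    have Lf: "Lp_norm \<infinity> lebesgue f = esssup lebesgue (\<lambda>w. ennreal (norm (f w)))"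
      by (simp add: Lp_norm_def)
    obtain \<mu> where \<mu>: "0 \<le> \<mu>" "Lp_norm \<infinity> lebesgue f = ennreal \<mu>"
      using fin by (cases "Lp_norm \<infinity> lebesgue f") auto
    have "AE w in lebesgue. ennreal (norm (f w)) \<le> ennreal \<mu>"
      using esssup_AE[of "\<lambda>w. ennreal (norm (f w))" lebesgue] unfolding \<mu>(2)[symmetric] Lf .
    then have f\<mu>: "AE w in lborel. ennreal (norm (f w)) \<le> ennreal \<mu>" unfolding AE_completion_iff .
    have ball: "ball (0::real^'n) C \<times> param_square \<in> sets borel"
      by (intro borel_Times) auto
    have f0: "f z = 0" if "z \<notin> ball 0 C \<times> param_square" for z using supp that by blast
    obtain g where g: "g \<in> borel_measurable borel" "\<And>w. ennreal (norm (f w)) \<le> g w"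
      "\<And>w. w \<notin> ball 0 C \<times> param_square \<Longrightarrow> g w = 0" "AE w in lborel. g w = ennreal (norm (f w))"
      using borel_majorant[OF f ball] f0 by blast
    let ?F = "plane_average A B g"
    have "AE w in lborel. g w \<le> ennreal \<mu>" using g(4) f\<mu> by eventually_elim simp
    from plane_average_bounded_AE[OF g(1) this, of A B]
    have F: "AE z in lborel. ?F z \<le> ennreal (\<mu> * s)" unfolding s(2) using \<mu> s by (simp add: ennreal_mult)
    show "Lp_norm q (lebesgue_on (UNIV \<times> unit_cube)) (plane_transform Q1 Q2 f) \<le> ennreal K * Lp_norm \<infinity> lebesgue f"
    proof (cases "q = \<infinity>")
      case True
      have T: "plane_transform Q1 Q2 f \<in> borel_measurable (lebesgue_on (UNIV \<times> unit_cube))"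
        by (rule measurable_restrict_space1[OF plane_transform_measurable[OF grad f]])
      have "AE z in lebesgue. ennreal (norm (plane_transform Q1 Q2 f z)) \<le> ennreal (\<mu> * s)"
        unfolding AE_completion_iff using F
        by eventually_elim (rule order_trans[OF norm_plane_transform_le[OF grad g(2)]])
      then have "AE z in lebesgue_on (UNIV \<times> unit_cube). ennreal (norm (plane_transform Q1 Q2 f z)) \<le> ennreal (\<mu> * s)"
        using cube by (subst AE_restrict_space_iff) (auto elim: eventually_mono)
      then have "esssup (lebesgue_on (UNIV \<times> unit_cube)) (\<lambda>z. ennreal (norm (plane_transform Q1 Q2 f z))) \<le> ennreal (\<mu> * s)"
        using T by (intro esssup_I) auto
      then show ?thesis using True \<mu> s by (simp add: Lp_norm_def K_def ennreal_mult mult.commute)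
    next
      case False
      then obtain q' where q': "q = ennreal q'" "0 \<le> q'" by (cases q) auto
      then have q'1: "1 \<le> q'" using q by simp
      have "(\<integral>\<^sup>+z. indicator unit_cube (snd z) * epowr (?F z) q' \<partial>lborel)
        \<le> (\<integral>\<^sup>+z. ennreal ((\<mu> * s) powr q') * indicator \<Omega> z \<partial>lborel)"
      proof (rule nn_integral_mono_AE)
        show "AE z in lborel. indicator unit_cube (snd z) * epowr (?F z) q' \<le> ennreal ((\<mu> * s) powr q') * indicator \<Omega> z"
          using F
        proof eventually_elim
          case (elim z)
          have e: "epowr (?F z) q' \<le> ennreal ((\<mu> * s) powr q')"
            using epowr_mono[OF elim, of q'] q' \<mu> s by simp
          show ?case
          proof (cases "snd z \<in> unit_cube \<and> z \<notin> \<Omega>")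
            case True
            then have "?F z = 0"
              using plane_average_zero_far[OF a(2) g(3) True[THEN conjunct1]] by (simp add: \<Omega>_def)
            then show ?thesis using q by (simp add: epowr_def)
          next
            case False
            then show ?thesis using e by (auto simp: indicator_def)
          qed
        qed
      qed
      also have "\<dots> = ennreal ((\<mu> * s) powr q' * \<omega>)"
        using \<Omega> \<omega> by (simp add: nn_integral_cmult_indicator ennreal_mult)
      finally have "(\<integral>\<^sup>+z. ennreal (norm (plane_transform Q1 Q2 f z) powr q') \<partial>lebesgue_on (UNIV \<times> unit_cube))
        \<le> ennreal ((\<mu> * s) powr q' * \<omega>)"
        using nn_integral_plane_transform_le[OF grad g(2) q'(2)] by (rule order_trans[rotated])
      from Lp_norm_leI[OF _ _ this]
      have "Lp_norm q (lebesgue_on (UNIV \<times> unit_cube)) (plane_transform Q1 Q2 f)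
        \<le> ennreal (((\<mu> * s) powr q' * \<omega>) powr (1 / q'))" using q' q'1 \<omega> by simp
      also have "((\<mu> * s) powr q' * \<omega>) powr (1 / q') = K * \<mu>"
        using \<mu> s \<omega> q' q'1 by (simp add: powr_mult powr_powr K_def)
      finally show ?thesis using \<mu> K_def s \<omega> by (simp add: ennreal_mult)
    qed
  qed
  moreover have "0 \<le> K" using s by (simp add: K_def)
  ultimately show ?thesis by blast
qed

text \<open>The conditions on \<open>b\<close> allow every \<open>1 + 1 / b > (d + 2) / 2\<close>. Thus \<open>\<theta>\<close> must satisfy
  \<open>(d + 2) \<theta> < 2 (p (1 + \<theta>) - 1)\<close>, which for \<open>q = p (1 + \<theta>)\<close> is the first condition on the exponents, while
  \<open>\<theta> \<le> 1\<close> is the second one. If \<open>q \<le> p\<close>, any small \<open>\<theta>\<close> will do.\<close>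

lemma interpolation_exponents_exist:
  fixes d p q :: real
  assumes d: "0 < d" and p: "1 \<le> p" and q: "1 \<le> q"
    and scaling: "(d + 2) / p < 2 + d / q" and ratio: "1 / p \<le> 2 / q"
  obtains \<theta> b where "0 < \<theta>" "\<theta> \<le> 1" "0 < b" "d * b < 2" "q \<le> p * (1 + \<theta>)" "1 + \<theta> * (1 + 1 / b) < p * (1 + \<theta>)"
proof -
  have scaling': "(d + 2) * q < (2 * q + d) * p"
    using scaling p q by (simp add: field_simps)
  have ratio': "q \<le> 2 * p" using ratio p q by (simp add: field_simps)
  have p1: "1 < p"
  proof (rule ccontr)
    assume "\<not> 1 < p"
    then have "p = 1" using p by simp
    with scaling' have "d * q < d * 1" by (simp add: algebra_simps)
    then show False using d q by simp
  qed
  have "\<exists>\<theta>. 0 < \<theta> \<and> \<theta> \<le> 1 \<and> q \<le> p * (1 + \<theta>) \<and> (d + 2) * \<theta> < 2 * (p * (1 + \<theta>) - 1)"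
  proof (cases "p < q")
    case True
    have "(d + 2) * (q / p - 1) < 2 * (q - 1)"
      using scaling' p by (simp add: field_simps)
    then show ?thesis using True p ratio'
      by (intro exI[of _ "q / p - 1"]) (simp add: field_simps)
  next
    case False
    (* p > 1 leaves room for a positive \<theta>. *)
    define \<theta> where "\<theta> = min 1 ((p - 1) / (d + 2))"
    have \<theta>: "0 < \<theta>" "\<theta> \<le> 1" "\<theta> \<le> (p - 1) / (d + 2)" using p1 d by (auto simp: \<theta>_def)
    have "(d + 2) * \<theta> \<le> p - 1" using \<theta>(3) d by (simp add: field_simps)
    moreover have "0 < p * \<theta>" using p1 \<theta> by simp
    moreover have "p * (1 + \<theta>) = p + p * \<theta>" by (simp add: algebra_simps)
    ultimately have X: "q \<le> p * (1 + \<theta>)" "(d + 2) * \<theta> < p * (1 + \<theta>) - 1" "0 < p * (1 + \<theta>) - 1"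
      using False p1 by linarith+
    have "y < 2 * Y" if "y < Y" "0 < Y" for y Y :: real using that by linarith
    from this[OF X(2,3)] have "(d + 2) * \<theta> < 2 * (p * (1 + \<theta>) - 1)" .
    with X(1) \<theta> show ?thesis by blast
  qed
  then obtain \<theta> where \<theta>: "0 < \<theta>" "\<theta> \<le> 1" "q \<le> p * (1 + \<theta>)" "(d + 2) * \<theta> < 2 * (p * (1 + \<theta>) - 1)" by blast
  define u where "u = (p * (1 + \<theta>) - 1) / \<theta>"
  have u: "(d + 2) / 2 < u" using \<theta> by (simp add: u_def field_simps)
  (* r = 1 + 1 / b is the midpoint of the interval of admissible values. *)
  define r where "r = ((d + 2) / 2 + u) / (1 + 1)"
  have r: "(d + 2) / 2 < r" "r < u"
    unfolding r_def using less_half_sum[OF u] gt_half_sum[OF u] by simp_all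
  have r1: "d / 2 < r - 1" using r by (simp add: add_divide_distrib)
  have r0: "0 < r - 1" using r1 d by linarith
  have "d * (1 / (r - 1)) < 2" using r1 r0 by (simp add: field_simps)
  moreover have "1 + \<theta> * (1 + 1 / (1 / (r - 1))) < p * (1 + \<theta>)"
  proof -
    have "\<theta> * r < \<theta> * u" using r \<theta> by simp
    also have "\<theta> * u = p * (1 + \<theta>) - 1" using \<theta> by (simp add: u_def)
    finally show ?thesis by simp
  qed
  ultimately show thesis using that[of \<theta> "1 / (r - 1)"] \<theta> r0 by simp
qed

lemma stable_pair_estimate:
  fixes A B :: "real^'n^'n" and p q :: ennreal
  assumes grad: "\<And>\<xi>. grad Q1 \<xi> = A *v \<xi>" "\<And>\<xi>. grad Q2 \<xi> = B *v \<xi>"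
    and sym: "transpose A = A" "transpose B = B" and stable: "\<not> unstable_pair A B"
    and p: "1 \<le> p" and q: "1 \<le> q"
    and scaling: "(of_nat CARD('n) + 2) / p < 2 + of_nat CARD('n) / q" and ratio: "1 / p \<le> 2 / q"
  shows "\<exists>K\<ge>0. plane_transform_estimate Q1 Q2 C p q K"
proof (cases "p = \<infinity>")
  case True
  then show ?thesis using plane_transform_estimate_infinite_exponent[OF grad q] by simp
next
  case False
  then obtain p' where p': "p = ennreal p'" "0 \<le> p'" by (cases p) auto
  then have p1: "1 \<le> p'" using p by simp
  have "q \<noteq> \<infinity>"
  proof
    assume "q = \<infinity>"
    then have "1 / ennreal p' = 0" using ratio p' by simp
    moreover have "1 / ennreal p' = ennreal (1 / p')" using p1 divide_ennreal[of 1 p'] by simp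
    ultimately show False using p1 by (simp add: ennreal_eq_0_iff)
  qed
  then obtain q' where q': "q = ennreal q'" "0 \<le> q'" by (cases q) auto
  then have q1: "1 \<le> q'" using q by simp
  let ?d = "real CARD('n)"
  have 1: "(of_nat CARD('n) + 2) / ennreal p' = ennreal ((?d + 2) / p')"
  proof -
    have "(of_nat CARD('n) + 2 :: ennreal) = ennreal (?d + 2)"
      by (simp add: ennreal_of_nat_eq_real_of_nat ennreal_plus)
    then show ?thesis using p1 by (simp only:) (rule divide_ennreal, auto)
  qed
  have 2: "2 + of_nat CARD('n) / ennreal q' = ennreal (2 + ?d / q')"
    using q1 by (simp add: ennreal_of_nat_eq_real_of_nat divide_ennreal ennreal_plus)
  have 3: "1 / ennreal p' = ennreal (1 / p')" using p1 divide_ennreal[of 1 p'] by simp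
  have 4: "2 / ennreal q' = ennreal (2 / q')" using q1 divide_ennreal[of 2 q'] by simp
  have "(?d + 2) / p' < 2 + ?d / q'"
    using scaling p1 q1 unfolding p' q' 1 2 by (subst (asm) ennreal_less_iff) auto
  moreover have "1 / p' \<le> 2 / q'"
    using ratio p1 q1 unfolding p' q' 3 4 by (subst (asm) ennreal_le_iff) auto
  ultimately obtain \<theta> b where \<theta>: "0 < \<theta>" "\<theta> \<le> 1" and b: "0 < b" "?d * b < 2"
    and e: "q' \<le> p' * (1 + \<theta>)" "1 + \<theta> * (1 + 1 / b) < p' * (1 + \<theta>)"
    using interpolation_exponents_exist[of ?d p' q'] p1 q1 by auto
  obtain C0 where C0: "0 < C0" "\<And>\<sigma>. \<sigma> \<in> param_square \<Longrightarrow>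
      (\<integral>\<^sup>+\<tau>. indicator param_square \<tau> * inverse (ennreal (\<bar>pencil_det A B (\<sigma> - \<tau>)\<bar> powr b)) \<partial>lborel) \<le> ennreal C0"
    using inverse_det_pencil_integrable[OF stable sym b] unfolding pencil_det_def by blast
  obtain v where v: "0 \<le> v" "emeasure lborel (unit_cube :: (real^'n) set) = ennreal v"
    using emeasure_bounded_real[of "unit_cube :: (real^'n) set"] unfolding unit_cube_eq_cbox by auto
  obtain K0 where K0: "0 \<le> K0" "\<And>g x. g \<in> borel_measurable borel \<Longrightarrow> 0 \<le> x \<Longrightarrow>
      (\<integral>\<^sup>+w. epowr (g w) p' \<partial>lborel) = ennreal x \<Longrightarrow>
      (\<integral>\<^sup>+z. indicator unit_cube (snd z) * epowr (plane_average A B g z) (p' * (1 + \<theta>)) \<partial>lborel)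
        \<le> ennreal (K0 * x powr (1 + \<theta>))"
    using plane_average_strong_type[OF b(1) C0 unit_cube_borel v(2,1) \<theta> _ refl e(2)] p1 by auto
  have "\<exists>K\<ge>0. plane_transform_estimate Q1 Q2 C (ennreal p') (ennreal q') K"
    by (rule plane_transform_estimate_finite_exponents[OF grad p1 less_imp_le[OF \<theta>(1)] _ e(1) K0]) (use q1 in simp)
  then show ?thesis unfolding p' q' .
qed

theorem theorem1:
  fixes Q1 Q2 :: "real^'n \<Rightarrow> real" and C :: real
  assumes "CARD('n) \<ge> 2"
    and "quadratic_form Q1" and "quadratic_form Q2"
    and "C > 0"
  shows "(well_curved Q1 Q2 \<longrightarrow>
            (\<forall>p q :: ennreal. 1 \<le> p \<longrightarrow> 1 \<le> q \<longrightarrow>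
               2 + of_nat CARD('n) / q > (of_nat CARD('n) + 2) / p \<longrightarrow>
               2 / q \<ge> 1 / p \<longrightarrow>
               (\<exists>K\<ge>0. plane_transform_estimate Q1 Q2 C p q K))) \<and>
         (\<not> well_curved Q1 Q2 \<longrightarrow>
            (\<exists>U :: (ennreal \<times> ennreal) set. open U \<and>
               (ennreal ((real CARD('n) + 4) / 4), ennreal ((real CARD('n) + 4) / 2)) \<in> U \<and>
               (\<forall>(p, q)\<in>U. 1 \<le> p \<longrightarrow> 1 \<le> q \<longrightarrow>
                  \<not> (\<exists>K\<ge>0. plane_transform_estimate Q1 Q2 C p q K))))"
proof -
  obtain A where A: "transpose A = A" "\<And>x. Q1 x = (x \<bullet> (A *v x)) / 2"
    using quadratic_form_hessian[OF assms(2)] by blast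
  obtain B where B: "transpose B = B" "\<And>x. Q2 x = (x \<bullet> (B *v x)) / 2"
    using quadratic_form_hessian[OF assms(3)] by blast
  note grad = grad_quadratic[OF A] grad_quadratic[OF B]
  have iff: "well_curved Q1 Q2 \<longleftrightarrow> \<not> unstable_pair A B"
    by (rule well_curved_iff_not_unstable[OF A B assms(2,3)])
  show ?thesis
    unfolding iff
    using stable_pair_estimate[OF grad A(1) B(1)] unstable_pair_no_estimate[OF grad A(1) B(1) assms(4)]
    by blast
qed

end
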